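(* Let $a_1,\dots,a_d$ be positive numbers and let $$\Omega=\Big\{(x_1,\dots,x_d)\in\mathbb{R}^d:\frac{x_1^2}{a_1^2}+\cdots+\frac{x_d^2}{a_d^2}<1\Big\}$$ be an ellipsoid. Then for every entire function $f$ on $\mathbb{C}^d$, the solution $h$ of the Dirichlet problem for $\Omega$ with data function $f$ (restricted to the boundary $\partial\Omega$) has a harmonic continuation to $\mathbb{R}^d$ and hence a continuation to an entire function on $\mathbb{C}^d$. Furthermore, denoting this extension also by $h$, we have $\rho(h)\le\rho(f)$, and if $0<\rho(h)=\rho(f)<\infty$, then $\tau(h)\le\tau(f)$.
   Context: $d$ is a positive integer. The solution of the Dirichlet problem for $\Omega$ with data $f$ is the function $h$ continuous on $\overline{\Omega}$, harmonic in $\Omega$, with $h=f$ on $\partial\Omega$. An entire function is a holomorphic function $f:\mathbb{C}^d\to\mathbb{C}$, and is also viewed as a function on $\mathbb{R}^d$ by restriction. Order and type: let $\mathbb{S}^{d-1}=\{\theta\in\mathbb{R}^d:|\theta|=1\}$ and for $r>0$ put $M(f,r)=\sup\{|f(\zeta\theta)|:\zeta\in\mathbb{C},|\zeta|=r,\theta\in\mathbb{S}^{d-1}\}$. The order of a non-constant entire function $f$ is $\rho(f)=\limsup_{r\to\infty}\frac{\log\log M(f,r)}{\log r}\in[0,\infty]$; constant functions are regarded as having order $0$. If $0<\rho(f)<\infty$, the type of $f$ is $\tau(f)=\limsup_{r\to\infty}\frac{\log M(f,r)}{r^{\rho(f)}}\in[0,\infty]$. *)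

theory Defs
  imports "HOL-Analysis.Analysis"
begin

definition ellipsoid :: "real ^ 'n \<Rightarrow> (real ^ 'n) set" where
  "ellipsoid a = {x. (\<Sum>i\<in>UNIV. (x $ i)\<^sup>2 / (a $ i)\<^sup>2) < 1}"

definition partial_deriv ::
    "'a::euclidean_space \<Rightarrow> ('a \<Rightarrow> complex) \<Rightarrow> 'a \<Rightarrow> complex" where
  "partial_deriv b u x = vector_derivative (\<lambda>t::real. u (x + t *\<^sub>R b)) (at 0)"

definition C1_on :: "'a::euclidean_space set \<Rightarrow> ('a \<Rightarrow> complex) \<Rightarrow> bool" where
  "C1_on S u \<longleftrightarrow>
     (\<forall>b\<in>Basis. (\<forall>x\<in>S. (\<lambda>t::real. u (x + t *\<^sub>R b)) differentiable (at 0))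
        \<and> continuous_on S (partial_deriv b u))"

definition C2_on :: "'a::euclidean_space set \<Rightarrow> ('a \<Rightarrow> complex) \<Rightarrow> bool" where
  "C2_on S u \<longleftrightarrow> C1_on S u \<and> (\<forall>b\<in>Basis. C1_on S (partial_deriv b u))"

definition laplacian :: "('a::euclidean_space \<Rightarrow> complex) \<Rightarrow> 'a \<Rightarrow> complex" where
  "laplacian u x = (\<Sum>b\<in>Basis. partial_deriv b (partial_deriv b u) x)"

definition harmonic_on :: "'a::euclidean_space set \<Rightarrow> ('a \<Rightarrow> complex) \<Rightarrow> bool" where
  "harmonic_on S u \<longleftrightarrow> open S \<and> C2_on S u \<and> (\<forall>x\<in>S. laplacian u x = 0)"

text \<open>Only the values of \<open>h\<close> on the closure of \<open>S\<close> matter.\<close>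

definition dirichlet_solution ::
    "'a::euclidean_space set \<Rightarrow> ('a \<Rightarrow> complex) \<Rightarrow> ('a \<Rightarrow> complex) \<Rightarrow> bool" where
  "dirichlet_solution S f h \<longleftrightarrow>
     continuous_on (closure S) h \<and> harmonic_on S h \<and> (\<forall>x\<in>frontier S. h x = f x)"

text \<open>Holomorphy in several variables: the real Frechet derivative exists
  everywhere and is complex linear.\<close>

definition entire :: "(complex ^ 'n \<Rightarrow> complex) \<Rightarrow> bool" where
  "entire f \<longleftrightarrow>
     (\<forall>z. \<exists>f'. (f has_derivative f') (at z) \<and> (\<forall>c v. f' (c *s v) = c * f' v))"

definition complex_vec :: "real ^ 'n \<Rightarrow> complex ^ 'n" where
  "complex_vec x = (\<chi> i. complex_of_real (x $ i))"

definition max_modulus :: "(complex ^ 'n \<Rightarrow> complex) \<Rightarrow> real \<Rightarrow> real" where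
  "max_modulus f r =
     Sup {cmod (f (\<zeta> *s complex_vec \<theta>)) | \<zeta> \<theta>. cmod \<zeta> = r \<and> norm \<theta> = 1}"

text \<open>For a non-constant entire function the maximum modulus tends to infinity, so the
  iterated real logarithm below is evaluated, for all large radii, at arguments greater
  than 1; the value of \<open>ln\<close> outside its natural domain plays no role.\<close>

definition growth_order :: "(complex ^ 'n \<Rightarrow> complex) \<Rightarrow> ereal" where
  "growth_order f =
     (if f constant_on UNIV then 0
      else Limsup at_top (\<lambda>r. ereal (ln (ln (max_modulus f r)) / ln r)))"

text \<open>Meaningful only if the order is positive and finite.\<close>

definition growth_type :: "(complex ^ 'n \<Rightarrow> complex) \<Rightarrow> ereal" where
  "growth_type f =
     Limsup at_top (\<lambda>r. ereal (ln (max_modulus f r) / r powr real_of_ereal (growth_order f)))"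

end

theory Submission
  imports Defs "HOL-Complex_Analysis.Cauchy_Integral_Formula" "HOL-Probability.Probability" "HOL-Real_Asymp.Real_Asymp"
begin

text \<open>Let \<open>P\<close> be the quadratic form \<open>\<Sum>i. x\<^sub>i\<^sup>2 / a\<^sub>i\<^sup>2\<close>, which equals 1 on the boundary.
  A homogeneous polynomial \<open>f\<close> of degree \<open>m\<close> is written as \<open>h + P q\<close> with \<open>h\<close> harmonic, where \<open>q\<close>
  is found from the normal equations: \<open>P q - f\<close> is orthogonal to all polynomials of degree
  \<open>m - 2\<close> for the Gaussian weight. Since \<open>P\<close> dominates a multiple \<open>lo |x|\<^sup>2\<close>, testing with \<open>q\<close> itself
  bounds \<open>q\<close> by \<open>f / lo\<close> in the \<open>L\<^sup>2\<close> norm of the sphere, uniformly in \<open>m\<close>. On the boundary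
  \<open>f = h + q\<close>, and iterating with \<open>q\<close> in place of \<open>f\<close> gives harmonic polynomials of degrees
  \<open>m - 2 j\<close> and size \<open>O(lo\<^sup>-\<^sup>j)\<close> that sum to \<open>f\<close> on the boundary. On the sphere of radius \<open>r\<close> they form
  a geometric series of ratio \<open>1 / (lo r\<^sup>2)\<close>, so for large \<open>r\<close> the whole sum is as small as its first term.
  For harmonic polynomials the supremum on the sphere exceeds the \<open>L\<^sup>2\<close> norm by at most a factor
  polynomial in the degree. Summing over the homogeneous parts of an entire \<open>f\<close> yields
  \<open>M(h, r) \<le> C M(f, t r)\<close> for every \<open>t > 1\<close>, which controls order and type.\<close>

section \<open>Entire functions of several variables\<close>

text \<open>The Gaussian weight is preferred to surface measure because its moments factor over the
  coordinates and integration by parts has no boundary terms, so means of polynomials become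
  algebra. The radial part of a mean depends on the degree alone; dividing it out recovers the norm
  of the sphere. The obstacle is the sharpness of constants. A factor \<open>c ^ m\<close> with
  fixed \<open>c > 1\<close> in degree \<open>m\<close> would enlarge the radius in
  \<open>M(f, t r)\<close> by \<open>c\<close>: harmless for the order, fatal for the type.
  Evaluating a harmonic polynomial at arbitrary complex points does cost such a factor, so that
  estimate serves only to prove convergence on all of C^d. The maximum modulus, however, sees only
  complex multiples of real unit vectors, where homogeneity reduces to real points and the loss is
  polynomial. The dilation \<open>t > 1\<close> is spent twice: one factor \<open>sqrt t\<close>
  absorbs the polynomial loss, the other makes the sum over the degrees converge.\<close>

definition pd :: "'n::finite \<Rightarrow> (complex ^ 'n \<Rightarrow> complex) \<Rightarrow> complex ^ 'n \<Rightarrow> complex" where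
  "pd i F z = deriv (\<lambda>t. F (z + t *s axis i 1)) 0"

definition lap :: "(complex ^ 'n::finite \<Rightarrow> complex) \<Rightarrow> complex ^ 'n \<Rightarrow> complex" where
  "lap F z = (\<Sum>i\<in>UNIV. pd i (pd i F) z)"

lemma norm_vector_scalar_mult: "norm (c *s z) = cmod c * norm (z :: complex ^ 'n)"
  by (simp add: norm_vec_def L2_set_def norm_mult power_mult_distrib flip: sum_distrib_left)
    (simp add: real_sqrt_mult)

lemma vector_scalar_mult_sum_axis: "(v :: complex ^ 'n) = (\<Sum>i\<in>UNIV. (v $ i) *s axis i 1)"
  by (simp add: vec_eq_iff sum_component axis_def if_distrib cong: if_cong)

lemma bounded_linear_scalar_line: "bounded_linear (\<lambda>c :: complex. c *s (z :: complex ^ 'n))"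
proof
  show "\<exists>K. \<forall>x. norm (x *s z) \<le> norm x * K"
    by (intro exI[of _ "norm z"]) (simp add: norm_vector_scalar_mult)
qed (simp_all add: vec_eq_iff algebra_simps)

lemma has_derivative_line:
  fixes F :: "complex ^ 'n \<Rightarrow> complex"
  assumes "(F has_derivative F') (at (z + t *s v))" "\<And>c w. F' (c *s w) = c * F' w"
  shows "((\<lambda>t. F (z + t *s v)) has_field_derivative F' v) (at t)"
proof -
  have "((\<lambda>t. z + t *s v) has_derivative (\<lambda>t. t *s v)) (at t)"
    using has_derivative_add[OF has_derivative_const[of z]
        bounded_linear_imp_has_derivative[OF bounded_linear_scalar_line[of v]]]
    by simp
  from has_derivative_compose[OF this assms(1)]
  show ?thesis
    by (rule has_derivative_imp_has_field_derivative) (simp add: assms(2) mult.commute)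
qed

lemma entire_has_derivative:
  assumes "entire F"
  shows "(F has_derivative (\<lambda>v. \<Sum>i\<in>UNIV. v $ i * pd i F z)) (at z)"
proof -
  obtain F' where F': "(F has_derivative F') (at z)" "\<And>c v. F' (c *s v) = c * F' v"
    using assms unfolding entire_def by blast
  have *: "pd i F z = F' (axis i 1)" for i
    unfolding pd_def using has_derivative_line[of F F' z 0 "axis i 1"] F' by (auto intro: DERIV_imp_deriv)
  have **: "F' v = (\<Sum>i\<in>UNIV. v $ i * F' (axis i 1))" for v
    by (subst vector_scalar_mult_sum_axis[of v])
      (simp add: linear_sum[OF has_derivative_linear[OF F'(1)]] F'(2))
  have "F' = (\<lambda>v. \<Sum>i\<in>UNIV. v $ i * pd i F z)"
    by (rule ext, simp only: *, rule **)
  with F'(1) show ?thesis by simp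
qed

lemma entireI:
  assumes "\<And>z. (F has_derivative (\<lambda>v. \<Sum>i\<in>UNIV. v $ i * D i z)) (at z)"
  shows "entire F"
  unfolding entire_def
  by (intro allI exI conjI, rule assms) (simp add: sum_distrib_left mult.assoc)

lemma pd_eqI:
  assumes "(F has_derivative (\<lambda>v. \<Sum>i\<in>UNIV. v $ i * D i)) (at z)"
  shows "pd i F z = D i"
proof -
  have "((\<lambda>t. F (z + t *s axis i 1)) has_field_derivative (\<Sum>j\<in>UNIV. axis i 1 $ j * D j)) (at 0)"
    by (rule has_derivative_line[where F' = "\<lambda>v. \<Sum>i\<in>UNIV. v $ i * D i"])
      (use assms in \<open>simp_all add: sum_distrib_left mult.assoc\<close>)
  then show ?thesis
    unfolding pd_def by (simp add: DERIV_imp_deriv axis_def if_distrib[of "\<lambda>x. x * _"] cong: if_cong)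
qed

lemma entire_line_deriv:
  assumes "entire F"
  shows "((\<lambda>t. F (z + t *s v)) has_field_derivative (\<Sum>i\<in>UNIV. v $ i * pd i F (z + t *s v))) (at t)"
  by (rule has_derivative_line[where F' = "\<lambda>w. \<Sum>i\<in>UNIV. w $ i * pd i F (z + t *s v)"])
     (use entire_has_derivative[OF assms] in \<open>simp_all add: sum_distrib_left mult.assoc\<close>)

lemma entire_line_holomorphic: "entire F \<Longrightarrow> (\<lambda>t. F (z + t *s v)) holomorphic_on S"
  unfolding holomorphic_on_def field_differentiable_def
  using entire_line_deriv by (blast intro: has_field_derivative_at_within)

lemma entire_continuous: "entire F \<Longrightarrow> continuous_on S F"
  by (meson entire_has_derivative has_derivative_continuous continuous_at_imp_continuous_on)

lemma entire_const [simp]: "entire (\<lambda>z. c)"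
  and pd_const [simp]: "pd i (\<lambda>z. c) = (\<lambda>z. 0)"
proof -
  have *: "((\<lambda>z::complex^'n. c) has_derivative (\<lambda>v. \<Sum>i\<in>UNIV. v $ i * 0)) (at z)" for z
    by simp
  show "entire (\<lambda>z :: complex^'n. c)" by (rule entireI[where D="\<lambda>_ _. 0"], rule *)
  show "pd i (\<lambda>z. c) = (\<lambda>z. 0)" by (rule ext, rule pd_eqI[where D="\<lambda>_. 0"], rule *)
qed

lemma
  assumes "entire F" "entire G"
  shows entire_add: "entire (\<lambda>z. F z + G z)"
    and pd_add: "pd i (\<lambda>z. F z + G z) z = pd i F z + pd i G z"
    and entire_mult: "entire (\<lambda>z. F z * G z)"
    and pd_mult: "pd i (\<lambda>z. F z * G z) z = pd i F z * G z + F z * pd i G z"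
proof -
  have *: "((\<lambda>z. F z + G z) has_derivative (\<lambda>v. \<Sum>i\<in>UNIV. v $ i * (pd i F z + pd i G z))) (at z)" for z
    using has_derivative_add[OF assms[THEN entire_has_derivative]]
    by (simp add: algebra_simps sum.distrib)
  have **: "((\<lambda>z. F z * G z) has_derivative
      (\<lambda>v. \<Sum>i\<in>UNIV. v $ i * (pd i F z * G z + F z * pd i G z))) (at z)" for z
    by (rule has_derivative_eq_rhs, rule has_derivative_mult[OF assms[THEN entire_has_derivative]])
      (simp add: fun_eq_iff algebra_simps sum.distrib sum_distrib_left)
  show "entire (\<lambda>z. F z + G z)"
    by (rule entireI, rule *)
  show "entire (\<lambda>z. F z * G z)"
    by (rule entireI, rule **)
  show "pd i (\<lambda>z. F z + G z) z = pd i F z + pd i G z"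
    by (rule pd_eqI[OF *])
  show "pd i (\<lambda>z. F z * G z) z = pd i F z * G z + F z * pd i G z"
    by (rule pd_eqI[OF **])
qed

lemma entire_cmult: "entire F \<Longrightarrow> entire (\<lambda>z. c * F z)"
  and pd_cmult: "entire F \<Longrightarrow> pd i (\<lambda>z. c * F z) z = c * pd i F z"
  using entire_mult[OF entire_const, of F c] pd_mult[OF entire_const, of F i c] by simp_all

lemma
  assumes "entire F" "entire G"
  shows entire_diff: "entire (\<lambda>z. F z - G z)"
    and pd_diff: "pd i (\<lambda>z. F z - G z) z = pd i F z - pd i G z"
  using entire_add[OF assms(1) entire_cmult[OF assms(2), of "-1"]]
    pd_add[OF assms(1) entire_cmult[OF assms(2), of "-1"], of i z]
  pd_cmult[OF assms(2), of i "-1" z] by simp_all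

lemma entire_sum: "(\<And>k. k \<in> A \<Longrightarrow> entire (F k)) \<Longrightarrow> entire (\<lambda>z. \<Sum>k\<in>A. F k z)"
  by (induction A rule: infinite_finite_induct) (auto intro: entire_add)

lemma pd_sum:
  "(\<And>k. k \<in> A \<Longrightarrow> entire (F k)) \<Longrightarrow> pd i (\<lambda>z. \<Sum>k\<in>A. F k z) z = (\<Sum>k\<in>A. pd i (F k) z)"
  by (induction A rule: infinite_finite_induct) (auto simp: pd_add entire_sum)

lemma entire_component: "entire (\<lambda>z :: complex ^ 'n. z $ i)"
  and pd_component: "pd j (\<lambda>z :: complex ^ 'n. z $ i) z = (if i = j then 1 else 0)"
proof -
  have *: "((\<lambda>z :: complex ^ 'n. z $ i) has_derivative
      (\<lambda>v. \<Sum>j\<in>UNIV. v $ j * (if i = j then 1 else 0))) (at z)" for z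
    by (rule has_derivative_eq_rhs, rule bounded_linear_imp_has_derivative, rule bounded_linear_vec_nth)
      (simp add: fun_eq_iff if_distrib cong: if_cong)
  show "entire (\<lambda>z :: complex ^ 'n. z $ i)"
    by (rule entireI, rule *)
  show "pd j (\<lambda>z :: complex ^ 'n. z $ i) z = (if i = j then 1 else 0)"
    using pd_eqI[OF *] by auto
qed

lemma entire_power: "entire F \<Longrightarrow> entire (\<lambda>z. F z ^ n)"
  by (induction n) (auto intro: entire_mult)

lemma entire_prod: "(\<And>k. k \<in> A \<Longrightarrow> entire (F k)) \<Longrightarrow> entire (\<lambda>z. \<Prod>k\<in>A. F k z)"
  by (induction A rule: infinite_finite_induct) (auto intro: entire_mult)

lemma pd_power_Suc:
  assumes "entire F"
  shows "pd i (\<lambda>z. F z ^ Suc n) z = of_nat (Suc n) * F z ^ n * pd i F z"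
proof (induction n)
  case (Suc n)
  have "pd i (\<lambda>z. F z ^ Suc (Suc n)) z = pd i (\<lambda>z. F z * F z ^ Suc n) z" by simp
  also have "\<dots> = pd i F z * F z ^ Suc n + F z * (of_nat (Suc n) * F z ^ n * pd i F z)"
    by (subst pd_mult) (use assms in \<open>auto simp: entire_power Suc.IH simp del: power_Suc\<close>)
  finally show ?case by (simp add: algebra_simps)
qed simp

text \<open>The Cauchy inequality on the unit circle of the coordinate line through
  \<open>z\<close>. Its radius 1 is why bounds over radius \<open>R + 1\<close> give bounds on
  derivatives over radius \<open>R\<close> below.\<close>

lemma pd_Cauchy:
  assumes "entire F" "\<And>\<zeta>. cmod \<zeta> = 1 \<Longrightarrow> cmod (F (z + \<zeta> *s axis i 1)) \<le> B"
  shows "cmod (pd i F z) \<le> B"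
proof -
  have "cmod ((deriv ^^ 1) (\<lambda>t. F (z + t *s axis i 1)) 0) \<le> fact 1 * B / 1 ^ 1"
    by (rule Cauchy_inequality)
      (auto intro!: entire_line_holomorphic assms holomorphic_on_imp_continuous_on)
  then show ?thesis by (simp add: pd_def)
qed

lemma uniform_limit_pd:
  assumes "\<And>n. entire (F n)" "entire G" "\<And>R. uniform_limit (cball 0 R) F G sequentially"
  shows "uniform_limit (cball 0 R) (\<lambda>n. pd i (F n)) (pd i G) sequentially"
proof (rule uniform_limitI)
  fix e :: real assume "e > 0"
  have "\<forall>\<^sub>F n in sequentially. \<forall>x\<in>cball 0 (R + 1). dist (F n x) (G x) < e / 2"
    using uniform_limitD[OF assms(3), of "e / 2"] \<open>e > 0\<close> by simp
  then show "\<forall>\<^sub>F n in sequentially. \<forall>x\<in>cball 0 R. dist (pd i (F n) x) (pd i G x) < e"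
  proof (rule eventually_mono)
    fix n assume *: "\<forall>x\<in>cball 0 (R + 1). dist (F n x) (G x) < e / 2"
    have "cmod (pd i (\<lambda>z. F n z - G z) x) \<le> e / 2" if "norm x \<le> R" for x
    proof (rule pd_Cauchy)
      fix \<zeta> :: complex assume "cmod \<zeta> = 1"
      then have "norm (x + \<zeta> *s axis i 1) \<le> R + 1"
        using that by (intro norm_triangle_le) (simp add: norm_vector_scalar_mult)
      with * show "cmod (F n (x + \<zeta> *s axis i 1) - G (x + \<zeta> *s axis i 1)) \<le> e / 2"
        by (force simp: dist_norm)
    qed (use assms in \<open>auto intro: entire_diff\<close>)
    with \<open>e > 0\<close> show "\<forall>x\<in>cball 0 R. dist (pd i (F n) x) (pd i G x) < e"
      by (force simp: dist_norm pd_diff assms)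
  qed
qed

text \<open>\<open>pd_Cauchy\<close> applied to the differences \<open>F m - F n\<close> makes all
  partial derivatives locally uniformly Cauchy. The Frechet derivatives then converge uniformly on a
  convex ball, so the limit is Frechet differentiable and its derivative inherits the complex linear
  form.\<close>

lemma entire_uniform_limit:
  fixes G :: "complex ^ 'n \<Rightarrow> complex"
  assumes ent: "\<And>n. entire (F n)" and lim: "\<And>R. uniform_limit (cball 0 R) F G sequentially"
  shows "entire G"
proof -
  have cau: "\<exists>N. \<forall>m\<ge>N. \<forall>n\<ge>N. \<forall>z\<in>cball 0 R. \<forall>i. cmod (pd i (F m) z - pd i (F n) z) \<le> e"
    if "e > 0" for e R
  proof -
    from lim[of "R + 1"] have "uniformly_Cauchy_on (cball 0 (R + 1)) F"
      using uniformly_convergent_Cauchy uniformly_convergent_on_def by blast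
    then obtain N where N: "\<And>m n z. m \<ge> N \<Longrightarrow> n \<ge> N \<Longrightarrow> norm z \<le> R + 1 \<Longrightarrow> dist (F m z) (F n z) < e"
      unfolding uniformly_Cauchy_on_def using \<open>e > 0\<close> mem_cball_0 by metis
    have "cmod (pd i (\<lambda>z. F m z - F n z) z) \<le> e" if "m \<ge> N" "n \<ge> N" "norm z \<le> R" for m n z i
    proof (rule pd_Cauchy)
      fix \<zeta> :: complex assume "cmod \<zeta> = 1"
      then have "norm (z + \<zeta> *s axis i 1) \<le> R + 1"
        using that by (intro norm_triangle_le) (simp add: norm_vector_scalar_mult)
      with N[OF that(1,2)] show "cmod (F m (z + \<zeta> *s axis i 1) - F n (z + \<zeta> *s axis i 1)) \<le> e"
        by (force simp: dist_norm)
    qed (use ent in \<open>auto intro: entire_diff\<close>)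
    then show ?thesis
      by (intro exI[of _ N]) (auto simp: pd_diff ent)
  qed
  define D where "D = (\<lambda>i z. lim (\<lambda>n. pd i (F n) z))"
  have D: "(\<lambda>n. pd i (F n) z) \<longlonglongrightarrow> D i z" for i z
    unfolding D_def
  proof (rule convergent_LIMSEQ_iff[THEN iffD1], rule Cauchy_convergent, rule metric_CauchyI)
    fix e :: real assume "e > 0"
    then obtain N where N: "\<forall>m\<ge>N. \<forall>n\<ge>N. \<forall>w\<in>cball 0 (norm z). \<forall>i. cmod (pd i (F m) w - pd i (F n) w) \<le> e / 2"
      using cau[of "e / 2" "norm z"] by auto
    have "dist (pd i (F m) z) (pd i (F n) z) < e" if "m \<ge> N" "n \<ge> N" for m n
    proof -
      have "cmod (pd i (F m) z - pd i (F n) z) \<le> e / 2" using N that by simp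
      then show ?thesis using \<open>e > 0\<close> by (simp add: dist_norm)
    qed
    then show "\<exists>M. \<forall>m\<ge>M. \<forall>n\<ge>M. dist (pd i (F m) z) (pd i (F n) z) < e"
      by blast
  qed
  have ev: "\<forall>\<^sub>F n in sequentially. \<forall>z\<in>cball 0 R. \<forall>i. cmod (pd i (F n) z - D i z) \<le> e"
    if "e > 0" for e R
  proof -
    obtain N where N: "\<forall>m\<ge>N. \<forall>n\<ge>N. \<forall>z\<in>cball 0 R. \<forall>i. cmod (pd i (F m) z - pd i (F n) z) \<le> e"
      using cau[OF \<open>e > 0\<close>] by blast
    have "cmod (pd i (F n) z - D i z) \<le> e" if "n \<ge> N" "z \<in> cball 0 R" for n z i
    proof (rule Lim_bounded[where M = N])
      show "(\<lambda>m. cmod (pd i (F n) z - pd i (F m) z)) \<longlonglongrightarrow> cmod (pd i (F n) z - D i z)"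
        by (intro tendsto_intros D)
    qed (use N that in auto)
    then show ?thesis
      unfolding eventually_sequentially by (intro exI[of _ N]) auto
  qed
  have "(G has_derivative (\<lambda>v. \<Sum>i\<in>UNIV. v $ i * D i z)) (at z)" for z
  proof -
    define S where "S = (ball 0 (norm z + 1) :: (complex ^ 'n) set)"
    have "\<exists>g. \<forall>x\<in>S. (\<lambda>n. F n x) \<longlonglongrightarrow> g x \<and>
        (g has_derivative (\<lambda>v. \<Sum>i\<in>UNIV. v $ i * D i x)) (at x within S)"
    proof (rule has_derivative_sequence[where f' = "\<lambda>n x v. \<Sum>i\<in>UNIV. v $ i * pd i (F n) x"])
      show "convex S" by (simp add: S_def)
      show "(F n has_derivative (\<lambda>v. \<Sum>i\<in>UNIV. v $ i * pd i (F n) x)) (at x within S)" for n x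
        by (rule has_derivative_at_withinI[OF entire_has_derivative[OF ent]])
      show "z \<in> S" by (simp add: S_def)
      show "(\<lambda>n. F n z) \<longlonglongrightarrow> G z"
        using tendsto_uniform_limitI[OF lim[of "norm z"]] by simp
      fix e :: real assume "e > 0"
      then have "e / real CARD('n) > 0" by simp
      from ev[OF this, of "norm z + 1"]
      show "\<forall>\<^sub>F n in sequentially. \<forall>x\<in>S. \<forall>h. cmod ((\<Sum>i\<in>UNIV. h $ i * pd i (F n) x) -
          (\<Sum>i\<in>UNIV. h $ i * D i x)) \<le> e * norm h"
      proof (rule eventually_mono, intro ballI allI)
        fix n x and h :: "complex ^ 'n"
        assume *: "\<forall>z\<in>cball 0 (norm z + 1). \<forall>i. cmod (pd i (F n) z - D i z) \<le> e / real CARD('n)"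
          and "x \<in> S"
        have "cmod ((\<Sum>i\<in>UNIV. h $ i * pd i (F n) x) - (\<Sum>i\<in>UNIV. h $ i * D i x)) =
            cmod (\<Sum>i\<in>UNIV. h $ i * (pd i (F n) x - D i x))"
          by (simp add: sum_subtractf right_diff_distrib)
        also have "\<dots> \<le> (\<Sum>i\<in>(UNIV::'n set). norm h * (e / real CARD('n)))"
        proof (rule sum_norm_le)
          fix i
          have "cmod (pd i (F n) x - D i x) \<le> e / real CARD('n)"
            using * \<open>x \<in> S\<close> by (simp add: S_def)
          then show "cmod (h $ i * (pd i (F n) x - D i x)) \<le> norm h * (e / real CARD('n))"
            unfolding norm_mult by (intro mult_mono Finite_Cartesian_Product.norm_nth_le) auto
        qed
        also have "\<dots> = e * norm h" by simp
        finally show "cmod ((\<Sum>i\<in>UNIV. h $ i * pd i (F n) x) - (\<Sum>i\<in>UNIV. h $ i * D i x)) \<le> e * norm h" .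
      qed
    qed
    then obtain g where g: "\<And>x. x \<in> S \<Longrightarrow> (\<lambda>n. F n x) \<longlonglongrightarrow> g x"
      "\<And>x. x \<in> S \<Longrightarrow> (g has_derivative (\<lambda>v. \<Sum>i\<in>UNIV. v $ i * D i x)) (at x within S)"
      by blast
    have "g x = G x" if "x \<in> S" for x
      using g(1)[OF that] tendsto_uniform_limitI[OF lim[of "norm x"], of x]
      by (auto intro: LIMSEQ_unique)
    note gG = this
    have zS: "z \<in> S" and "open S" by (auto simp: S_def)
    then have "(g has_derivative (\<lambda>v. \<Sum>i\<in>UNIV. v $ i * D i z)) (at z)"
      using g(2)[OF zS] at_within_open[OF zS] by simp
    then show ?thesis
      by (rule has_derivative_transform_within_open[OF _ \<open>open S\<close> zS]) (rule gG)
  qed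
  then show ?thesis by (rule entireI)
qed

text \<open>\<open>entire\<close> provides one derivative only, so the regularity of
  \<open>pd i F\<close> is not immediate. Difference quotients of \<open>F\<close> are entire as
  combinations of translates, and a second-order Taylor bound makes them converge to
  \<open>pd i F\<close> uniformly on balls.\<close>

lemma entire_pd:
  fixes F :: "complex ^ 'n \<Rightarrow> complex"
  assumes "entire F"
  shows "entire (pd i F)"
proof (rule entire_uniform_limit)
  define e :: "complex ^ 'n" where "e = axis i 1"
  define F' where "F' = (\<lambda>n z. of_nat (Suc n) * (F (z + (1 / of_nat (Suc n)) *s e) - F z))"
  have tr: "entire (\<lambda>z. F (z + c))" for c
  proof (rule entireI)
    fix z
    have "((\<lambda>z. z + c) has_derivative (\<lambda>v. v)) (at z)" by (auto intro!: derivative_eq_intros)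
    from has_derivative_compose[OF this entire_has_derivative[OF assms]]
    show "((\<lambda>z. F (z + c)) has_derivative (\<lambda>v. \<Sum>i\<in>UNIV. v $ i * pd i F (z + c))) (at z)" .
  qed
  show "entire (F' n)" for n
    unfolding F'_def by (intro entire_cmult entire_diff tr assms)
  fix R :: real
  \<comment> \<open>Radius \<open>R + 2\<close>: one unit for the step \<open>t\<close>, of modulus
    at most 1, and one for the Cauchy circle that bounds the second derivative.\<close>
  obtain B where B: "\<And>z. norm z \<le> R + 2 \<Longrightarrow> cmod (F z) \<le> B"
    using compact_imp_bounded[OF compact_continuous_image[OF entire_continuous[OF assms] compact_cball[of 0 "R + 2"]]]
    by (fastforce simp: bounded_iff)
  have key: "cmod (F' n z - pd i F z) \<le> 2 * B / real (Suc n)" if z: "norm z \<le> R" for n z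
  proof -
    define \<phi> where "\<phi> = (\<lambda>t. F (z + t *s e))"
    have hol: "\<phi> holomorphic_on S" for S
      unfolding \<phi>_def by (rule entire_line_holomorphic[OF assms])
    have d2: "cmod ((deriv ^^ 2) \<phi> w) \<le> 2 * B" if "cmod w \<le> 1" for w
    proof -
      have "cmod ((deriv ^^ 2) \<phi> w) \<le> fact 2 * B / 1 ^ 2"
      proof (rule Cauchy_inequality)
        fix x assume "cmod (w - x) = 1"
        then have "cmod x \<le> 2" using that norm_triangle_ineq2[of x w] by (simp add: norm_minus_commute)
        then have "norm (z + x *s e) \<le> R + 2"
          using z by (intro norm_triangle_le) (simp add: norm_vector_scalar_mult e_def)
        then show "cmod (\<phi> x) \<le> B" unfolding \<phi>_def by (rule B)
      qed (auto intro: hol holomorphic_on_imp_continuous_on)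
      then show ?thesis by simp
    qed
    define t :: complex where "t = 1 / of_nat (Suc n)"
    have ct: "cmod t = 1 / real (Suc n)" by (simp add: t_def norm_divide del: of_nat_Suc)
    have "cmod ((deriv ^^ 0) \<phi> t - (\<Sum>k\<le>1. (deriv ^^ k) \<phi> 0 * (t - 0) ^ k / fact k)) \<le> 2 * B * cmod (t - 0) ^ Suc 1 / fact 1"
    proof (rule complex_Taylor[where S = "cball 0 1" and f = "\<lambda>k. (deriv ^^ k) \<phi>"])
      fix k x assume "x \<in> cball (0::complex) 1"
      show "((deriv ^^ k) \<phi> has_field_derivative (deriv ^^ Suc k) \<phi> x) (at x within cball 0 1)"
        using holomorphic_derivI[OF holomorphic_higher_deriv[OF hol[of UNIV] open_UNIV] open_UNIV]
        by (auto intro: has_field_derivative_at_within)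
    next
      fix x assume "x \<in> cball (0::complex) 1"
      then show "cmod ((deriv ^^ Suc 1) \<phi> x) \<le> 2 * B"
        using d2 by (simp add: eval_nat_numeral)
    qed (auto simp: ct)
    moreover have "\<phi> 0 = F z" "deriv \<phi> 0 = pd i F z" "F' n z = (\<phi> t - \<phi> 0) / t"
      by (auto simp: \<phi>_def pd_def e_def F'_def t_def)
    ultimately have "cmod (\<phi> t - \<phi> 0 - pd i F z * t) \<le> 2 * B * cmod t ^ 2"
      by (simp add: eval_nat_numeral algebra_simps)
    moreover have "F' n z - pd i F z = (\<phi> t - \<phi> 0 - pd i F z * t) / t"
    proof -
      have "t \<noteq> 0" unfolding t_def by (simp del: of_nat_Suc)
      then show ?thesis using \<open>F' n z = _\<close> by (simp add: field_simps)
    qed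
    ultimately have "cmod (F' n z - pd i F z) \<le> 2 * B * cmod t ^ 2 / cmod t"
      by (simp add: norm_divide divide_right_mono)
    also have "\<dots> = 2 * B / real (Suc n)"
      by (simp add: power2_eq_square ct)
    finally show ?thesis .
  qed
  show "uniform_limit (cball 0 R) F' (pd i F) sequentially"
  proof (rule uniform_limitI)
    fix \<epsilon> :: real assume "\<epsilon> > 0"
    have "(\<lambda>n. 2 * B / real (Suc n)) \<longlonglongrightarrow> 0" by real_asymp
    then have "\<forall>\<^sub>F n in sequentially. 2 * B / real (Suc n) < \<epsilon>"
      using \<open>\<epsilon> > 0\<close> by (rule order_tendstoD)
    then show "\<forall>\<^sub>F n in sequentially. \<forall>x\<in>cball 0 R. dist (F' n x) (pd i F x) < \<epsilon>"
    proof (rule eventually_mono)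
      fix n assume "2 * B / real (Suc n) < \<epsilon>"
      then show "\<forall>x\<in>cball 0 R. dist (F' n x) (pd i F x) < \<epsilon>"
        using key[of _ n] by (force simp: dist_norm simp del: of_nat_Suc)
    qed
  qed
qed

section \<open>Homogeneous polynomials\<close>

text \<open>Generation from monomials gives induction on the shape of a polynomial and keeps the
  zero function in every degree, so sums and derivatives need no case distinction on
  vanishing.\<close>

inductive hpoly :: "nat \<Rightarrow> (complex ^ 'n::finite \<Rightarrow> complex) \<Rightarrow> bool" where
  monomial: "(\<Sum>i\<in>UNIV. \<alpha> i) = m \<Longrightarrow> hpoly m (\<lambda>z. c * (\<Prod>i\<in>UNIV. z $ i ^ \<alpha> i))"
| add: "hpoly m F \<Longrightarrow> hpoly m G \<Longrightarrow> hpoly m (\<lambda>z. F z + G z)"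

lemma hpoly_cmult: "hpoly m F \<Longrightarrow> hpoly m (\<lambda>z. c * F z)"
proof (induction rule: hpoly.induct)
  case (monomial \<alpha> m d)
  then show ?case using hpoly.monomial[of \<alpha> m "c * d"] by (simp add: mult.assoc)
next
  case (add m F G)
  then show ?case using hpoly.add by (simp add: distrib_left)
qed

lemma hpoly_0: "hpoly m (\<lambda>z. 0)"
  using hpoly.monomial[of "(\<lambda>_. 0)(undefined := m)" m 0] by simp

lemma hpoly_diff: "hpoly m F \<Longrightarrow> hpoly m G \<Longrightarrow> hpoly m (\<lambda>z. F z - G z)"
  using hpoly.add[of m F "\<lambda>z. - 1 * G z"] hpoly_cmult[of m G "-1"] by simp

lemma hpoly_sum: "(\<And>k. k \<in> A \<Longrightarrow> hpoly m (F k)) \<Longrightarrow> hpoly m (\<lambda>z. \<Sum>k\<in>A. F k z)"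
  by (induction A rule: infinite_finite_induct) (auto intro: hpoly_0 hpoly.add)

lemma hpoly_mult: "hpoly m F \<Longrightarrow> hpoly k G \<Longrightarrow> hpoly (m + k) (\<lambda>z. F z * G z)"
proof (induction rule: hpoly.induct)
  case (monomial \<alpha> m c)
  from monomial.prems monomial.hyps show ?case
  proof (induction rule: hpoly.induct)
    case (monomial \<beta> k d)
    then show ?case
      using hpoly.monomial[of "\<lambda>i. \<alpha> i + \<beta> i" "m + k" "c * d"]
      by (simp add: sum.distrib power_add prod.distrib mult_ac)
  next
    case (add k F G)
    then show ?case using hpoly.add by (simp add: distrib_left)
  qed
next
  case (add m F H)
  then show ?case using hpoly.add by (simp add: distrib_right)
qed

lemma hpoly_const: "hpoly 0 (\<lambda>z. c)"
  using hpoly.monomial[of "\<lambda>_. 0" 0 c] by simp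

lemma hpoly_component: "hpoly 1 (\<lambda>z :: complex ^ 'n. z $ i)"
proof -
  have "(\<Prod>j\<in>UNIV. z $ j ^ (if j = i then 1 else 0)) = z $ i" for z :: "complex ^ 'n"
    by (subst prod.cong[OF refl, of _ _ "\<lambda>j. if j = i then z $ i else 1"]) auto
  then show ?thesis
    using hpoly.monomial[of "\<lambda>j. if j = i then 1 else 0" 1 1] by simp
qed

lemma hpoly_component_mult: "hpoly m F \<Longrightarrow> hpoly (Suc m) (\<lambda>z. z $ i * F z)"
  using hpoly_mult[OF hpoly_component] by simp

lemma hpoly_power: "hpoly k F \<Longrightarrow> hpoly (k * n) (\<lambda>z. F z ^ n)"
  by (induction n) (auto intro: hpoly_const hpoly_mult)

lemma hpoly_linear: "hpoly 1 (\<lambda>x. \<Sum>i\<in>UNIV. x $ i * z $ i)"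
proof (rule hpoly_sum)
  fix i show "hpoly 1 (\<lambda>x. x $ i * z $ i)"
    using hpoly_cmult[OF hpoly_component, of "z $ i" i] by (simp add: mult.commute)
qed

lemma hpoly_entire: "hpoly m F \<Longrightarrow> entire F"
  by (induction rule: hpoly.induct)
    (auto intro!: entire_add entire_cmult entire_prod entire_power entire_component)

lemma hpoly_scale: "hpoly m F \<Longrightarrow> F (c *s z) = c ^ m * F z"
proof (induction rule: hpoly.induct)
  case (monomial \<alpha> m d)
  then show ?case
    by (auto simp: power_mult_distrib prod.distrib power_sum)
qed (simp add: distrib_left)

lemma pd_prod_component_power:
  "pd i (\<lambda>z :: complex ^ 'n. \<Prod>j\<in>UNIV. z $ j ^ \<alpha> j) z
    = of_nat (\<alpha> i) * (\<Prod>j\<in>UNIV. z $ j ^ (if j = i then \<alpha> i - 1 else \<alpha> j))"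
proof -
  have ent: "entire (\<lambda>z :: complex ^ 'n. \<Prod>j\<in>A. z $ j ^ \<alpha> j)" for A
    by (intro entire_prod entire_power entire_component)
  have 0: "pd i (\<lambda>z :: complex ^ 'n. \<Prod>j\<in>A. z $ j ^ \<alpha> j) z = 0" if "i \<notin> A" for A
    using finite[of A] that
  proof (induction A)
    case (insert j A)
    have "pd i (\<lambda>z :: complex ^ 'n. z $ j ^ \<alpha> j) z = 0"
      using insert.prems by (cases "\<alpha> j") (auto simp: pd_power_Suc entire_component pd_component simp del: power_Suc)
    with insert show ?case
      by (simp add: pd_mult ent entire_power entire_component)
  qed simp
  have 1: "pd i (\<lambda>z :: complex ^ 'n. z $ i ^ \<alpha> i) z = of_nat (\<alpha> i) * z $ i ^ (\<alpha> i - 1)"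
    by (cases "\<alpha> i") (simp_all add: pd_power_Suc entire_component pd_component del: power_Suc)
  have split: "(\<Prod>j\<in>UNIV. g j) = g i * (\<Prod>j\<in>UNIV - {i}. g j)" for g :: "'n \<Rightarrow> complex"
    by (rule prod.remove) auto
  have "(\<Prod>j\<in>UNIV. z $ j ^ (if j = i then \<alpha> i - 1 else \<alpha> j))
      = z $ i ^ (\<alpha> i - 1) * (\<Prod>j\<in>UNIV - {i}. z $ j ^ \<alpha> j)"
    by (subst split) (auto intro!: prod.cong)
  then show ?thesis
    unfolding split[of "\<lambda>j. _ $ j ^ \<alpha> j"]
    by (simp add: pd_mult ent entire_power entire_component 0 1)
qed

text \<open>In degree 0 the truncated \<open>m - 1\<close> is again 0; this is correct because the
  derivative vanishes and the zero function has every degree. The same convention carries over to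
  \<open>lap\<close>.\<close>

lemma hpoly_pd:
  fixes F :: "complex ^ 'n \<Rightarrow> complex"
  shows "hpoly m F \<Longrightarrow> hpoly (m - 1) (pd i F)"
proof (induction rule: hpoly.induct)
  case (monomial \<alpha> m c)
  have ent: "entire (\<lambda>z :: complex ^ 'n. \<Prod>j\<in>UNIV. z $ j ^ \<alpha> j)"
    by (intro entire_prod entire_power entire_component)
  show ?case
  proof (cases "\<alpha> i")
    case 0
    then show ?thesis
      by (simp add: pd_cmult[OF ent] pd_prod_component_power fun_eq_iff hpoly_0 cong: if_cong)
  next
    case (Suc k)
    have "(\<Sum>j\<in>UNIV. if j = i then \<alpha> i - 1 else \<alpha> j) = \<alpha> i - 1 + (\<Sum>j\<in>UNIV - {i}. \<alpha> j)"
      by (subst sum.remove[of _ i]) auto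
    moreover have "(\<Sum>j\<in>UNIV. \<alpha> j) = \<alpha> i + (\<Sum>j\<in>UNIV - {i}. \<alpha> j)"
      by (subst sum.remove[of _ i]) auto
    ultimately have "(\<Sum>j\<in>UNIV. if j = i then \<alpha> i - 1 else \<alpha> j) = m - 1"
      using monomial Suc by simp
    from hpoly.monomial[OF this, of "c * of_nat (\<alpha> i)"] show ?thesis
      by (simp add: pd_cmult[OF ent] pd_prod_component_power fun_eq_iff[of "pd i _"] mult.assoc
          cong: if_cong)
  qed
next
  case (add m F G)
  then have "pd i (\<lambda>z. F z + G z) = (\<lambda>z. pd i F z + pd i G z)"
    by (auto simp: pd_add hpoly_entire)
  with add show ?case by (auto intro: hpoly.add)
qed

lemma hpoly_pd_Suc: "hpoly (Suc m) F \<Longrightarrow> hpoly m (pd i F)"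
  using hpoly_pd by fastforce

lemma hpoly_0_pd: "hpoly 0 F \<Longrightarrow> pd i F = (\<lambda>z. 0)"
  by (induction "0::nat" F rule: hpoly.induct) (auto simp: pd_add hpoly_entire)

lemma Euler_homogeneous:
  fixes F :: "complex ^ 'n \<Rightarrow> complex"
  assumes "hpoly m F"
  shows "(\<Sum>i\<in>UNIV. z $ i * pd i F z) = of_nat m * F z"
  using assms
proof (induction rule: hpoly.induct)
  case (monomial \<alpha> m c)
  have ent: "entire (\<lambda>z :: complex ^ 'n. \<Prod>j\<in>UNIV. z $ j ^ \<alpha> j)"
    by (intro entire_prod entire_power entire_component)
  have *: "z $ i * (of_nat (\<alpha> i) * (\<Prod>j\<in>UNIV. z $ j ^ (if j = i then \<alpha> i - 1 else \<alpha> j)))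
      = of_nat (\<alpha> i) * (\<Prod>j\<in>UNIV. z $ j ^ \<alpha> j)" for i
  proof (cases "\<alpha> i")
    case (Suc k)
    have "(\<Prod>j\<in>UNIV. z $ j ^ \<alpha> j) = z $ i ^ \<alpha> i * (\<Prod>j\<in>UNIV - {i}. z $ j ^ \<alpha> j)"
      by (rule prod.remove) auto
    moreover have "(\<Prod>j\<in>UNIV. z $ j ^ (if j = i then \<alpha> i - 1 else \<alpha> j))
       = z $ i ^ (\<alpha> i - 1) * (\<Prod>j\<in>UNIV - {i}. z $ j ^ \<alpha> j)"
      by (subst prod.remove[of _ i]) (auto intro!: prod.cong)
    ultimately show ?thesis by (simp add: Suc)
  qed simp
  have "(\<Sum>i\<in>UNIV. z $ i * pd i (\<lambda>z. c * (\<Prod>j\<in>UNIV. z $ j ^ \<alpha> j)) z)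
     = (\<Sum>i\<in>UNIV. c * (of_nat (\<alpha> i) * (\<Prod>j\<in>UNIV. z $ j ^ \<alpha> j)))"
    by (simp only: pd_cmult[OF ent] pd_prod_component_power mult.left_commute[of _ c] *)
  also have "\<dots> = of_nat m * (c * (\<Prod>j\<in>UNIV. z $ j ^ \<alpha> j))"
    using monomial by (simp flip: sum_distrib_left sum_distrib_right of_nat_sum)
  finally show ?case .
next
  case (add m F G)
  then show ?case by (simp add: pd_add hpoly_entire distrib_left sum.distrib)
qed

lemma pd_commute:
  fixes F :: "complex ^ 'n \<Rightarrow> complex"
  shows "hpoly m F \<Longrightarrow> pd i (pd j F) z = pd j (pd i F) z"
proof (induction arbitrary: z rule: hpoly.induct)
  case (monomial \<alpha> m c)
  show ?case
  proof (cases "i = j")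
    case False
    have ent: "entire (\<lambda>z :: complex ^ 'n. \<Prod>j\<in>UNIV. z $ j ^ \<beta> j)" for \<beta>
      by (intro entire_prod entire_power entire_component)
    have pd: "pd i (\<lambda>z. d * (\<Prod>j\<in>UNIV. z $ j ^ \<beta> j)) =
        (\<lambda>z. (d * of_nat (\<beta> i)) * (\<Prod>j\<in>UNIV. z $ j ^ (if j = i then \<beta> i - 1 else \<beta> j)))" for i :: 'n and \<beta> d
      by (rule ext) (simp only: pd_cmult[OF ent] pd_prod_component_power mult.assoc)
    show ?thesis
      unfolding pd using False by (auto intro!: prod.cong)
  qed simp
next
  case (add m F G)
  have "pd i (\<lambda>z. F z + G z) = (\<lambda>z. pd i F z + pd i G z)" for i
    using add by (auto simp: pd_add hpoly_entire)
  with add show ?case by (simp add: pd_add entire_pd hpoly_entire)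
qed

lemma hpoly_lap: "hpoly m F \<Longrightarrow> hpoly (m - 2) (lap F)"
  unfolding lap_def[abs_def]
  by (intro hpoly_sum) (metis hpoly_pd diff_diff_left one_add_one)

lemma lap_hpoly_0: "hpoly 0 F \<Longrightarrow> lap F z = 0"
  by (simp add: lap_def hpoly_0_pd)

lemma lap_hpoly_1: "hpoly 1 F \<Longrightarrow> lap F z = 0"
  using hpoly_pd[of 1 F] by (simp add: lap_def hpoly_0_pd)

lemma lap_add:
  assumes "entire F" "entire G"
  shows "lap (\<lambda>z. F z + G z) z = lap F z + lap G z"
proof -
  have "pd i (\<lambda>z. F z + G z) = (\<lambda>z. pd i F z + pd i G z)" for i
    using assms by (auto simp: pd_add)
  then show "lap (\<lambda>z. F z + G z) z = lap F z + lap G z"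
    by (simp add: lap_def pd_add entire_pd assms sum.distrib)
qed

lemma lap_sum: "(\<And>k. k \<in> A \<Longrightarrow> entire (F k)) \<Longrightarrow> lap (\<lambda>z. \<Sum>k\<in>A. F k z) z = (\<Sum>k\<in>A. lap (F k) z)"
  by (induction A rule: infinite_finite_induct) (simp_all add: lap_add entire_sum, simp_all add: lap_def)

text \<open>Partial derivatives commute, so the Laplacian passes through \<open>pd i\<close>. This
  feeds the induction on the degree in \<open>harmonic_reproducing\<close>.\<close>

lemma lap_pd: "hpoly m F \<Longrightarrow> (\<And>z. lap F z = 0) \<Longrightarrow> lap (pd i F) z = 0"
proof -
  assume F: "hpoly m F" and 0: "\<And>z. lap F z = 0"
  have *: "pd j (pd i G) = pd i (pd j G)" if "hpoly k G" for j k G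
    using pd_commute[OF that] by auto
  have "lap (pd i F) z = (\<Sum>j\<in>UNIV. pd i (pd j (pd j F)) z)"
    unfolding lap_def by (simp add: *[OF F] *[OF hpoly_pd[OF F]])
  also have "\<dots> = pd i (lap F) z"
    unfolding lap_def[abs_def] by (simp add: pd_sum entire_pd hpoly_entire[OF F])
  also have "lap F = (\<lambda>z. 0)" using 0 by auto
  finally show ?thesis by simp
qed

subsection \<open>Homogeneous expansion of an entire function\<close>

definition dird :: "complex ^ 'n::finite \<Rightarrow> (complex ^ 'n \<Rightarrow> complex) \<Rightarrow> complex ^ 'n \<Rightarrow> complex" where
  "dird z F = (\<lambda>y. \<Sum>i\<in>UNIV. z $ i * pd i F y)"

text \<open>The \<open>m\<close>-th Taylor coefficient at \<open>t = 0\<close> of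
  \<open>F (t *s z)\<close>. Writing it by derivatives in the fixed direction \<open>z\<close>,
  rather than by \<open>deriv\<close>, exposes the polynomial dependence on
  \<open>z\<close>.\<close>

definition hpart :: "(complex ^ 'n::finite \<Rightarrow> complex) \<Rightarrow> nat \<Rightarrow> complex ^ 'n \<Rightarrow> complex" where
  "hpart F m z = (dird z ^^ m) F 0 / fact m"

lemma entire_dird: "entire F \<Longrightarrow> entire (dird z F)"
  unfolding dird_def by (intro entire_sum entire_cmult entire_pd)

lemma entire_dird_power: "entire F \<Longrightarrow> entire ((dird z ^^ m) F)"
  by (induction m) (auto intro: entire_dird)

lemma dird_power_sum:
  "finite A \<Longrightarrow> (\<And>i. i \<in> A \<Longrightarrow> entire (F i)) \<Longrightarrow>
    (dird z ^^ m) (\<lambda>y. \<Sum>i\<in>A. c i * F i y) = (\<lambda>y. \<Sum>i\<in>A. c i * (dird z ^^ m) (F i) y)"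
proof (induction m)
  case (Suc m)
  then have ent: "entire ((dird z ^^ m) (F i))" if "i \<in> A" for i
    using that by (intro entire_dird_power) auto
  have "(\<Sum>j\<in>UNIV. z $ j * pd j (\<lambda>y. \<Sum>i\<in>A. c i * (dird z ^^ m) (F i) y) y)
      = (\<Sum>i\<in>A. c i * (\<Sum>j\<in>UNIV. z $ j * pd j ((dird z ^^ m) (F i)) y))" for y
  proof -
    have "(\<Sum>j\<in>UNIV. z $ j * pd j (\<lambda>y. \<Sum>i\<in>A. c i * (dird z ^^ m) (F i) y) y)
        = (\<Sum>j\<in>UNIV. \<Sum>i\<in>A. c i * (z $ j * pd j ((dird z ^^ m) (F i)) y))"
      using ent by (simp add: pd_sum pd_cmult entire_cmult sum_distrib_left mult.left_commute)
    also have "\<dots> = (\<Sum>i\<in>A. c i * (\<Sum>j\<in>UNIV. z $ j * pd j ((dird z ^^ m) (F i)) y))"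
      by (subst sum.swap) (simp add: sum_distrib_left)
    finally show ?thesis .
  qed
  then have "dird z (\<lambda>y. \<Sum>i\<in>A. c i * (dird z ^^ m) (F i) y)
      = (\<lambda>y. \<Sum>i\<in>A. c i * dird z ((dird z ^^ m) (F i)) y)"
    unfolding dird_def[of z "\<lambda>y. \<Sum>i\<in>A. c i * _ i y"] by (simp add: dird_def)
  with Suc show ?case by simp
qed simp

text \<open>Splitting off the innermost derivative writes the iterate as a sum of
  \<open>z $ i\<close> times an iterate of order \<open>m\<close> of \<open>pd i F\<close>; hence
  the induction over all entire \<open>F\<close>.\<close>

lemma hpoly_dird_power: "entire F \<Longrightarrow> hpoly m (\<lambda>z. (dird z ^^ m) F y)"
proof (induction m arbitrary: F)
  case 0
  then show ?case by (simp add: hpoly_const)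
next
  case (Suc m)
  have "(dird z ^^ Suc m) F y = (\<Sum>i\<in>UNIV. z $ i * (dird z ^^ m) (pd i F) y)" for z
  proof -
    have "(dird z ^^ Suc m) F y = (dird z ^^ m) (\<lambda>y. \<Sum>i\<in>UNIV. z $ i * pd i F y) y"
      by (simp add: funpow_swap1 dird_def)
    also have "\<dots> = (\<Sum>i\<in>UNIV. z $ i * (dird z ^^ m) (pd i F) y)"
      by (subst dird_power_sum) (auto intro: entire_pd Suc.prems)
    finally show ?thesis .
  qed
  then show ?case
    using Suc by (auto intro!: hpoly_sum hpoly_component_mult entire_pd)
qed

lemma hpoly_hpart: "entire F \<Longrightarrow> hpoly m (hpart F m)"
  using hpoly_cmult[OF hpoly_dird_power[of F m 0], where c = "1 / fact m"] by (simp add: hpart_def[abs_def])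

lemma deriv_power_line:
  assumes "entire F"
  shows "(deriv ^^ m) (\<lambda>t. F (t *s z)) = (\<lambda>t. (dird z ^^ m) F (t *s z))"
proof (induction m)
  case (Suc m)
  have "deriv (\<lambda>t. (dird z ^^ m) F (t *s z)) t = dird z ((dird z ^^ m) F) (t *s z)" for t
    using entire_line_deriv[OF entire_dird_power[OF assms], where z = 0 and v = z and t = t]
    by (intro DERIV_imp_deriv) (simp add: dird_def)
  then show ?case using Suc by auto
qed simp

lemma entire_scale_holomorphic: "entire F \<Longrightarrow> (\<lambda>t. F (t *s z)) holomorphic_on S"
  using entire_line_holomorphic[of F 0 z S] by simp

lemma hpart_sums:
  assumes "entire F"
  shows "(\<lambda>m. hpart F m z) sums F z"
proof -
  \<comment> \<open>The Taylor series along the line is evaluated at \<open>t = 1\<close>; any disc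
    of radius above 1 would serve.\<close>
  have "(\<lambda>m. (deriv ^^ m) (\<lambda>t. F (t *s z)) 0 / fact m * (1 - 0) ^ m) sums F (1 *s z)"
    by (rule holomorphic_power_series[where r = 2]) (auto intro: entire_scale_holomorphic assms)
  then show ?thesis by (simp add: deriv_power_line[OF assms] hpart_def)
qed

lemma hpart_Cauchy:
  assumes "entire F" "r > 0" "\<And>\<zeta>. cmod \<zeta> = r \<Longrightarrow> cmod (F (\<zeta> *s z)) \<le> B"
  shows "cmod (hpart F m z) \<le> B / r ^ m"
proof -
  have "cmod ((deriv ^^ m) (\<lambda>t. F (t *s z)) 0) \<le> fact m * B / r ^ m"
    by (rule Cauchy_inequality)
      (auto intro!: entire_scale_holomorphic assms holomorphic_on_imp_continuous_on)
  then show ?thesis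
    by (simp add: deriv_power_line[OF assms(1)] hpart_def norm_divide field_simps)
qed

section \<open>Gaussian integration of homogeneous polynomials\<close>

definition gauss1 :: "real measure" where
  "gauss1 = density lborel std_normal_density"

definition gauss :: "('n::finite \<Rightarrow> real) measure" where
  "gauss = Pi\<^sub>M UNIV (\<lambda>_. gauss1)"

text \<open>The product measure lives on functions, not on vectors; this embeds its sample points as
  real points of complex space.\<close>

definition rpt :: "('n::finite \<Rightarrow> real) \<Rightarrow> complex ^ 'n" where
  "rpt \<omega> = (\<chi> i. complex_of_real (\<omega> i))"

definition gmean :: "(complex ^ 'n::finite \<Rightarrow> complex) \<Rightarrow> complex" where
  "gmean F = (\<integral>\<omega>. F (rpt \<omega>) \<partial>gauss)"

lemma rpt_nth [simp]: "rpt \<omega> $ i = of_real (\<omega> i)"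
  by (simp add: rpt_def)

lemma complex_vec_lambda [simp]: "complex_vec (\<chi> i. \<omega> i) = rpt \<omega>"
  by (simp add: rpt_def complex_vec_def vec_eq_iff)

definition gmom :: "nat \<Rightarrow> real" where
  "gmom k = (\<integral>x. x ^ k \<partial>gauss1)"

lemma prob_space_gauss1: "prob_space gauss1"
  unfolding gauss1_def by (rule prob_space_normal_density) simp

lemma integrable_gauss1: "integrable gauss1 (\<lambda>x. x ^ k)"
  unfolding gauss1_def
  by (subst integrable_density) (auto simp: integrable_std_normal_moment)

lemma gmom_eq: "gmom k = (\<integral>x. std_normal_density x * x ^ k \<partial>lborel)"
  unfolding gmom_def gauss1_def by (subst integral_density) auto

lemma gmom_0: "gmom 0 = 1"
  and gmom_1: "gmom (Suc 0) = 0"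
  using integral_std_normal_moment_even[of 0] integral_std_normal_moment_odd[of 0]
  by (simp_all add: gmom_eq)

lemma gmom_Suc: "gmom (Suc (Suc k)) = real (Suc k) * gmom k"
proof (cases "even k")
  case True
  then obtain j where k: "k = 2 * j" by blast
  then have "gmom k = fact (2 * j) / (2 ^ j * fact j)"
    "gmom (Suc (Suc k)) = fact (2 * Suc j) / (2 ^ Suc j * fact (Suc j))"
    using integral_std_normal_moment_even[of j] integral_std_normal_moment_even[of "Suc j"]
    by (simp_all add: gmom_eq)
  moreover have "fact (2 * Suc j) = (2 * real (Suc j)) * (real (Suc (2 * j)) * fact (2 * j))"
    "2 ^ Suc j * fact (Suc j) = (2 * real (Suc j)) * (2 ^ j * fact j)"
    by (simp_all add: algebra_simps)
  ultimately show ?thesis using k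
    by (simp only: mult_divide_mult_cancel_left_if) simp
next
  case False
  then obtain j where k: "k = 2 * j + 1" using oddE by blast
  then show ?thesis
    using integral_std_normal_moment_odd[of j] integral_std_normal_moment_odd[of "Suc j"]
    by (simp add: gmom_eq)
qed

lemma gmom_Stein: "gmom (Suc k) = real k * gmom (k - 1)"
  by (cases k) (simp_all add: gmom_1 gmom_Suc)

lemma
  fixes \<alpha> :: "'n::finite \<Rightarrow> nat"
  shows integrable_gauss_monomial:
      "integrable gauss (\<lambda>\<omega>. c * (\<Prod>i\<in>UNIV. rpt \<omega> $ i ^ \<alpha> i))"
    and gmean_monomial:
      "gmean (\<lambda>z. c * (\<Prod>i\<in>UNIV. z $ i ^ \<alpha> i)) = c * (\<Prod>i\<in>UNIV. of_real (gmom (\<alpha> i)))"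
proof -
  interpret product_prob_space "\<lambda>_::'n. gauss1" UNIV
    by (intro product_prob_spaceI prob_space_gauss1)
  have int: "integrable gauss1 (\<lambda>x. complex_of_real x ^ k)" for k
    using integrable_of_real[OF integrable_gauss1[of k], where 'a = complex] by simp
  show "integrable gauss (\<lambda>\<omega>. c * (\<Prod>i\<in>UNIV. rpt \<omega> $ i ^ \<alpha> i))"
    unfolding gauss_def rpt_nth
    by (intro integrable_mult_right product_integrable_prod[where f = "\<lambda>i x. complex_of_real x ^ \<alpha> i"] int) simp
  have "(\<integral>x. complex_of_real x ^ k \<partial>gauss1) = of_real (gmom k)" for k
    unfolding gmom_def of_real_power[symmetric] by (rule integral_complex_of_real)
  then show "gmean (\<lambda>z. c * (\<Prod>i\<in>UNIV. z $ i ^ \<alpha> i)) = c * (\<Prod>i\<in>UNIV. of_real (gmom (\<alpha> i)))"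
    unfolding gmean_def gauss_def rpt_nth integral_mult_right_zero
    by (subst product_integral_prod[where f = "\<lambda>i x. complex_of_real x ^ \<alpha> i"]) (auto intro: int)
qed

lemma hpoly_integrable: "hpoly m F \<Longrightarrow> integrable gauss (\<lambda>\<omega>. F (rpt \<omega>))"
  by (induction rule: hpoly.induct) (auto intro: integrable_gauss_monomial simp del: rpt_nth)

lemma gmean_add: "hpoly m F \<Longrightarrow> hpoly k G \<Longrightarrow> gmean (\<lambda>z. F z + G z) = gmean F + gmean G"
  by (simp add: gmean_def hpoly_integrable)

lemma gmean_diff: "hpoly m F \<Longrightarrow> hpoly k G \<Longrightarrow> gmean (\<lambda>z. F z - G z) = gmean F - gmean G"
  by (simp add: gmean_def hpoly_integrable)

lemma gmean_cmult: "gmean (\<lambda>z. c * F z) = c * gmean F"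
  by (simp add: gmean_def)

lemma gmean_0 [simp]: "gmean (\<lambda>z. 0) = 0"
  by (simp add: gmean_def)

lemma gmean_const: "gmean (\<lambda>z :: complex ^ 'n. c) = c"
  using gmean_monomial[of c "\<lambda>_::'n. 0"] by (simp add: gmom_0)

lemma gmean_sum:
  "(\<And>k. k \<in> A \<Longrightarrow> hpoly m (F k)) \<Longrightarrow> gmean (\<lambda>z. \<Sum>k\<in>A. F k z) = (\<Sum>k\<in>A. gmean (F k))"
  unfolding gmean_def by (rule Bochner_Integration.integral_sum) (rule hpoly_integrable)

lemma gmean_mono:
  fixes F G :: "complex ^ 'n \<Rightarrow> complex"
  assumes "hpoly m F" "hpoly k G" "\<And>\<omega>. Re (F (rpt \<omega>)) \<le> Re (G (rpt \<omega>))"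
  shows "Re (gmean F) \<le> Re (gmean G)"
proof -
  have "Re (gmean F) = (\<integral>\<omega>. Re (F (rpt \<omega>)) \<partial>gauss)" if "hpoly m F"
    for m and F :: "complex ^ 'n \<Rightarrow> complex"
    unfolding gmean_def using hpoly_integrable[OF that] by simp
  moreover have "(\<integral>\<omega>. Re (F (rpt \<omega>)) \<partial>gauss) \<le> (\<integral>\<omega>. Re (G (rpt \<omega>)) \<partial>gauss)"
    by (intro integral_mono integrable_Re) (use assms in \<open>auto intro: hpoly_integrable\<close>)
  ultimately show ?thesis using assms(1,2) by simp
qed

text \<open>Gaussian integration by parts. On monomials it is the moment recursion
  \<open>gmom_Stein\<close> in coordinate \<open>i\<close>, which avoids any discussion of decay at
  infinity; linearity does the rest.\<close>

lemma gmean_Stein: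
  fixes F :: "complex ^ 'n \<Rightarrow> complex"
  assumes "hpoly m F"
  shows "gmean (\<lambda>z. z $ i * F z) = gmean (pd i F)"
  using assms
proof (induction rule: hpoly.induct)
  case (monomial \<alpha> m c)
  have ent: "entire (\<lambda>z :: complex ^ 'n. \<Prod>j\<in>UNIV. z $ j ^ \<alpha> j)"
    by (intro entire_prod entire_power entire_component)
  define R where "R = (\<Prod>j\<in>UNIV - {i}. complex_of_real (gmom (\<alpha> j)))"
  have rem: "(\<Prod>j\<in>UNIV. g j) = g i * (\<Prod>j\<in>UNIV - {i}. g j)" for g :: "'n \<Rightarrow> complex"
    by (rule prod.remove) auto
  have M: "(\<Prod>j\<in>UNIV. complex_of_real (gmom (if j = i then a else \<alpha> j))) = of_real (gmom a) * R" for a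
    unfolding rem R_def by (auto intro!: prod.cong)
  have "(\<Prod>j\<in>UNIV. z $ j ^ (if j = i then Suc (\<alpha> i) else \<alpha> j)) = z $ i * (\<Prod>j\<in>UNIV. z $ j ^ \<alpha> j)"
    for z :: "complex ^ 'n"
    unfolding rem by (simp add: mult.assoc)
  then have "(\<lambda>z :: complex ^ 'n. z $ i * (c * (\<Prod>j\<in>UNIV. z $ j ^ \<alpha> j)))
      = (\<lambda>z. c * (\<Prod>j\<in>UNIV. z $ j ^ (if j = i then Suc (\<alpha> i) else \<alpha> j)))"
    by (simp add: mult.left_commute)
  then have "gmean (\<lambda>z. z $ i * (c * (\<Prod>j\<in>UNIV. z $ j ^ \<alpha> j))) = c * (of_real (gmom (Suc (\<alpha> i))) * R)"
    by (simp only: gmean_monomial M)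
  moreover have "gmean (pd i (\<lambda>z. c * (\<Prod>j\<in>UNIV. z $ j ^ \<alpha> j)))
      = c * of_nat (\<alpha> i) * (of_real (gmom (\<alpha> i - 1)) * R)"
  proof -
    have "pd i (\<lambda>z. c * (\<Prod>j\<in>UNIV. z $ j ^ \<alpha> j))
        = (\<lambda>z. (c * of_nat (\<alpha> i)) * (\<Prod>j\<in>UNIV. z $ j ^ (if j = i then \<alpha> i - 1 else \<alpha> j)))"
      by (rule ext) (simp only: pd_cmult[OF ent] pd_prod_component_power mult.assoc)
    then show ?thesis
      by (simp only: gmean_monomial M)
  qed
  ultimately show ?case by (simp add: gmom_Stein)
next
  case (add m F G)
  have "pd i (\<lambda>z. F z + G z) = (\<lambda>z. pd i F z + pd i G z)"
    using add by (auto simp: pd_add hpoly_entire)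
  with add show ?case
    by (simp add: distrib_left gmean_add[OF hpoly_component_mult hpoly_component_mult] gmean_add[OF hpoly_pd hpoly_pd])
qed

lemma gmean_Stein2:
  assumes "hpoly m F" "hpoly k G"
  shows "gmean (\<lambda>z. z $ i * F z * G z) = gmean (\<lambda>z. pd i F z * G z) + gmean (\<lambda>z. F z * pd i G z)"
proof -
  have "gmean (\<lambda>z. z $ i * F z * G z) = gmean (pd i (\<lambda>z. F z * G z))"
    using gmean_Stein[OF hpoly_mult[OF assms], of i] by (simp add: mult.assoc)
  also have "pd i (\<lambda>z. F z * G z) = (\<lambda>z. pd i F z * G z + F z * pd i G z)"
    using assms by (auto simp: pd_mult hpoly_entire)
  finally show ?thesis
    by (simp add: gmean_add[OF hpoly_mult[OF hpoly_pd] hpoly_mult[OF _ hpoly_pd]] assms)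
       (subst gmean_add[OF hpoly_mult[OF hpoly_pd] hpoly_mult[OF _ hpoly_pd]], use assms in auto)
qed

section \<open>Gaussian means of powers of |x|^2 and the radial constants\<close>

definition sqn :: "complex ^ 'n::finite \<Rightarrow> complex" where
  "sqn z = (\<Sum>i\<in>UNIV. (z $ i)\<^sup>2)"

lemma hpoly_sqn: "hpoly 2 sqn"
  unfolding sqn_def[abs_def] using hpoly_power[OF hpoly_component, of 2] by (intro hpoly_sum) simp

lemma hpoly_sqn_mult: "hpoly m F \<Longrightarrow> hpoly (m + 2) (\<lambda>z. sqn z * F z)"
  using hpoly_mult[OF hpoly_sqn] by (simp add: add.commute)

text \<open>Stein's identity in each coordinate yields \<open>F\<close> once per coordinate plus the
  Euler operator, which acts as the degree \<open>m\<close>. This substitutes for polar coordinates: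
  the radial weight contributes only a scalar.\<close>

lemma gmean_sqn:
  fixes F :: "complex ^ 'n \<Rightarrow> complex"
  assumes F: "hpoly m F"
  shows "gmean (\<lambda>z. sqn z * F z) = of_nat (m + CARD('n)) * gmean F"
proof -
  have eq: "gmean (\<lambda>z. z $ i * (z $ i * F z)) = gmean (\<lambda>z. F z) + gmean (\<lambda>z. z $ i * pd i F z)" for i
  proof -
    have "pd i (\<lambda>z. z $ i * F z) = (\<lambda>z. F z + z $ i * pd i F z)"
      by (rule ext) (subst pd_mult, auto simp: entire_component pd_component hpoly_entire[OF F])
    moreover have "gmean (\<lambda>z. F z + z $ i * pd i F z) = gmean F + gmean (\<lambda>z. z $ i * pd i F z)"
      by (rule gmean_add[OF F hpoly_component_mult[OF hpoly_pd[OF F]]])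
    ultimately show ?thesis
      using gmean_Stein[OF hpoly_component_mult[OF F], of i i] by simp
  qed
  have "gmean (\<lambda>z. sqn z * F z) = gmean (\<lambda>z. \<Sum>i\<in>UNIV. z $ i * (z $ i * F z))"
    by (simp add: sqn_def power2_eq_square sum_distrib_right mult.assoc)
  also have "\<dots> = (\<Sum>i\<in>UNIV. gmean (\<lambda>z. z $ i * (z $ i * F z)))"
    by (intro gmean_sum[where m = "Suc (Suc m)"] hpoly_component_mult F)
  also have "\<dots> = of_nat CARD('n) * gmean F + (\<Sum>i\<in>UNIV. gmean (\<lambda>z. z $ i * pd i F z))"
    by (simp add: eq sum.distrib)
  also have "(\<Sum>i\<in>UNIV. gmean (\<lambda>z. z $ i * pd i F z)) = gmean (\<lambda>z. \<Sum>i\<in>UNIV. z $ i * pd i F z)"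
    by (intro gmean_sum[symmetric, where m = "Suc (m - 1)"] hpoly_component_mult hpoly_pd F)
  also have "\<dots> = of_nat m * gmean F"
    by (simp add: Euler_homogeneous[OF F] gmean_cmult)
  finally show ?thesis by (simp add: algebra_simps)
qed

text \<open>The moment of order \<open>2 m\<close> of \<open>|x|\<close> for a standard Gaussian
  vector in dimension \<open>d\<close>, that is \<open>d (d + 2) ... (d + 2 m - 2)\<close>; see
  \<open>gmean_sqn_power_1\<close>.\<close>

definition kap :: "nat \<Rightarrow> nat \<Rightarrow> real" where
  "kap d m = (\<Prod>i<m. real (d + 2 * i))"

lemma kap_0 [simp]: "kap d 0 = 1"
  and kap_Suc: "kap d (Suc m) = real (d + 2 * m) * kap d m"
  by (simp_all add: kap_def)

lemma kap_pos: "d > 0 \<Longrightarrow> kap d m > 0"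
  by (auto simp: kap_def intro!: prod_pos)

lemma gmean_sqn_power:
  fixes F :: "complex ^ 'n \<Rightarrow> complex"
  assumes F: "hpoly (2 * p) F"
  shows "gmean (\<lambda>z. sqn z ^ j * F z) * of_real (kap CARD('n) p) = of_real (kap CARD('n) (p + j)) * gmean F"
proof (induction j)
  case (Suc j)
  have "gmean (\<lambda>z. sqn z ^ Suc j * F z) = gmean (\<lambda>z. sqn z * (sqn z ^ j * F z))"
    by (simp add: mult.assoc)
  also have "\<dots> = of_nat (2 * j + 2 * p + CARD('n)) * gmean (\<lambda>z. sqn z ^ j * F z)"
    by (rule gmean_sqn[OF hpoly_mult[OF hpoly_power[OF hpoly_sqn] F]])
  finally show ?case using Suc by (simp add: kap_Suc algebra_simps)
qed simp

lemma gmean_sqn_power_1: "gmean (\<lambda>z :: complex ^ 'n. sqn z ^ j) = of_real (kap CARD('n) j)"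
proof -
  have "hpoly (2 * 0) (\<lambda>z :: complex ^ 'n. 1)" by (simp add: hpoly_const)
  from gmean_sqn_power[OF this, of j] show ?thesis by (simp add: gmean_const)
qed

text \<open>Conjugating the coefficients keeps polynomials polynomial and gives the conjugate on
  real points. Thus \<open>|F|^2\<close> is there a homogeneous polynomial, within reach of Stein's
  identity.\<close>

definition star :: "(complex ^ 'n::finite \<Rightarrow> complex) \<Rightarrow> complex ^ 'n \<Rightarrow> complex" where
  "star F z = cnj (F (\<chi> i. cnj (z $ i)))"

lemma star_rpt [simp]: "star F (rpt \<omega>) = cnj (F (rpt \<omega>))"
  by (simp add: star_def rpt_def)

lemma hpoly_star: "hpoly m F \<Longrightarrow> hpoly m (star F)"
proof (induction rule: hpoly.induct)
  case (monomial \<alpha> m c)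
  then show ?case
    using hpoly.monomial[of \<alpha> m "cnj c"] by (simp add: star_def[abs_def])
next
  case (add m F G)
  then show ?case using hpoly.add[of m "star F" "star G"] by (simp add: star_def[abs_def])
qed

definition nsq :: "(complex ^ 'n::finite \<Rightarrow> complex) \<Rightarrow> real" where
  "nsq F = Re (gmean (\<lambda>z. F z * star F z))"

lemma gmean_cong: "(\<And>\<omega>. F (rpt \<omega>) = G (rpt \<omega>)) \<Longrightarrow> gmean F = gmean G"
  by (simp add: gmean_def)

lemma gmean_mult_star: "gmean (\<lambda>z. F z * star F z) = of_real (nsq F)"
proof -
  have "gmean (\<lambda>z. F z * star F z) = (\<integral>\<omega>. complex_of_real ((cmod (F (rpt \<omega>)))\<^sup>2) \<partial>gauss)"
    by (simp only: gmean_def star_rpt complex_norm_square)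
  then have "gmean (\<lambda>z. F z * star F z) = of_real (\<integral>\<omega>. (cmod (F (rpt \<omega>)))\<^sup>2 \<partial>gauss)"
    by (simp only: integral_complex_of_real)
  then show ?thesis by (simp add: nsq_def)
qed

lemma nsq_eq_integral: "nsq F = (\<integral>\<omega>. (cmod (F (rpt \<omega>)))\<^sup>2 \<partial>gauss)"
proof -
  have "gmean (\<lambda>z. F z * star F z) = (\<integral>\<omega>. complex_of_real ((cmod (F (rpt \<omega>)))\<^sup>2) \<partial>gauss)"
    by (simp only: gmean_def star_rpt complex_norm_square)
  then show ?thesis by (simp only: nsq_def integral_complex_of_real Re_complex_of_real)
qed

lemma nsq_nonneg: "nsq F \<ge> 0"
  by (simp add: nsq_eq_integral)

lemma nsq_integrable: "hpoly m F \<Longrightarrow> integrable gauss (\<lambda>\<omega>. (cmod (F (rpt \<omega>)))\<^sup>2)"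
proof -
  assume "hpoly m F"
  then have "integrable gauss (\<lambda>\<omega>. F (rpt \<omega>) * star F (rpt \<omega>))"
    by (intro hpoly_integrable[OF hpoly_mult[OF _ hpoly_star]])
  then have "integrable gauss (\<lambda>\<omega>. complex_of_real ((cmod (F (rpt \<omega>)))\<^sup>2))"
    by (simp only: star_rpt complex_norm_square)
  from integrable_Re[OF this] show ?thesis by (simp only: Re_complex_of_real)
qed

lemma nsq_star: "nsq (star F) = nsq F"
  by (simp add: nsq_eq_integral)

text \<open>The pairing is bilinear, without conjugation; \<open>nsq_star\<close> allows either
  factor to be conjugated. The pointwise inequality \<open>2 t |F G| \<le> t^2 |F|^2 + |G|^2\<close>
  is integrated and the real parameter \<open>t\<close> optimised afterwards.\<close>

lemma gmean_Cauchy_Schwarz: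
  assumes F: "hpoly m F" and G: "hpoly k G"
  shows "(cmod (gmean (\<lambda>z. F z * G z)))\<^sup>2 \<le> nsq F * nsq G"
proof -
  define c where "c = cmod (gmean (\<lambda>z. F z * G z))"
  have FG: "integrable gauss (\<lambda>\<omega>. F (rpt \<omega>) * G (rpt \<omega>))"
    by (rule hpoly_integrable[OF hpoly_mult[OF F G]])
  have *: "2 * t * c \<le> t\<^sup>2 * nsq F + nsq G" if "t \<ge> 0" for t
  proof -
    have "2 * t * c \<le> 2 * t * (\<integral>\<omega>. cmod (F (rpt \<omega>) * G (rpt \<omega>)) \<partial>gauss)"
      unfolding c_def gmean_def using that by (intro mult_left_mono integral_norm_bound) auto
    also have "\<dots> = (\<integral>\<omega>. 2 * t * cmod (F (rpt \<omega>) * G (rpt \<omega>)) \<partial>gauss)" by simp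
    also have "\<dots> \<le> (\<integral>\<omega>. t\<^sup>2 * (cmod (F (rpt \<omega>)))\<^sup>2 + (cmod (G (rpt \<omega>)))\<^sup>2 \<partial>gauss)"
    proof (intro integral_mono)
      show "integrable gauss (\<lambda>\<omega>. 2 * t * cmod (F (rpt \<omega>) * G (rpt \<omega>)))"
        using FG by auto
      show "integrable gauss (\<lambda>\<omega>. t\<^sup>2 * (cmod (F (rpt \<omega>)))\<^sup>2 + (cmod (G (rpt \<omega>)))\<^sup>2)"
        using nsq_integrable[OF F] nsq_integrable[OF G] by auto
      fix \<omega>
      show "2 * t * cmod (F (rpt \<omega>) * G (rpt \<omega>)) \<le> t\<^sup>2 * (cmod (F (rpt \<omega>)))\<^sup>2 + (cmod (G (rpt \<omega>)))\<^sup>2"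
        using sum_squares_bound[of "t * cmod (F (rpt \<omega>))" "cmod (G (rpt \<omega>))"]
        by (simp add: norm_mult power_mult_distrib mult.assoc)
    qed
    also have "\<dots> = t\<^sup>2 * nsq F + nsq G"
      using nsq_integrable[OF F] nsq_integrable[OF G] by (simp add: nsq_eq_integral)
    finally show ?thesis .
  qed
  have c: "c \<ge> 0" by (simp add: c_def)
  have "c\<^sup>2 \<le> nsq F * nsq G"
  proof (cases "nsq F = 0")
    case True
    have "c = 0"
    proof (rule ccontr)
      assume "c \<noteq> 0"
      with c have "c > 0" by simp
      \<comment> \<open>With \<open>nsq F = 0\<close> this \<open>t\<close> turns the inequality
        into \<open>nsq G + 1 \<le> nsq G\<close>.\<close>
      with *[of "(nsq G + 1) / (2 * c)"] True nsq_nonneg[of G] show False by (simp add: field_simps)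
    qed
    then show ?thesis using True by simp
  next
    case False
    then have pos: "nsq F > 0" using nsq_nonneg[of F] by simp
    with *[of "c / nsq F"] c have "2 * c\<^sup>2 / nsq F \<le> c\<^sup>2 / nsq F + nsq G"
      by (simp add: power2_eq_square field_simps)
    then have "c\<^sup>2 / nsq F \<le> nsq G" by (simp add: field_simps)
    with pos show ?thesis by (simp add: field_simps)
  qed
  then show ?thesis by (simp add: c_def)
qed

text \<open>Integration by parts shows that the derivatives of a polynomial of norm zero have norm zero as well.\<close>

lemma nsq_eq_0D: "hpoly m F \<Longrightarrow> nsq F = 0 \<Longrightarrow> F z = 0"
proof (induction m arbitrary: F z)
  case 0
  have "F w = F 0" for w
    using hpoly_scale[OF 0(1), of 0 w] by simp
  then have "F = (\<lambda>_. F 0)" by auto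
  with 0(2) have "nsq (\<lambda>_::complex^'a. F 0) = 0" by simp
  then have "F 0 * cnj (F 0) = 0"
    using gmean_mult_star[of "\<lambda>_::complex^'a. F 0"] by (simp add: star_def gmean_const)
  then show ?case using \<open>F z = F 0\<close> by simp
next
  case (Suc m)
  have orth: "gmean (\<lambda>z. F z * G z) = 0" if "hpoly k G" for k G
    using gmean_Cauchy_Schwarz[OF Suc.prems(1) that] Suc.prems(2) by simp
  have "pd i F z = 0" for i z
  proof (rule Suc.IH)
    show D: "hpoly m (pd i F)" by (rule hpoly_pd_Suc[OF Suc.prems(1)])
    have "gmean (\<lambda>z. pd i F z * star (pd i F) z) = 0"
      using gmean_Stein2[OF Suc.prems(1) hpoly_star[OF D], of i] orth[OF hpoly_pd[OF hpoly_star[OF D]]]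
        orth[OF hpoly_component_mult[OF hpoly_star[OF D]], of i] by (simp add: mult_ac)
    then show "nsq (pd i F) = 0" by (simp add: nsq_def)
  qed
  then have "of_nat (Suc m) * F z = 0"
    using Euler_homogeneous[OF Suc.prems(1), of z] by simp
  then show ?case by (simp del: of_nat_Suc)
qed

section \<open>The Fischer decomposition for a positive quadratic form\<close>

definition pharm :: "nat \<Rightarrow> (complex ^ 'n::finite \<Rightarrow> complex) \<Rightarrow> bool" where
  "pharm m F \<longleftrightarrow> hpoly m F \<and> (\<forall>z. lap F z = 0)"

definition qform :: "real ^ 'n \<Rightarrow> complex ^ 'n::finite \<Rightarrow> complex" where
  "qform a z = (\<Sum>i\<in>UNIV. (z $ i)\<^sup>2 / (of_real (a $ i))\<^sup>2)"

lemma hpoly_qform: "hpoly 2 (qform a)"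
proof -
  have "hpoly 2 (\<lambda>z. 1 / (of_real (a $ i))\<^sup>2 * (z $ i)\<^sup>2)" for i
    using hpoly_power[OF hpoly_component, of 2] by (intro hpoly_cmult) simp
  then have "hpoly 2 (\<lambda>z. \<Sum>i\<in>UNIV. 1 / (of_real (a $ i))\<^sup>2 * (z $ i)\<^sup>2)"
    by (rule hpoly_sum)
  then show ?thesis by (simp add: qform_def[abs_def])
qed

text \<open>Stein's identity moves the derivative off \<open>G\<close>; Euler's identity and the
  Laplacian of \<open>w\<close> collect what remains. The left side is symmetric in \<open>G\<close>
  and \<open>w\<close>, so exchanging them gives a Green identity.\<close>

lemma gmean_grad_grad:
  assumes G: "hpoly m G" and w: "hpoly k w"
  shows "(\<Sum>i\<in>UNIV. gmean (\<lambda>z. pd i G z * pd i w z)) =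
      of_nat k * gmean (\<lambda>z. G z * w z) - gmean (\<lambda>z. G z * lap w z)"
proof -
  have "gmean (\<lambda>z. pd i G z * pd i w z) =
      gmean (\<lambda>z. G z * (z $ i * pd i w z)) - gmean (\<lambda>z. G z * pd i (pd i w) z)" for i
    using gmean_Stein2[OF G hpoly_pd[OF w], of i i] by (simp add: mult_ac)
  then have "(\<Sum>i\<in>UNIV. gmean (\<lambda>z. pd i G z * pd i w z)) =
      (\<Sum>i\<in>UNIV. gmean (\<lambda>z. G z * (z $ i * pd i w z))) -
      (\<Sum>i\<in>UNIV. gmean (\<lambda>z. G z * pd i (pd i w) z))"
    by (simp add: sum_subtractf)
  also have "(\<Sum>i\<in>UNIV. gmean (\<lambda>z. G z * (z $ i * pd i w z))) =
      gmean (\<lambda>z. \<Sum>i\<in>UNIV. G z * (z $ i * pd i w z))"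
    by (rule gmean_sum[symmetric]) (rule hpoly_mult[OF G hpoly_component_mult[OF hpoly_pd[OF w]]])
  also have "\<dots> = gmean (\<lambda>z. of_nat k * (G z * w z))"
    by (simp add: Euler_homogeneous[OF w] mult.left_commute flip: sum_distrib_left)
  also have "\<dots> = of_nat k * gmean (\<lambda>z. G z * w z)"
    by (rule gmean_cmult)
  also have "(\<Sum>i\<in>UNIV. gmean (\<lambda>z. G z * pd i (pd i w) z)) = gmean (\<lambda>z. \<Sum>i\<in>UNIV. G z * pd i (pd i w) z)"
    by (rule gmean_sum[symmetric]) (rule hpoly_mult[OF G hpoly_pd[OF hpoly_pd[OF w]]])
  also have "\<dots> = gmean (\<lambda>z. G z * lap w z)"
    by (simp add: lap_def flip: sum_distrib_left)
  finally show ?thesis .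
qed

text \<open>If \<open>G\<close> is orthogonal to all of degree \<open>k\<close>, then so is \<open>lap G\<close>, which itself has degree \<open>k\<close>.\<close>

lemma orthogonal_imp_harmonic:
  fixes G :: "complex ^ 'n \<Rightarrow> complex"
  assumes G: "hpoly (k + 2) G" and orth: "\<And>v. hpoly k v \<Longrightarrow> gmean (\<lambda>z. G z * v z) = 0"
  shows "pharm (k + 2) G"
proof -
  have lapG: "hpoly k (lap G)" using hpoly_lap[OF G] by simp
  have 0: "gmean (\<lambda>z. G z * lap w z) = 0" if w: "hpoly k w" for w
  proof (cases "k < 2")
    case True
    then have "k = 0 \<or> k = 1" by auto
    with w have "lap w z = 0" for z
      using lap_hpoly_0[of w z] lap_hpoly_1[of w z] by auto
    then show ?thesis by simp
  next
    case False
    then obtain j where k: "k = j + 2" by (metis add.commute le_Suc_ex not_less)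
    have lapw: "hpoly j (lap w)" using hpoly_lap[OF w] k by simp
    \<comment> \<open>The degree of \<open>lap w\<close> is \<open>k - 2\<close>, too low for
      \<open>orth\<close>; the factor \<open>sqn\<close> lifts it to \<open>k\<close> and afterwards
      leaves only a nonzero scalar.\<close>
    have "gmean (\<lambda>z. G z * (sqn z * lap w z)) = 0"
      using orth hpoly_sqn_mult[OF lapw] k by simp
    moreover have "gmean (\<lambda>z. sqn z * (G z * lap w z)) =
        of_nat (k + 2 + j + CARD('n)) * gmean (\<lambda>z. G z * lap w z)"
      by (rule gmean_sqn[OF hpoly_mult[OF G lapw]])
    moreover have "(of_nat (k + 2 + j + CARD('n)) :: complex) \<noteq> 0"
      unfolding of_nat_eq_0_iff by simp
    ultimately show ?thesis by (simp add: mult.left_commute del: of_nat_add)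
  qed
  have "gmean (\<lambda>z. lap G z * w z) = 0" if w: "hpoly k w" for w
  proof -
    \<comment> \<open>The gradient identity read in both orders: the left sides agree, and three of
      the four terms on the right vanish.\<close>
    have "(\<Sum>i\<in>UNIV. gmean (\<lambda>z. pd i w z * pd i G z)) =
        of_nat (k + 2) * gmean (\<lambda>z. w z * G z) - gmean (\<lambda>z. w z * lap G z)"
      by (rule gmean_grad_grad[OF w G])
    moreover have "(\<Sum>i\<in>UNIV. gmean (\<lambda>z. pd i G z * pd i w z)) =
        of_nat k * gmean (\<lambda>z. G z * w z) - gmean (\<lambda>z. G z * lap w z)"
      by (rule gmean_grad_grad[OF G w])
    ultimately show ?thesis using orth[OF w] 0[OF w] by (simp add: mult.commute)
  qed
  from this[OF hpoly_star[OF lapG]] have "nsq (lap G) = 0" by (simp add: nsq_def)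
  then show ?thesis
    using G nsq_eq_0D[OF lapG] by (simp add: pharm_def)
qed

section \<open>Monomials, positivity of the quadratic form and the normal equations\<close>

definition vmonomial :: "('n \<Rightarrow> nat) \<Rightarrow> complex ^ 'n::finite \<Rightarrow> complex" where
  "vmonomial \<alpha> z = (\<Prod>i\<in>UNIV. z $ i ^ \<alpha> i)"

lemma hpoly_vmonomial: "hpoly (\<Sum>i\<in>UNIV. \<alpha> i) (vmonomial \<alpha>)"
  using hpoly.monomial[of \<alpha> _ 1] by (simp add: vmonomial_def[abs_def])

lemma finite_exponents: "finite {\<alpha> :: 'n::finite \<Rightarrow> nat. (\<Sum>i\<in>UNIV. \<alpha> i) = k}"
proof (rule finite_subset)
  have "\<alpha> i \<le> (\<Sum>i\<in>UNIV. \<alpha> i)" for \<alpha> :: "'n \<Rightarrow> nat" and i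
    by (rule member_le_sum) auto
  then show "{\<alpha> :: 'n \<Rightarrow> nat. (\<Sum>i\<in>UNIV. \<alpha> i) = k} \<subseteq> PiE UNIV (\<lambda>_. {..k})"
    by auto
  show "finite (PiE (UNIV :: 'n set) (\<lambda>_. {..k}))"
    by (intro finite_PiE) auto
qed

lemma hpoly_span:
  "hpoly k F \<Longrightarrow> \<exists>c. F = (\<lambda>z. \<Sum>\<alpha> | (\<Sum>i\<in>UNIV. \<alpha> i) = k. c \<alpha> * vmonomial \<alpha> z)"
proof (induction rule: hpoly.induct)
  case (monomial \<alpha> k c)
  then have "(\<Sum>\<beta> | (\<Sum>i\<in>UNIV. \<beta> i) = k. (if \<beta> = \<alpha> then c else 0) * vmonomial \<beta> z) = c * vmonomial \<alpha> z" for z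
    by (subst sum.cong[OF refl, of _ _ "\<lambda>\<beta>. if \<beta> = \<alpha> then c * vmonomial \<alpha> z else 0"])
      (auto simp: finite_exponents sum.delta)
  then show ?case
    by (intro exI[of _ "\<lambda>\<beta>. if \<beta> = \<alpha> then c else 0"]) (simp add: vmonomial_def[abs_def])
next
  case (add m F G)
  then obtain c d where
    "F = (\<lambda>z. \<Sum>\<alpha> | (\<Sum>i\<in>UNIV. \<alpha> i) = m. c \<alpha> * vmonomial \<alpha> z)"
    "G = (\<lambda>z. \<Sum>\<alpha> | (\<Sum>i\<in>UNIV. \<alpha> i) = m. d \<alpha> * vmonomial \<alpha> z)" by blast
  then show ?case
    by (intro exI[of _ "\<lambda>\<alpha>. c \<alpha> + d \<alpha>"]) (simp add: distrib_right sum.distrib)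
qed

locale ellipsoid_axes =
  fixes a :: "real ^ 'n::finite"
  assumes a_pos: "\<And>i. a $ i > 0"
begin

lemma dim_pos: "0 < 2 * real k + real CARD('n)"
  by (simp add: add_nonneg_pos)

definition lo :: real where "lo = Min (range (\<lambda>i. 1 / (a $ i)\<^sup>2))"
definition hi :: real where "hi = Max (range (\<lambda>i. 1 / (a $ i)\<^sup>2))"

lemma lo_le: "lo \<le> 1 / (a $ i)\<^sup>2" and hi_ge: "1 / (a $ i)\<^sup>2 \<le> hi"
  unfolding lo_def hi_def by (auto intro!: Min_le Max_ge)

lemma lo_pos: "lo > 0"
  unfolding lo_def by (subst Min_gr_iff) (use a_pos in \<open>auto intro: zero_less_power simp: less_imp_neq[symmetric]\<close>)

lemma hi_pos: "hi > 0"
  using hi_ge[of undefined] a_pos[of undefined] by (smt (verit) divide_pos_pos zero_less_power)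

lemma sqn_rpt: "sqn (rpt \<omega>) = of_real (\<Sum>i\<in>UNIV. (\<omega> i)\<^sup>2)"
  by (simp add: sqn_def)

lemma qform_rpt: "qform a (rpt \<omega>) = of_real (\<Sum>i\<in>UNIV. (\<omega> i)\<^sup>2 / (a $ i)\<^sup>2)"
  by (simp add: qform_def)

lemma qform_bounds:
  "lo * (\<Sum>i\<in>UNIV. (\<omega> i)\<^sup>2) \<le> (\<Sum>i\<in>UNIV. (\<omega> i)\<^sup>2 / (a $ i)\<^sup>2)"
  "(\<Sum>i\<in>UNIV. (\<omega> i)\<^sup>2 / (a $ i)\<^sup>2) \<le> hi * (\<Sum>i\<in>UNIV. (\<omega> i)\<^sup>2)"
  unfolding sum_distrib_left
  using mult_right_mono[OF lo_le, of "(\<omega> _)\<^sup>2"] mult_right_mono[OF hi_ge, of "(\<omega> _)\<^sup>2"]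
  by (auto intro!: sum_mono)

text \<open>Coercivity: \<open>lo |x|^2 \<le> P\<close> holds pointwise, and
  \<open>gmean_sqn\<close> evaluates the mean of \<open>|x|^2 |F|^2\<close>, where
  \<open>|F|^2\<close> has degree \<open>2 k\<close>.\<close>

lemma gmean_qform_ge:
  assumes F: "hpoly k F"
  shows "Re (gmean (\<lambda>z. qform a z * F z * star F z)) \<ge> lo * real (2 * k + CARD('n)) * nsq F"
proof -
  have FF: "hpoly (k + k) (\<lambda>z. F z * star F z)"
    by (rule hpoly_mult[OF F hpoly_star[OF F]])
  have "lo * real (2 * k + CARD('n)) * nsq F = Re (of_real lo * gmean (\<lambda>z. sqn z * (F z * star F z)))"
    by (simp add: gmean_sqn[OF FF] gmean_mult_star)
  also have "\<dots> = Re (gmean (\<lambda>z. of_real lo * (sqn z * (F z * star F z))))"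
    by (simp only: gmean_cmult)
  also have "\<dots> \<le> Re (gmean (\<lambda>z. qform a z * (F z * star F z)))"
  proof (rule gmean_mono)
    fix \<omega>
    have "lo * (\<Sum>i\<in>UNIV. (\<omega> i)\<^sup>2) * (cmod (F (rpt \<omega>)))\<^sup>2
        \<le> (\<Sum>i\<in>UNIV. (\<omega> i)\<^sup>2 / (a $ i)\<^sup>2) * (cmod (F (rpt \<omega>)))\<^sup>2"
      by (intro mult_right_mono qform_bounds) auto
    then show "Re (of_real lo * (sqn (rpt \<omega>) * (F (rpt \<omega>) * star F (rpt \<omega>))))
        \<le> Re (qform a (rpt \<omega>) * (F (rpt \<omega>) * star F (rpt \<omega>)))"
      unfolding sqn_rpt qform_rpt star_rpt complex_norm_square[symmetric]
      by (simp add: mult.assoc flip: of_real_mult)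
  qed (rule hpoly_cmult[OF hpoly_sqn_mult[OF FF]], rule hpoly_mult[OF hpoly_qform FF])
  finally show ?thesis by (simp add: mult.assoc)
qed

lemma qform_definite:
  assumes F: "hpoly k F" and 0: "gmean (\<lambda>z. qform a z * F z * star F z) = 0"
  shows "F z = 0"
proof (rule nsq_eq_0D[OF F])
  have "lo * real (2 * k + CARD('n)) * nsq F \<le> 0"
    using gmean_qform_ge[OF F] 0 by simp
  moreover have "lo * real (2 * k + CARD('n)) > 0" using lo_pos dim_pos[of k] by simp
  ultimately have "nsq F \<le> 0" by (metis mult_le_0_iff not_less)
  then show "nsq F = 0" using nsq_nonneg[of F] by simp
qed

text \<open>By Gram--Schmidt along the monomials.\<close>

lemma normal_equations_aux:
  assumes "finite A" "A \<subseteq> {\<alpha>. (\<Sum>i\<in>UNIV. \<alpha> i) = k}"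
  shows "hpoly m f \<Longrightarrow> \<exists>c. \<forall>\<alpha>\<in>A.
    gmean (\<lambda>z. qform a z * (\<Sum>\<beta>\<in>A. c \<beta> * vmonomial \<beta> z) * vmonomial \<alpha> z) = gmean (\<lambda>z. f z * vmonomial \<alpha> z)"
  using assms
proof (induction A arbitrary: f m)
  case empty
  then show ?case by simp
next
  case (insert \<beta> A)
  define comb where "comb = (\<lambda>c z. \<Sum>\<alpha>\<in>A. c \<alpha> * vmonomial \<alpha> z)"
  have hp: "hpoly k (vmonomial \<alpha>)" if "\<alpha> \<in> insert \<beta> A" for \<alpha>
    using that insert.prems hpoly_vmonomial[of \<alpha>] by auto
  have hc: "hpoly k (comb c)" for c
    unfolding comb_def using hp by (intro hpoly_sum hpoly_cmult) auto
  have q2: "hpoly (2 + (k + k)) (\<lambda>z. qform a z * (G z * H z))" if "hpoly k G" "hpoly k H" for G H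
    by (intro hpoly_mult hpoly_qform that)
  define B where "B = (\<lambda>G H. gmean (\<lambda>z. qform a z * G z * H z))"
  have B_add: "B (\<lambda>z. G z + c * G' z) H = B G H + c * B G' H"
    if "hpoly k G" "hpoly k G'" "hpoly k H" for G G' H c
    using gmean_add[OF q2[OF that(1,3)] hpoly_cmult[OF q2[OF that(2,3)]], of c]
    by (simp add: B_def algebra_simps gmean_cmult)
  have B_comm: "B G H = B H G" for G H by (simp add: B_def mult_ac)
  have B_comb: "B G (comb c) = (\<Sum>\<alpha>\<in>A. c \<alpha> * B G (vmonomial \<alpha>))" if "hpoly k G" for G c
  proof -
    have "B G (comb c) = gmean (\<lambda>z. \<Sum>\<alpha>\<in>A. c \<alpha> * (qform a z * (G z * vmonomial \<alpha> z)))"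
      by (simp add: B_def comb_def sum_distrib_left mult_ac)
    also have "\<dots> = (\<Sum>\<alpha>\<in>A. gmean (\<lambda>z. c \<alpha> * (qform a z * (G z * vmonomial \<alpha> z))))"
      using that hp by (intro gmean_sum[where m = "2 + (k + k)"] hpoly_cmult q2) auto
    finally show ?thesis by (simp add: gmean_cmult B_def mult.assoc)
  qed
  have f_comb: "gmean (\<lambda>z. f z * comb c z) = (\<Sum>\<alpha>\<in>A. c \<alpha> * gmean (\<lambda>z. f z * vmonomial \<alpha> z))" for c
  proof -
    have "gmean (\<lambda>z. f z * comb c z) = gmean (\<lambda>z. \<Sum>\<alpha>\<in>A. c \<alpha> * (f z * vmonomial \<alpha> z))"
      by (simp add: comb_def sum_distrib_left mult_ac)
    also have "\<dots> = (\<Sum>\<alpha>\<in>A. gmean (\<lambda>z. c \<alpha> * (f z * vmonomial \<alpha> z)))"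
      using hp by (intro gmean_sum[where m = "m + k"] hpoly_cmult hpoly_mult[OF insert.prems(1)]) auto
    finally show ?thesis by (simp add: gmean_cmult)
  qed
  have IH: "\<exists>c. \<forall>\<alpha>\<in>A. B (comb c) (vmonomial \<alpha>) = gmean (\<lambda>z. g z * vmonomial \<alpha> z)" if "hpoly j g" for g j
    using insert.IH[OF that] insert.prems unfolding B_def comb_def by auto
  \<comment> \<open>The projection of the new monomial to the span of \<open>A\<close>. The
    induction hypothesis is used with right side \<open>qform a\<close> times this monomial, of
    degree \<open>k + 2\<close>, which is why it ranges over all \<open>f\<close> and
    \<open>m\<close>.\<close>
  obtain p where p: "\<And>\<alpha>. \<alpha> \<in> A \<Longrightarrow> B (comb p) (vmonomial \<alpha>) = B (vmonomial \<beta>) (vmonomial \<alpha>)"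
    using IH[OF hpoly_mult[OF hpoly_qform[of a] hp[of \<beta>]]] unfolding B_def by auto
  obtain c where c: "\<And>\<alpha>. \<alpha> \<in> A \<Longrightarrow> B (comb c) (vmonomial \<alpha>) = gmean (\<lambda>z. f z * vmonomial \<alpha> z)"
    using IH[OF insert.prems(1)] by auto
  define e where "e = (\<lambda>z. vmonomial \<beta> z + (-1) * comb p z)"
  have he: "hpoly k e"
    unfolding e_def by (intro hpoly.add hpoly_cmult hp hc) auto
  have eA: "B e (vmonomial \<alpha>) = 0" if "\<alpha> \<in> A" for \<alpha>
    unfolding e_def using that p[OF that] by (subst B_add) (auto intro: hp hc)
  define d where "d = B e (vmonomial \<beta>)"
  define t where "t = (if d = 0 then 0 else (gmean (\<lambda>z. f z * vmonomial \<beta> z) - B (comb c) (vmonomial \<beta>)) / d)"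
  define c' where "c' = (\<lambda>\<alpha>. if \<alpha> = \<beta> then t else c \<alpha> - t * p \<alpha>)"
  have comb': "(\<lambda>z. \<Sum>\<alpha>\<in>insert \<beta> A. c' \<alpha> * vmonomial \<alpha> z) = (\<lambda>z. comb c z + t * e z)"
  proof
    fix z
    have "(\<Sum>\<alpha>\<in>A. c' \<alpha> * vmonomial \<alpha> z) = (\<Sum>\<alpha>\<in>A. c \<alpha> * vmonomial \<alpha> z - t * (p \<alpha> * vmonomial \<alpha> z))"
      using insert.hyps by (intro sum.cong) (auto simp: c'_def algebra_simps)
    moreover have c'\<beta>: "c' \<beta> = t" by (simp add: c'_def)
    ultimately show "(\<Sum>\<alpha>\<in>insert \<beta> A. c' \<alpha> * vmonomial \<alpha> z) = comb c z + t * e z"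
      unfolding sum.insert[OF insert.hyps]
      by (simp add: e_def comb_def sum_subtractf c'\<beta> algebra_simps flip: sum_distrib_left)
  qed
  have "B (\<lambda>z. comb c z + t * e z) (vmonomial \<alpha>) = gmean (\<lambda>z. f z * vmonomial \<alpha> z)" if "\<alpha> \<in> insert \<beta> A" for \<alpha>
  proof (cases "\<alpha> \<in> A")
    case True
    then show ?thesis
      by (subst B_add) (auto intro: hp hc he simp: c eA)
  next
    case False
    with that have \<alpha>: "\<alpha> = \<beta>" by simp
    show ?thesis
    proof (cases "d = 0")
      case False
      then show ?thesis
        unfolding \<alpha> by (subst B_add) (auto intro: hp hc he simp: t_def d_def[symmetric])
    next
      \<comment> \<open>\<open>B\<close> is bilinear rather than Hermitian, so \<open>d = 0\<close>
        alone does not show \<open>e = 0\<close>. But \<open>star e\<close> is again the new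
        monomial plus a combination from \<open>A\<close>, so \<open>B (star e) e\<close> vanishes
        too and definiteness applies. The equation for \<open>\<beta>\<close> then follows from
        those for \<open>A\<close>.\<close>
      case True
      have "e z = 0" for z
      proof (rule qform_definite[OF he])
        have star_e: "star e = (\<lambda>z. vmonomial \<beta> z + (-1) * comb (\<lambda>\<alpha>. cnj (p \<alpha>)) z)"
          by (simp add: star_def[abs_def] e_def comb_def vmonomial_def)
        have "B (star e) e = B (vmonomial \<beta>) e + (-1) * B (comb (\<lambda>\<alpha>. cnj (p \<alpha>))) e"
          unfolding star_e by (rule B_add) (auto intro: hp hc he)
        also have "B (vmonomial \<beta>) e = 0" using True by (simp add: d_def B_comm)
        also have "B (comb (\<lambda>\<alpha>. cnj (p \<alpha>))) e = 0"
          unfolding B_comm[of _ e] by (simp add: B_comb[OF he] eA)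
        finally show "gmean (\<lambda>z. qform a z * e z * star e z) = 0"
          unfolding B_def by (simp add: mult_ac)
      qed
      then have \<beta>: "vmonomial \<beta> = comb p" by (auto simp: e_def)
      have "B (comb c) (vmonomial \<beta>) = gmean (\<lambda>z. f z * vmonomial \<beta> z)"
        unfolding \<beta> by (simp add: B_comb[OF hc] f_comb c)
      then show ?thesis using True by (simp add: \<alpha> t_def)
    qed
  qed
  then show ?case
    unfolding B_def comb'[symmetric] by blast
qed

lemma normal_equations:
  assumes f: "hpoly m f"
  shows "\<exists>q. hpoly k q \<and>
    (\<forall>v. hpoly k v \<longrightarrow> gmean (\<lambda>z. qform a z * q z * v z) = gmean (\<lambda>z. f z * v z))"
proof -
  define A where "A = {\<alpha> :: 'n \<Rightarrow> nat. (\<Sum>i\<in>UNIV. \<alpha> i) = k}"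
  obtain c where c: "\<And>\<alpha>. \<alpha> \<in> A \<Longrightarrow>
      gmean (\<lambda>z. qform a z * (\<Sum>\<beta>\<in>A. c \<beta> * vmonomial \<beta> z) * vmonomial \<alpha> z) = gmean (\<lambda>z. f z * vmonomial \<alpha> z)"
    using normal_equations_aux[OF _ _ f, of A k] finite_exponents unfolding A_def by auto
  define q where "q = (\<lambda>z. \<Sum>\<beta>\<in>A. c \<beta> * vmonomial \<beta> z)"
  have hp: "hpoly k (vmonomial \<alpha>)" if "\<alpha> \<in> A" for \<alpha>
    using that hpoly_vmonomial[of \<alpha>] by (auto simp: A_def)
  have q: "hpoly k q"
    unfolding q_def using hp by (intro hpoly_sum hpoly_cmult)
  have "gmean (\<lambda>z. qform a z * q z * v z) = gmean (\<lambda>z. f z * v z)" if v: "hpoly k v" for v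
  proof -
    obtain d where d: "v = (\<lambda>z. \<Sum>\<alpha>\<in>A. d \<alpha> * vmonomial \<alpha> z)"
      using hpoly_span[OF v] unfolding A_def by auto
    have "gmean (\<lambda>z. g z * v z) = (\<Sum>\<alpha>\<in>A. d \<alpha> * gmean (\<lambda>z. g z * vmonomial \<alpha> z))" if "hpoly j g" for g j
    proof -
      have "gmean (\<lambda>z. g z * v z) = gmean (\<lambda>z. \<Sum>\<alpha>\<in>A. d \<alpha> * (g z * vmonomial \<alpha> z))"
        by (simp add: d sum_distrib_left mult_ac)
      also have "\<dots> = (\<Sum>\<alpha>\<in>A. gmean (\<lambda>z. d \<alpha> * (g z * vmonomial \<alpha> z)))"
        using hp by (intro gmean_sum[where m = "j + k"] hpoly_cmult hpoly_mult[OF that]) auto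
      finally show ?thesis by (simp add: gmean_cmult)
    qed
    from this[OF hpoly_mult[OF hpoly_qform[of a] q]] this[OF f] show ?thesis
      using c by (simp add: q_def)
  qed
  with q show ?thesis by blast
qed

text \<open>For \<open>F\<close> of degree \<open>m\<close> this is the \<open>L^2\<close> norm on
  the unit sphere with normalised surface measure: the radial part of the Gaussian mean of
  \<open>|F|^2\<close> is exactly \<open>kap\<close>.\<close>

definition hnorm :: "nat \<Rightarrow> (complex ^ 'n \<Rightarrow> complex) \<Rightarrow> real" where
  "hnorm m F = sqrt (nsq F / kap CARD('n) m)"

lemma hnorm_nonneg: "hnorm m F \<ge> 0"
  using kap_pos[of "CARD('n)" m] nsq_nonneg[of F] by (simp add: hnorm_def)

lemma hnorm_square: "nsq F = kap CARD('n) m * (hnorm m F)\<^sup>2"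
  using kap_pos[of "CARD('n)" m] nsq_nonneg[of F] by (simp add: hnorm_def)

lemma hnorm_le:
  assumes "nsq F \<le> kap CARD('n) m * b\<^sup>2" "b \<ge> 0"
  shows "hnorm m F \<le> b"
proof -
  have "nsq F / kap CARD('n) m \<le> b\<^sup>2"
    using assms kap_pos[of "CARD('n)" m] by (simp add: field_simps)
  then show ?thesis unfolding hnorm_def by (rule real_le_lsqrt[OF \<open>b \<ge> 0\<close>])
qed

lemma nsq_sqn_mult:
  fixes F :: "complex ^ 'n \<Rightarrow> complex"
  assumes F: "hpoly k F"
  shows "nsq (\<lambda>z. sqn z * F z) = real (2 * k + CARD('n) + 2) * real (2 * k + CARD('n)) * nsq F"
proof -
  have FF: "hpoly (k + k) (\<lambda>z. F z * star F z)"
    by (rule hpoly_mult[OF F hpoly_star[OF F]])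
  have "gmean (\<lambda>z. (sqn z * F z) * star (\<lambda>z. sqn z * F z) z) = gmean (\<lambda>z. sqn z * (sqn z * (F z * star F z)))"
    by (rule gmean_cong) (simp add: sqn_rpt)
  also have "\<dots> = of_nat (k + k + 2 + CARD('n)) * (of_nat (k + k + CARD('n)) * of_real (nsq F))"
    by (simp only: gmean_sqn[OF hpoly_sqn_mult[OF FF]] gmean_sqn[OF FF] gmean_mult_star)
  finally have "complex_of_real (nsq (\<lambda>z. sqn z * F z)) =
      of_real (real (2 * k + CARD('n) + 2) * real (2 * k + CARD('n)) * nsq F)"
    unfolding gmean_mult_star by (simp add: algebra_simps)
  then show ?thesis by (simp only: of_real_eq_iff)
qed

text \<open>\<open>|x|^2\<close> equals 1 on the unit sphere. In Gaussian terms, the two scalars of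
  \<open>nsq_sqn_mult\<close> are those by which \<open>kap\<close> grows in two steps.\<close>

lemma hnorm_sqn_mult:
  fixes F :: "complex ^ 'n \<Rightarrow> complex"
  assumes F: "hpoly k F"
  shows "hnorm (k + 2) (\<lambda>z. sqn z * F z) = hnorm k F"
proof -
  have "kap CARD('n) (k + 2) = real (2 * k + CARD('n) + 2) * real (2 * k + CARD('n)) * kap CARD('n) k"
    by (simp add: kap_Suc algebra_simps)
  then show ?thesis using dim_pos[of k] by (simp add: hnorm_def nsq_sqn_mult[OF F])
qed

text \<open>The bound on the quotient carries no constant besides \<open>1 / lo\<close>, because it
  will be iterated; the bound on the harmonic remainder is applied once per component and may be
  crude.\<close>

lemma Fischer_decomposition:
  assumes f: "hpoly (k + 2) f"
  shows "\<exists>q. hpoly k q \<and> pharm (k + 2) (\<lambda>z. f z - qform a z * q z) \<and>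
    hnorm k q \<le> hnorm (k + 2) f / lo \<and>
    hnorm (k + 2) (\<lambda>z. f z - qform a z * q z) \<le> 2 * (1 + hi / lo) * hnorm (k + 2) f"
proof -
  obtain q where q: "hpoly k q" and
    orth: "\<And>v. hpoly k v \<Longrightarrow> gmean (\<lambda>z. qform a z * q z * v z) = gmean (\<lambda>z. f z * v z)"
    using normal_equations[OF f, of k] by blast
  have qq: "hpoly (k + 2) (\<lambda>z. qform a z * q z)"
    using hpoly_mult[OF hpoly_qform q] by (simp add: add.commute)
  define h where "h = (\<lambda>z. f z - qform a z * q z)"
  have h: "hpoly (k + 2) h" unfolding h_def by (rule hpoly_diff[OF f qq])
  have "pharm (k + 2) h"
  proof (rule orthogonal_imp_harmonic[OF h])
    fix v :: "complex ^ 'n \<Rightarrow> complex" assume v: "hpoly k v"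
    show "gmean (\<lambda>z. h z * v z) = 0"
      using gmean_diff[OF hpoly_mult[OF f v] hpoly_mult[OF qq v]] orth[OF v]
      by (simp add: h_def left_diff_distrib)
  qed
  moreover have q_le: "hnorm k q \<le> hnorm (k + 2) f / lo"
  proof (rule hnorm_le)
    define D where "D = real (2 * k + CARD('n))"
    have D: "D > 0" using dim_pos[of k] by (simp add: D_def)
    define X where "X = nsq q"
    have X: "X \<ge> 0" by (simp add: X_def nsq_nonneg)
    have fq: "hpoly (k + 2 + k) (\<lambda>z. f z * star q z)" by (rule hpoly_mult[OF f hpoly_star[OF q]])
    have "lo * D * X \<le> Re (gmean (\<lambda>z. qform a z * q z * star q z))"
      unfolding D_def X_def by (rule gmean_qform_ge[OF q])
    also have "\<dots> \<le> cmod (gmean (\<lambda>z. f z * star q z))"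
      using orth[OF hpoly_star[OF q]] complex_Re_le_cmod by simp
    finally have 1: "lo * D * X \<le> cmod (gmean (\<lambda>z. f z * star q z))" .
    \<comment> \<open>Direct Cauchy-Schwarz on \<open>f\<close> and \<open>star q\<close> would mix
      the degrees \<open>k + 2\<close> and \<open>k\<close> and leave a factor
      \<open>(D + 2) / D\<close> in the squared bound. Multiplying \<open>star q\<close> by
      \<open>sqn\<close> first equalises the degrees, and all factors \<open>D\<close> and
      \<open>D + 2\<close> cancel.\<close>
    have "gmean (\<lambda>z. f z * (sqn z * star q z)) = of_real (D + 2) * gmean (\<lambda>z. f z * star q z)"
      using gmean_sqn[OF fq] by (simp add: mult.left_commute D_def)
    then have "(D + 2) * cmod (gmean (\<lambda>z. f z * star q z)) = cmod (gmean (\<lambda>z. f z * (sqn z * star q z)))"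
      using D by (simp add: norm_mult del: of_real_add)
    moreover have "(cmod (gmean (\<lambda>z. f z * (sqn z * star q z))))\<^sup>2 \<le> nsq f * nsq (\<lambda>z. sqn z * star q z)"
      by (rule gmean_Cauchy_Schwarz[OF f hpoly_sqn_mult[OF hpoly_star[OF q]]])
    moreover have "nsq (\<lambda>z. sqn z * star q z) = (D + 2) * D * X"
      using nsq_sqn_mult[OF hpoly_star[OF q]] by (simp add: D_def X_def nsq_star)
    ultimately have "((D + 2) * cmod (gmean (\<lambda>z. f z * star q z)))\<^sup>2 \<le> nsq f * ((D + 2) * D * X)"
      by simp
    moreover have "((D + 2) * (lo * D * X))\<^sup>2 \<le> ((D + 2) * cmod (gmean (\<lambda>z. f z * star q z)))\<^sup>2"
      using 1 D X lo_pos by (intro power_mono mult_left_mono) auto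
    ultimately have "((D + 2) * (lo * D * X))\<^sup>2 \<le> nsq f * ((D + 2) * D * X)"
      by linarith
    then have 3: "((D + 2) * D * X) * (lo\<^sup>2 * (D + 2) * D * X) \<le> ((D + 2) * D * X) * nsq f"
      by (simp add: power2_eq_square algebra_simps)
    have 2: "lo\<^sup>2 * (D + 2) * D * X \<le> nsq f"
    proof (cases "X = 0")
      case False
      with D X have "(D + 2) * D * X > 0" by simp
      with 3 show ?thesis by (simp only: mult_le_cancel_left_pos)
    qed (simp add: nsq_nonneg)
    have "kap CARD('n) (k + 2) = (D + 2) * D * kap CARD('n) k"
      by (simp add: kap_Suc D_def algebra_simps)
    then have "nsq f = (D + 2) * D * kap CARD('n) k * (hnorm (k + 2) f)\<^sup>2"
      using hnorm_square[of f "k + 2"] by simp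
    with 2 have "(D + 2) * D * (lo\<^sup>2 * X) \<le> (D + 2) * D * (kap CARD('n) k * (hnorm (k + 2) f)\<^sup>2)"
      by (simp add: algebra_simps)
    then have "lo\<^sup>2 * X \<le> kap CARD('n) k * (hnorm (k + 2) f)\<^sup>2"
      by (rule mult_left_le_imp_le) (use D in auto)
    then show "nsq q \<le> kap CARD('n) k * (hnorm (k + 2) f / lo)\<^sup>2"
      using lo_pos by (simp add: X_def power_divide field_simps)
  qed (use lo_pos hnorm_nonneg in simp)
  moreover have "hnorm (k + 2) h \<le> 2 * (1 + hi / lo) * hnorm (k + 2) f"
  proof (rule hnorm_le)
    define s where "s = hnorm (k + 2) f"
    define K where "K = kap CARD('n) (k + 2)"
    have K: "K > 0" by (simp add: K_def kap_pos)
    have s: "s \<ge> 0" by (simp add: s_def hnorm_nonneg)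
    have int: "integrable gauss (\<lambda>\<omega>. (cmod (F (rpt \<omega>)))\<^sup>2)" if "hpoly (k + 2) F" for F :: "complex ^ 'n \<Rightarrow> complex"
      using nsq_integrable[OF that] .
    have sq: "hpoly (k + 2) (\<lambda>z. sqn z * q z)" by (rule hpoly_sqn_mult[OF q])
    \<comment> \<open>From \<open>|u - v|^2 \<le> 2 |u|^2 + 2 |v|^2\<close>. Replacing
      \<open>P\<close> by \<open>hi * sqn\<close> lets \<open>hnorm_sqn_mult\<close> turn the second
      term into the norm of \<open>q\<close>; the constant \<open>2 * (1 + hi / lo)\<close> results
      from this split.\<close>
    have "nsq h \<le> 2 * nsq f + 2 * (hi\<^sup>2 * nsq (\<lambda>z. sqn z * q z))"
    proof -
      have "nsq h \<le> (\<integral>\<omega>. 2 * (cmod (f (rpt \<omega>)))\<^sup>2 + 2 * (hi\<^sup>2 * (cmod (sqn (rpt \<omega>) * q (rpt \<omega>)))\<^sup>2) \<partial>gauss)"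
        unfolding nsq_eq_integral
      proof (intro integral_mono)
        fix \<omega>
        have "cmod (qform a (rpt \<omega>)) \<le> hi * cmod (sqn (rpt \<omega>))"
        proof -
          have "(\<Sum>i\<in>UNIV. (\<omega> i)\<^sup>2 / (a $ i)\<^sup>2) \<ge> 0" "(\<Sum>i\<in>UNIV. (\<omega> i)\<^sup>2) \<ge> 0"
            by (auto intro!: sum_nonneg)
          then show ?thesis
            using qform_bounds(2)[of \<omega>] unfolding qform_rpt sqn_rpt norm_of_real by simp
        qed
        then have "cmod (qform a (rpt \<omega>) * q (rpt \<omega>)) \<le> hi * cmod (sqn (rpt \<omega>) * q (rpt \<omega>))"
          by (simp add: norm_mult mult.assoc[symmetric] mult_right_mono)
        then have 1: "(cmod (qform a (rpt \<omega>) * q (rpt \<omega>)))\<^sup>2 \<le> hi\<^sup>2 * (cmod (sqn (rpt \<omega>) * q (rpt \<omega>)))\<^sup>2"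
          by (metis norm_ge_zero power_mono power_mult_distrib)
        have "(cmod (h (rpt \<omega>)))\<^sup>2 \<le> (cmod (f (rpt \<omega>)) + cmod (qform a (rpt \<omega>) * q (rpt \<omega>)))\<^sup>2"
          unfolding h_def by (intro power_mono norm_triangle_ineq4) auto
        also have "\<dots> \<le> 2 * (cmod (f (rpt \<omega>)))\<^sup>2 + 2 * (cmod (qform a (rpt \<omega>) * q (rpt \<omega>)))\<^sup>2"
          using sum_squares_bound[of "cmod (f (rpt \<omega>))" "cmod (qform a (rpt \<omega>) * q (rpt \<omega>))"]
          by (simp add: power2_sum)
        finally show "(cmod (h (rpt \<omega>)))\<^sup>2 \<le> 2 * (cmod (f (rpt \<omega>)))\<^sup>2 + 2 * (hi\<^sup>2 * (cmod (sqn (rpt \<omega>) * q (rpt \<omega>)))\<^sup>2)"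
          using 1 by linarith
      qed (use int[OF h] int[OF f] int[OF sq] in auto)
      also have "\<dots> = 2 * nsq f + 2 * (hi\<^sup>2 * nsq (\<lambda>z. sqn z * q z))"
        unfolding nsq_eq_integral using int[OF f] int[OF sq] by simp
      finally show ?thesis .
    qed
    also have "nsq (\<lambda>z. sqn z * q z) = K * (hnorm k q)\<^sup>2"
      using hnorm_square[of "\<lambda>z. sqn z * q z" "k + 2"] hnorm_sqn_mult[OF q] by (simp add: K_def)
    also have "nsq f = K * s\<^sup>2" unfolding K_def s_def by (rule hnorm_square)
    finally have "nsq h \<le> 2 * (K * s\<^sup>2) + 2 * (hi\<^sup>2 * (K * (hnorm k q)\<^sup>2))" .
    moreover have "hi\<^sup>2 * (K * (hnorm k q)\<^sup>2) \<le> hi\<^sup>2 * (K * (s / lo)\<^sup>2)"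
      using q_le K hnorm_nonneg by (intro mult_left_mono power_mono) (auto simp: s_def)
    ultimately have "nsq h \<le> 2 * (K * s\<^sup>2) + 2 * (hi\<^sup>2 * (K * (s / lo)\<^sup>2))"
      by linarith
    also have "\<dots> = K * (2 * s\<^sup>2 * (1 + (hi / lo)\<^sup>2))"
      by (simp add: algebra_simps power_divide)
    also have "\<dots> \<le> K * (2 * (1 + hi / lo) * s)\<^sup>2"
    proof (intro mult_left_mono)
      have sq: "2 * s\<^sup>2 * (2 * u\<^sup>2) = (2 * u * s)\<^sup>2" for u :: real
        by (simp add: power_mult_distrib)
      have "1 + (hi / lo)\<^sup>2 \<le> 2 * (1 + hi / lo)\<^sup>2"
      proof -
        have "(hi / lo)\<^sup>2 \<ge> 0" "hi / lo > 0" using hi_pos lo_pos by auto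
        then show ?thesis unfolding power2_sum by simp
      qed
      then have "2 * s\<^sup>2 * (1 + (hi / lo)\<^sup>2) \<le> 2 * s\<^sup>2 * (2 * (1 + hi / lo)\<^sup>2)"
        by (intro mult_left_mono) auto
      then show "2 * s\<^sup>2 * (1 + (hi / lo)\<^sup>2) \<le> (2 * (1 + hi / lo) * s)\<^sup>2"
        unfolding sq .
    qed (use K in simp)
    finally show "nsq h \<le> kap CARD('n) (k + 2) * (2 * (1 + hi / lo) * hnorm (k + 2) f)\<^sup>2"
      by (simp add: K_def s_def)
  qed (use lo_pos hi_pos hnorm_nonneg in simp)
  ultimately show ?thesis using q unfolding h_def by blast
qed

end

section \<open>Pointwise bounds for homogeneous harmonic polynomials\<close>

definition lin :: "complex ^ 'n::finite \<Rightarrow> complex ^ 'n \<Rightarrow> complex" where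
  "lin z x = (\<Sum>i\<in>UNIV. x $ i * z $ i)"

lemma hpoly_lin: "hpoly 1 (lin z)"
  using hpoly_linear by (simp add: lin_def[abs_def])

lemma hpoly_lin_power: "hpoly n (\<lambda>x. lin z x ^ n)"
  using hpoly_power[OF hpoly_lin, of n] by simp

lemma pd_lin: "pd i (lin z) x = z $ i"
proof -
  have "pd i (lin z) x = pd i (\<lambda>x. \<Sum>j\<in>UNIV. z $ j * x $ j) x"
    by (simp add: lin_def[abs_def] mult.commute)
  also have "\<dots> = z $ i"
    by (subst pd_sum) (simp_all add: pd_cmult entire_cmult entire_component pd_component if_distrib cong: if_cong)
  finally show ?thesis .
qed

lemma pd_lin_power: "pd i (\<lambda>x. lin z x ^ Suc n) x = of_nat (Suc n) * z $ i * lin z x ^ n"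
  by (subst pd_power_Suc) (simp_all add: hpoly_entire[OF hpoly_lin] pd_lin)

text \<open>Euler's identity expresses \<open>h\<close> by its gradient and Stein's identity removes
  the factors \<open>x $ i\<close>. The terms with second derivatives add up to the Laplacian and
  vanish; the others differentiate the power and yield \<open>z $ i\<close>, so Euler's identity at
  \<open>z\<close> restores \<open>h z\<close>. The factorials are cross-multiplied;
  \<open>n = 0\<close> gives the reproducing formula for point evaluation.\<close>

lemma harmonic_reproducing:
  "pharm k h \<Longrightarrow> fact n * gmean (\<lambda>x. h x * lin z x ^ (k + n)) = fact (k + n) * h z * gmean (\<lambda>x. lin z x ^ n)"
proof (induction k arbitrary: h)
  case 0
  define c where "c = h 0"
  from 0 have "h w = c" for w using hpoly_scale[of 0 h 0 w] by (simp add: pharm_def c_def)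
  then have "h = (\<lambda>_. c)" by blast
  then show ?case by (simp add: gmean_cmult)
next
  case (Suc k)
  define M where "M = gmean (\<lambda>x. lin z x ^ n)"
  define N where "N = k + n"
  have h: "hpoly (Suc k) h" and lap: "\<And>x. lap h x = 0" using Suc.prems by (auto simp: pharm_def)
  have dh: "hpoly k (pd i h)" for i by (rule hpoly_pd_Suc[OF h])
  have IH: "fact n * gmean (\<lambda>x. pd i h x * lin z x ^ N) = fact N * pd i h z * M" for i
    unfolding M_def N_def using dh lap_pd[OF h lap] by (intro Suc.IH) (simp add: pharm_def)
  have hL: "hpoly (k + N) (\<lambda>x. pd i h x * lin z x ^ N)" for i
    by (rule hpoly_mult[OF dh hpoly_lin_power])
  have step: "gmean (\<lambda>x. x $ i * pd i h x * lin z x ^ Suc N) =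
      gmean (\<lambda>x. pd i (pd i h) x * lin z x ^ Suc N) + of_nat (Suc N) * z $ i * gmean (\<lambda>x. pd i h x * lin z x ^ N)" for i
  proof -
    have "gmean (\<lambda>x. pd i h x * pd i (\<lambda>x. lin z x ^ Suc N) x) =
        gmean (\<lambda>x. of_nat (Suc N) * z $ i * (pd i h x * lin z x ^ N))"
      by (simp only: pd_lin_power mult_ac)
    then show ?thesis
      using gmean_Stein2[OF dh hpoly_lin_power, of i i z "Suc N"] by (simp only: gmean_cmult)
  qed
  have "of_nat (Suc k) * gmean (\<lambda>x. h x * lin z x ^ Suc N) =
      gmean (\<lambda>x. of_nat (Suc k) * h x * lin z x ^ Suc N)"
    by (simp only: gmean_cmult mult.assoc)
  also have "\<dots> = gmean (\<lambda>x. \<Sum>i\<in>UNIV. x $ i * pd i h x * lin z x ^ Suc N)"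
    by (simp only: Euler_homogeneous[OF h, symmetric] sum_distrib_right)
  also have "\<dots> = (\<Sum>i\<in>UNIV. gmean (\<lambda>x. x $ i * pd i h x * lin z x ^ Suc N))"
    by (rule gmean_sum) (rule hpoly_mult[OF hpoly_component_mult[OF dh] hpoly_lin_power])
  also have "\<dots> = (\<Sum>i\<in>UNIV. gmean (\<lambda>x. pd i (pd i h) x * lin z x ^ Suc N)) +
      of_nat (Suc N) * (\<Sum>i\<in>UNIV. z $ i * gmean (\<lambda>x. pd i h x * lin z x ^ N))"
    by (simp only: step sum.distrib) (simp only: sum_distrib_left mult.assoc)
  also have "(\<Sum>i\<in>UNIV. gmean (\<lambda>x. pd i (pd i h) x * lin z x ^ Suc N)) =
      gmean (\<lambda>x. \<Sum>i\<in>UNIV. pd i (pd i h) x * lin z x ^ Suc N)"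
    by (rule gmean_sum[symmetric]) (rule hpoly_mult[OF hpoly_pd[OF dh] hpoly_lin_power])
  also have "\<dots> = 0"
    using lap by (simp add: lap_def flip: sum_distrib_right)
  finally have "fact n * (of_nat (Suc k) * gmean (\<lambda>x. h x * lin z x ^ Suc N)) =
      of_nat (Suc N) * (\<Sum>i\<in>UNIV. z $ i * (fact n * gmean (\<lambda>x. pd i h x * lin z x ^ N)))"
    by (simp add: sum_distrib_left mult_ac)
  also have "\<dots> = of_nat (Suc N) * fact N * M * (\<Sum>i\<in>UNIV. z $ i * pd i h z)"
    unfolding IH by (simp add: sum_distrib_left mult_ac)
  also have "\<dots> = of_nat (Suc k) * (fact (Suc N) * h z * M)"
    unfolding Euler_homogeneous[OF h] by (simp add: mult_ac)
  finally have "of_nat (Suc k) * (fact n * gmean (\<lambda>x. h x * lin z x ^ Suc N)) =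
      of_nat (Suc k) * (fact (Suc N) * h z * M)" by (simp add: mult_ac)
  then have "fact n * gmean (\<lambda>x. h x * lin z x ^ Suc N) = fact (Suc N) * h z * M"
    by (simp del: of_nat_Suc)
  then show ?case by (simp add: N_def M_def)
qed

text \<open>For real \<open>z\<close> this is the moment recursion of a centred normal variable of
  variance \<open>sqn z\<close>; Stein's identity yields it for complex \<open>z\<close> as
  well.\<close>

lemma gmean_lin_power_Suc:
  "gmean (\<lambda>x. lin z x ^ Suc (Suc n)) = of_nat (Suc n) * sqn z * gmean (\<lambda>x. lin z x ^ n)"
proof -
  have "gmean (\<lambda>x. lin z x ^ Suc (Suc n)) = gmean (\<lambda>x. \<Sum>i\<in>UNIV. z $ i * (x $ i * lin z x ^ Suc n))"
    by (simp only: power_Suc[of _ "Suc n"]) (simp add: lin_def[of z] sum_distrib_left sum_distrib_right mult_ac del: power_Suc)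
  also have "\<dots> = (\<Sum>i\<in>UNIV. gmean (\<lambda>x. z $ i * (x $ i * lin z x ^ Suc n)))"
    by (rule gmean_sum) (rule hpoly_cmult[OF hpoly_component_mult[OF hpoly_lin_power]])
  also have "\<dots> = (\<Sum>i\<in>UNIV. z $ i * gmean (pd i (\<lambda>x. lin z x ^ Suc n)))"
    by (simp only: gmean_cmult gmean_Stein[OF hpoly_lin_power])
  also have "\<dots> = (\<Sum>i\<in>UNIV. z $ i * (of_nat (Suc n) * z $ i * gmean (\<lambda>x. lin z x ^ n)))"
    by (simp only: pd_lin_power[abs_def] gmean_cmult)
  also have "\<dots> = of_nat (Suc n) * sqn z * gmean (\<lambda>x. lin z x ^ n)"
    by (simp only: sqn_def sum_distrib_left sum_distrib_right power2_eq_square mult_ac)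
  finally show ?thesis .
qed

text \<open>\<open>kap 1\<close> is the odd double factorial.\<close>

lemma gmean_lin_power_even:
  assumes "sqn z = 1"
  shows "gmean (\<lambda>x. lin z x ^ (2 * l)) = of_real (kap 1 l)"
proof (induction l)
  case (Suc l)
  then show ?case
    using gmean_lin_power_Suc[of z "2 * l"] assms by (simp add: kap_Suc algebra_simps)
qed (simp add: gmean_const)

lemma sqn_complex_vec: "sqn (complex_vec x) = of_real ((norm x)\<^sup>2)"
  by (simp add: sqn_def complex_vec_def norm_vec_def L2_set_def real_sqrt_pow2 sum_nonneg)

lemma lin_complex_vec_bound: "cmod (lin z (rpt \<omega>)) \<le> norm z * sqrt (\<Sum>i\<in>UNIV. (\<omega> i)\<^sup>2)"
proof -
  have "cmod (lin z (rpt \<omega>)) \<le> (\<Sum>i\<in>UNIV. \<bar>\<bar>\<omega> i\<bar>\<bar> * \<bar>cmod (z $ i)\<bar>)"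
    unfolding lin_def by (intro sum_norm_le) (simp add: norm_mult)
  also have "\<dots> \<le> L2_set (\<lambda>i. \<bar>\<omega> i\<bar>) UNIV * L2_set (\<lambda>i. cmod (z $ i)) UNIV"
    by (rule L2_set_mult_ineq)
  finally show ?thesis by (simp add: L2_set_def norm_vec_def mult.commute)
qed

context ellipsoid_axes
begin

text \<open>Homogeneity extends the bound on the sphere to
  \<open>|F x|^2 \<le> s^2 |x|^(2 m)\<close>, and the right side has Gaussian mean
  \<open>s^2\<close> times \<open>kap\<close>.\<close>

lemma hnorm_le_sup:
  assumes F: "hpoly m F" and s: "\<And>\<theta>. norm \<theta> = 1 \<Longrightarrow> cmod (F (complex_vec \<theta>)) \<le> s" "s \<ge> 0"
  shows "hnorm m F \<le> s"
proof (rule hnorm_le)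
  have FF: "hpoly (m + m) (\<lambda>z. F z * star F z)"
    by (rule hpoly_mult[OF F hpoly_star[OF F]])
  have pt: "(cmod (F (complex_vec x)))\<^sup>2 \<le> s\<^sup>2 * ((norm x)\<^sup>2) ^ m" for x :: "real ^ 'n"
  proof (cases "x = 0")
    case False
    define \<theta> where "\<theta> = (1 / norm x) *\<^sub>R x"
    have "complex_vec x = of_real (norm x) *s complex_vec \<theta>"
      using False by (simp add: vec_eq_iff complex_vec_def \<theta>_def)
    then have "cmod (F (complex_vec x)) = norm x ^ m * cmod (F (complex_vec \<theta>))"
      by (simp add: hpoly_scale[OF F] norm_mult norm_power)
    also have "\<dots> \<le> norm x ^ m * s"
      using False by (intro mult_left_mono s) (auto simp: \<theta>_def)
    finally have "(cmod (F (complex_vec x)))\<^sup>2 \<le> (norm x ^ m * s)\<^sup>2"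
      by (intro power_mono) auto
    then show ?thesis by (simp add: power_mult_distrib power2_eq_square mult_ac)
  next
    case True
    show ?thesis
    proof (cases m)
      case (Suc k)
      then show ?thesis using True hpoly_scale[OF F, of 0 0] by (simp add: complex_vec_def zero_vec_def)
    next
      \<comment> \<open>Here \<open>0 ^ 0 = 1\<close>: in degree 0 the origin obeys the bound
        because \<open>F\<close> is constant.\<close>
      case 0
      obtain \<theta> :: "real ^ 'n" where \<theta>: "norm \<theta> = 1" using vector_choose_size[of 1] by auto
      have "F (complex_vec x) = F (complex_vec \<theta>)"
        using hpoly_scale[OF F, of 0 "complex_vec \<theta>"] hpoly_scale[OF F, of 0 "complex_vec x"] 0 by simp
      then show ?thesis using s(1)[OF \<theta>] 0 by (simp add: power_mono)
    qed
  qed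
  have "nsq F = Re (gmean (\<lambda>z. F z * star F z))" by (simp add: nsq_def)
  also have "\<dots> \<le> Re (gmean (\<lambda>z :: complex ^ 'n. of_real (s\<^sup>2) * sqn z ^ m))"
  proof (rule gmean_mono[OF FF])
    show "hpoly (2 * m) (\<lambda>z. of_real (s\<^sup>2) * sqn z ^ m)"
      by (intro hpoly_cmult hpoly_power hpoly_sqn)
    fix \<omega> :: "'n \<Rightarrow> real"
    have "sqn (rpt \<omega>) = of_real ((norm (\<chi> i. \<omega> i))\<^sup>2)"
      using sqn_complex_vec[of "\<chi> i. \<omega> i"] by simp
    then have A: "Re (of_real (s\<^sup>2) * sqn (rpt \<omega>) ^ m) = s\<^sup>2 * ((norm (\<chi> i. \<omega> i))\<^sup>2) ^ m"
      by (simp flip: of_real_power of_real_mult)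
    have B: "Re (F (rpt \<omega>) * star F (rpt \<omega>)) = (cmod (F (rpt \<omega>)))\<^sup>2"
      unfolding star_rpt complex_norm_square[symmetric] by simp
    show "Re (F (rpt \<omega>) * star F (rpt \<omega>)) \<le> Re (of_real (s\<^sup>2) * sqn (rpt \<omega>) ^ m)"
      unfolding A B using pt[of "\<chi> i. \<omega> i"] by (simp only: complex_vec_lambda)
  qed
  also have "\<dots> = kap CARD('n) m * s\<^sup>2"
    by (simp only: gmean_cmult gmean_sqn_power_1 flip: of_real_mult) simp
  finally show "nsq F \<le> kap CARD('n) m * s\<^sup>2" .
qed (rule s)

lemma nsq_lin_power_le: "nsq (\<lambda>x. lin z x ^ k) \<le> norm z ^ (2 * k) * kap CARD('n) k" for z :: "complex ^ 'n"
proof -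
  have "nsq (\<lambda>x. lin z x ^ k) \<le> Re (gmean (\<lambda>x :: complex ^ 'n. of_real (norm z ^ (2 * k)) * sqn x ^ k))"
    unfolding nsq_def
  proof (rule gmean_mono)
    show "hpoly (k + k) (\<lambda>x. lin z x ^ k * star (\<lambda>x. lin z x ^ k) x)"
      by (rule hpoly_mult[OF hpoly_lin_power hpoly_star[OF hpoly_lin_power]])
    show "hpoly (2 * k) (\<lambda>x. of_real (norm z ^ (2 * k)) * sqn x ^ k)"
      by (intro hpoly_cmult hpoly_power hpoly_sqn)
    fix \<omega> :: "'n \<Rightarrow> real"
    have S: "(\<Sum>i\<in>UNIV. (\<omega> i)\<^sup>2) \<ge> 0" by (intro sum_nonneg) auto
    have "cmod (lin z (rpt \<omega>)) ^ (2 * k) \<le> (norm z * sqrt (\<Sum>i\<in>UNIV. (\<omega> i)\<^sup>2)) ^ (2 * k)"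
      by (intro power_mono lin_complex_vec_bound) auto
    also have "\<dots> = norm z ^ (2 * k) * (\<Sum>i\<in>UNIV. (\<omega> i)\<^sup>2) ^ k"
      using S by (simp add: power_mult_distrib power_mult)
    also have "\<dots> = Re (of_real (norm z ^ (2 * k)) * sqn (rpt \<omega>) ^ k)"
      unfolding sqn_rpt by (simp flip: of_real_power of_real_mult)
    finally show "Re (lin z (rpt \<omega>) ^ k * star (\<lambda>x. lin z x ^ k) (rpt \<omega>)) \<le>
        Re (of_real (norm z ^ (2 * k)) * sqn (rpt \<omega>) ^ k)"
      unfolding star_rpt complex_norm_square[symmetric] by (simp add: norm_power mult.commute flip: power_mult)
  qed
  also have "\<dots> = norm z ^ (2 * k) * kap CARD('n) k"
    by (simp only: gmean_cmult gmean_sqn_power_1 flip: of_real_mult) simp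
  finally show ?thesis .
qed

text \<open>Point evaluation is pairing with \<open>lin z x ^ k\<close>, up to
  \<open>fact k\<close>, so Cauchy-Schwarz applies. The factors \<open>d + 2 i\<close> of
  \<open>kap\<close> are at most \<open>(i + 1) (d + 2)\<close>, whence the exponential
  rate.\<close>

lemma pharm_bound_complex:
  assumes h: "pharm k h"
  shows "cmod (h z) \<le> real (CARD('n) + 2) ^ k * norm z ^ k * hnorm k h"
proof -
  have hp: "hpoly k h" using h by (simp add: pharm_def)
  define K where "K = kap CARD('n) k"
  have K: "K > 0" by (simp add: K_def kap_pos)
  have "gmean (\<lambda>x. h x * lin z x ^ k) = fact k * h z"
    using harmonic_reproducing[OF h, of 0 z] by (simp add: gmean_const)
  then have "(fact k * cmod (h z))\<^sup>2 = (cmod (gmean (\<lambda>x. h x * lin z x ^ k)))\<^sup>2"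
    by (simp add: norm_mult)
  also have "\<dots> \<le> nsq h * nsq (\<lambda>x. lin z x ^ k)"
    by (rule gmean_Cauchy_Schwarz[OF hp hpoly_lin_power])
  also have "\<dots> \<le> (K * (hnorm k h)\<^sup>2) * (norm z ^ (2 * k) * K)"
    unfolding hnorm_square[of h k] K_def[symmetric]
    using nsq_lin_power_le[of z k] K unfolding K_def by (intro mult_left_mono) auto
  also have "\<dots> = (K * norm z ^ k * hnorm k h)\<^sup>2"
    unfolding power_even_eq by (simp add: power2_eq_square mult_ac)
  finally have 1: "fact k * cmod (h z) \<le> K * norm z ^ k * hnorm k h"
    using K hnorm_nonneg by (rule_tac power2_le_imp_le) auto
  have "K \<le> fact k * real (CARD('n) + 2) ^ k"
    unfolding K_def
  proof (induction k)
    case (Suc k)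
    have le: "real (CARD('n) + 2 * k) \<le> real (Suc k * (CARD('n) + 2))"
      unfolding of_nat_le_iff by simp
    have "real (CARD('n) + 2 * k) * kap CARD('n) k \<le>
        (real (Suc k) * real (CARD('n) + 2)) * (fact k * real (CARD('n) + 2) ^ k)"
      using kap_pos[of "CARD('n)" k] Suc by (intro mult_mono[OF le[unfolded of_nat_mult]]) auto
    then show ?case by (simp add: kap_Suc mult_ac)
  qed simp
  then have "K * (norm z ^ k * hnorm k h) \<le> (fact k * real (CARD('n) + 2) ^ k) * (norm z ^ k * hnorm k h)"
    using hnorm_nonneg by (intro mult_right_mono) auto
  with 1 have "fact k * cmod (h z) \<le> fact k * (real (CARD('n) + 2) ^ k * norm z ^ k * hnorm k h)"
    by (simp only: mult.assoc)
  then show ?thesis by simp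
qed

text \<open>Testing against a power of degree far above \<open>k\<close> concentrates the mean near the two poles
  \<open>\<plusminus>\<theta>\<close>; the choice \<open>l = k\<^sup>2\<close> below makes the constant polynomial in \<open>k\<close>.\<close>

lemma pharm_bound_aux:
  assumes h: "pharm k h" and \<theta>: "norm \<theta> = 1"
  shows "fact (k + 2 * l) * kap 1 l * cmod (h (complex_vec \<theta>)) \<le> fact (2 * l) * kap CARD('n) (k + l) * hnorm k h"
proof -
  have hp: "hpoly k h" using h by (simp add: pharm_def)
  define z where "z = complex_vec \<theta>"
  have z: "sqn z = 1" using \<theta> by (simp add: z_def sqn_complex_vec)
  define N where "N = k + 2 * l"
  define K where "K = (\<lambda>p. kap CARD('n) p)"
  have K: "K p > 0" for p by (simp add: K_def kap_pos)
  define E where "E = gmean (\<lambda>x. h x * lin z x ^ N)"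
  have "fact (2 * l) * E = fact N * h z * of_real (kap 1 l)"
    using harmonic_reproducing[OF h, of "2 * l" z] gmean_lin_power_even[OF z] by (simp add: E_def N_def)
  then have "cmod (fact (2 * l) * E) = cmod (fact N * h z * of_real (kap 1 l))" by simp
  then have 1: "fact (2 * l) * cmod E = fact N * kap 1 l * cmod (h z)"
    using kap_pos[of 1 l] by (simp add: norm_mult mult_ac)
  \<comment> \<open>The factor \<open>sqn x ^ l\<close> raises \<open>h\<close> to degree
    \<open>N\<close>, that of the power it is paired with. Both squared norms then carry
    \<open>K N\<close>, which cancels against the \<open>K N\<close> produced by removing
    \<open>sqn x ^ l\<close>, and only \<open>K (k + l)\<close> is left.\<close>
  have "gmean (\<lambda>x. sqn x ^ l * (h x * lin z x ^ N)) * of_real (K (k + l)) = of_real (K (k + l + l)) * E"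
    unfolding K_def E_def
    by (rule gmean_sqn_power)
      (use hpoly_mult[OF hp hpoly_lin_power[of N z]] in \<open>simp add: N_def mult_2 add_ac\<close>)
  then have "cmod (gmean (\<lambda>x. (sqn x ^ l * h x) * lin z x ^ N) * of_real (K (k + l))) = cmod (of_real (K N) * E)"
    by (simp add: N_def mult.assoc mult_2 add.assoc)
  then have 2: "cmod (gmean (\<lambda>x. (sqn x ^ l * h x) * lin z x ^ N)) * K (k + l) = K N * cmod E"
    using K[of N] K[of "k + l"] by (simp add: norm_mult)
  have "(cmod (gmean (\<lambda>x. (sqn x ^ l * h x) * lin z x ^ N)))\<^sup>2 \<le>
      nsq (\<lambda>x. sqn x ^ l * h x) * nsq (\<lambda>x. lin z x ^ N)"
    by (rule gmean_Cauchy_Schwarz[OF hpoly_mult[OF hpoly_power[OF hpoly_sqn] hp] hpoly_lin_power])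
  also have "nsq (\<lambda>x. sqn x ^ l * h x) = K N * (hnorm k h)\<^sup>2"
  proof -
    have hh: "hpoly (2 * k) (\<lambda>x. h x * star h x)"
      using hpoly_mult[OF hp hpoly_star[OF hp]] by (simp add: mult_2)
    have "complex_of_real (nsq (\<lambda>x. sqn x ^ l * h x)) = gmean (\<lambda>x. sqn x ^ (2 * l) * (h x * star h x))"
      unfolding gmean_mult_star[symmetric] power_even_eq
      by (rule gmean_cong) (simp add: sqn_rpt power2_eq_square mult_ac)
    then have "complex_of_real (nsq (\<lambda>x. sqn x ^ l * h x) * K k) = of_real (K N * nsq h)"
      using gmean_sqn_power[OF hh, of "2 * l"] by (simp add: K_def N_def gmean_mult_star)
    then have "nsq (\<lambda>x. sqn x ^ l * h x) * K k = K N * nsq h" by (simp only: of_real_eq_iff)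
    also have "nsq h = K k * (hnorm k h)\<^sup>2" unfolding K_def by (rule hnorm_square)
    finally show ?thesis using K[of k] by simp
  qed
  also have "nsq (\<lambda>x. lin z x ^ N) \<le> K N"
  proof -
    have "norm z = 1"
    proof -
      have "norm z = norm \<theta>" by (simp add: z_def norm_vec_def complex_vec_def)
      with \<theta> show ?thesis by simp
    qed
    then show ?thesis using nsq_lin_power_le[of z N] by (simp add: K_def)
  qed
  finally have "(cmod (gmean (\<lambda>x. (sqn x ^ l * h x) * lin z x ^ N)))\<^sup>2 \<le> K N * (hnorm k h)\<^sup>2 * K N"
    using K[of N] by (simp add: mult_left_mono)
  then have "(cmod (gmean (\<lambda>x. (sqn x ^ l * h x) * lin z x ^ N)))\<^sup>2 \<le> (K N * hnorm k h)\<^sup>2"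
    by (simp add: power2_eq_square mult_ac)
  then have "cmod (gmean (\<lambda>x. (sqn x ^ l * h x) * lin z x ^ N)) \<le> K N * hnorm k h"
    using K[of N] hnorm_nonneg by (rule_tac power2_le_imp_le) auto
  then have "K N * cmod E \<le> K N * hnorm k h * K (k + l)"
    using K[of "k + l"] unfolding 2[symmetric] by (intro mult_right_mono) auto
  then have "cmod E \<le> K (k + l) * hnorm k h"
    using K[of N] by (simp add: mult_ac)
  then have "fact (2 * l) * cmod E \<le> fact (2 * l) * (K (k + l) * hnorm k h)"
    by (intro mult_left_mono) auto
  then show ?thesis unfolding 1 by (simp add: N_def K_def z_def mult_ac)
qed

end

text \<open>The dimension costs only a polynomial factor: \<open>d + 2 i\<close> is at most
  \<open>2 (i + 1 + d)\<close>, so \<open>kap\<close> is at most \<open>2 ^ n\<close> times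
  \<open>fact (n + d) / fact d\<close>, and \<open>fact (n + d)\<close> exceeds
  \<open>fact n\<close> by at most the factor \<open>(n + d) ^ d\<close>.\<close>

lemma kap_le: "kap d n \<le> 2 ^ n * fact n * real (n + d) ^ d"
proof -
  have *: "kap d n * fact d \<le> 2 ^ n * fact (n + d)"
  proof (induction n)
    case (Suc n)
    have "kap d (Suc n) * fact d = real (d + 2 * n) * (kap d n * fact d)" by (simp add: kap_Suc)
    also have "\<dots> \<le> real (2 * Suc (n + d)) * (2 ^ n * fact (n + d))"
      by (rule mult_mono) (use Suc in \<open>auto simp: kap_def intro!: prod_nonneg mult_nonneg_nonneg\<close>)
    also have "\<dots> = 2 ^ Suc n * fact (Suc n + d)" by simp
    finally show ?case .
  qed simp
  have **: "fact (n + d) \<le> fact n * real (n + d) ^ d"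
  proof -
    have "fact (n + d) = fact n * (\<Prod>i<d. real (n + Suc i))"
      by (induction d) (auto simp: algebra_simps)
    also have "\<dots> \<le> fact n * (\<Prod>i<d. real (n + d))"
      by (intro mult_left_mono prod_mono) auto
    finally show ?thesis by simp
  qed
  have "kap d n \<le> kap d n * fact d"
    using mult_left_mono[OF fact_ge_1[where 'a = real, of d], of "kap d n"]
    by (simp add: kap_def prod_nonneg)
  also note *
  also have "2 ^ n * fact (n + d) \<le> 2 ^ n * (fact n * real (n + d) ^ d)"
    by (rule mult_left_mono[OF **]) simp
  finally show ?thesis by (simp only: mult.assoc)
qed

text \<open>The lower bound \<open>4 ^ l / (2 l + 1)\<close> for the central binomial coefficient,
  with denominators cleared.\<close>

lemma fact_mult_le: "2 ^ (2 * l) * fact l * fact l \<le> (real (2 * l + 1)) * fact (2 * l)"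
proof (induction l)
  case (Suc l)
  have "2 ^ (2 * Suc l) * fact (Suc l) * fact (Suc l) = 4 * real (Suc l) * real (Suc l) * (2 ^ (2 * l) * fact l * fact l)"
    by (simp add: mult_ac)
  also have "\<dots> \<le> 4 * real (Suc l) * real (Suc l) * (real (2 * l + 1) * fact (2 * l))"
    by (intro mult_left_mono Suc) auto
  also have "\<dots> = (real (2 * Suc l) * real (2 * Suc l)) * (real (2 * l + 1) * fact (2 * l))"
    by (simp add: algebra_simps)
  also have "\<dots> \<le> (real (2 * Suc l) * real (2 * Suc l + 1)) * (real (2 * l + 1) * fact (2 * l))"
    by (intro mult_right_mono mult_left_mono) auto
  also have "\<dots> = real (2 * Suc l + 1) * fact (2 * Suc l)"
    by (simp add: algebra_simps)
  finally show ?case .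
qed simp

text \<open>From \<open>j\<close> to \<open>j + 1\<close> the left side gains
  \<open>2 (j + 1 + l)\<close> and the factorial on the right \<open>j + 1 + 2 l\<close>. Their
  quotient is \<open>1 + (j + 1) / (j + 1 + 2 l)\<close>, at most \<open>1 + 1 / (2 k)\<close>
  because \<open>j < k\<close> and \<open>l = k^2\<close>; after \<open>k\<close> steps the product
  is still bounded.\<close>

lemma fact_ratio_le:
  assumes "k \<ge> 1" "l = k * k"
  shows "j \<le> k \<Longrightarrow> 2 ^ (j + 2 * l) * fact (j + l) * fact l \<le> (1 + 1 / (2 * real k)) ^ j * real (2 * l + 1) * fact (j + 2 * l)"
proof (induction j)
  case 0
  then show ?case using fact_mult_le[of l] by simp
next
  case (Suc j)
  have "2 * real (Suc j + l) \<le> (1 + 1 / (2 * real k)) * real (Suc j + 2 * l)"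
  proof -
    define R where "R = real (Suc j + 2 * l)"
    have "real (Suc j) \<le> real k" using Suc by simp
    then have "2 * real k * real (Suc j) \<le> 2 * real k * real k"
      by (intro mult_left_mono) auto
    also have "\<dots> \<le> R" using assms by (simp add: R_def)
    finally have "real (Suc j) \<le> R / (2 * real k)"
      using assms by (simp add: field_simps)
    moreover have "(1 + 1 / (2 * real k)) * R = R + R / (2 * real k)"
      by (simp add: distrib_right)
    moreover have "2 * real (Suc j + l) = R + real (Suc j)" by (simp add: R_def)
    ultimately show ?thesis unfolding R_def[symmetric] by linarith
  qed
  then have "2 * real (Suc j + l) * (2 ^ (j + 2 * l) * fact (j + l) * fact l) \<le>
      (1 + 1 / (2 * real k)) * real (Suc j + 2 * l) * ((1 + 1 / (2 * real k)) ^ j * real (2 * l + 1) * fact (j + 2 * l))"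
    by (rule mult_mono) (use Suc in auto)
  also have "2 * real (Suc j + l) * (2 ^ (j + 2 * l) * fact (j + l) * fact l) =
      2 ^ (Suc j + 2 * l) * fact (Suc j + l) * fact l"
    by (simp only: add_Suc fact_Suc power_Suc mult_ac)
  also have "(1 + 1 / (2 * real k)) * real (Suc j + 2 * l) * ((1 + 1 / (2 * real k)) ^ j * real (2 * l + 1) * fact (j + 2 * l)) =
      (1 + 1 / (2 * real k)) ^ Suc j * real (2 * l + 1) * fact (Suc j + 2 * l)"
    by (simp only: add_Suc fact_Suc power_Suc mult_ac)
  finally show ?case .
qed

context ellipsoid_axes
begin

text \<open>With \<open>l = k * k\<close>: the 2 bounds \<open>(1 + 1 / (2 k)) ^ k\<close>, the
  factor \<open>2 l + 1\<close> comes from the central binomial coefficient, and the power from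
  \<open>kap_le\<close> at \<open>k + l\<close>.\<close>

definition supc :: "nat \<Rightarrow> real" where
  "supc k = 2 * real (2 * (k * k) + 1) * real (k + k * k + CARD('n)) ^ CARD('n)"

lemma pharm_bound_real:
  assumes h: "pharm k h" and \<theta>: "norm \<theta> = 1"
  shows "cmod (h (complex_vec \<theta>)) \<le> supc k * hnorm k h"
proof (cases "k = 0")
  case True
  have "cmod (h (complex_vec \<theta>)) \<le> hnorm k h"
    using pharm_bound_complex[OF h, of "complex_vec \<theta>"] True by simp
  also have "\<dots> \<le> supc k * hnorm k h"
  proof -
    have "1 \<le> real CARD('n) ^ CARD('n)" by (rule one_le_power) (simp add: Suc_leI)
    moreover have "supc k = 2 * real CARD('n) ^ CARD('n)" using True by (simp add: supc_def)
    ultimately have "1 \<le> supc k" by linarith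
    from mult_right_mono[OF this hnorm_nonneg] show ?thesis by simp
  qed
  finally show ?thesis .
next
  case False
  define l where "l = k * k"
  define d where "d = CARD('n)"
  define c where "c = cmod (h (complex_vec \<theta>))"
  define H where "H = hnorm k h"
  have c: "c \<ge> 0" and H: "H \<ge> 0" by (simp_all add: c_def H_def hnorm_nonneg)
  have aux: "fact (k + 2 * l) * kap 1 l * c \<le> fact (2 * l) * kap d (k + l) * H"
    unfolding c_def H_def d_def by (rule pharm_bound_aux[OF h \<theta>])
  \<comment> \<open>The identity \<open>(2 l - 1)!! (2 l)!! = (2 l)!\<close>, which removes
    \<open>kap 1 l\<close> from both sides.\<close>
  have df: "kap 1 l * (2 ^ l * fact l) = fact (2 * l)" for l
  proof (induction l)
    case (Suc l)
    have "kap 1 (Suc l) * (2 ^ Suc l * fact (Suc l)) = real (1 + 2 * l) * (2 * real (Suc l)) * (kap 1 l * (2 ^ l * fact l))"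
      by (simp only: kap_Suc power_Suc fact_Suc mult_ac)
    then show ?case unfolding Suc by (simp add: algebra_simps)
  qed simp
  have kp: "kap 1 l > 0" by (simp add: kap_pos)
  have "kap 1 l * (fact (k + 2 * l) * c) \<le> kap 1 l * (2 ^ l * fact l * kap d (k + l) * H)"
    using aux unfolding df[symmetric] by (simp add: mult_ac)
  then have "fact (k + 2 * l) * c \<le> 2 ^ l * fact l * kap d (k + l) * H"
    using kp by simp
  also have "\<dots> \<le> 2 ^ l * fact l * (2 ^ (k + l) * fact (k + l) * real (k + l + d) ^ d) * H"
    by (intro mult_right_mono mult_left_mono kap_le) (auto simp: H)
  also have "\<dots> = (2 ^ (k + 2 * l) * fact (k + l) * fact l) * (real (k + l + d) ^ d * H)"
  proof -
    have p: "(2::real) ^ (k + 2 * l) = 2 ^ l * 2 ^ (k + l)" by (simp add: mult_2 flip: power_add)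
    show ?thesis unfolding p by (simp only: mult_ac)
  qed
  also have "\<dots> \<le> ((1 + 1 / (2 * real k)) ^ k * real (2 * l + 1) * fact (k + 2 * l)) * (real (k + l + d) ^ d * H)"
    using False H by (intro mult_right_mono fact_ratio_le) (auto simp: l_def)
  also have "\<dots> \<le> (2 * real (2 * l + 1) * fact (k + 2 * l)) * (real (k + l + d) ^ d * H)"
  proof (intro mult_right_mono)
    have "(1 + 1 / (2 * real k)) ^ k \<le> exp (1 / (2 * real k)) ^ k"
      by (intro power_mono exp_ge_add_one_self) auto
    also have "\<dots> = exp (1 / 2)" using False by (simp flip: exp_of_nat_mult)
    also have "\<dots> \<le> 2" using exp_bound_half[of "1/2::real"] by simp
    finally show "(1 + 1 / (2 * real k)) ^ k \<le> 2" .
  qed (use H in auto)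
  finally have "fact (k + 2 * l) * c \<le> fact (k + 2 * l) * (supc k * H)"
    by (simp add: supc_def d_def l_def mult_ac)
  then show ?thesis by (simp add: c_def H_def)
qed

text \<open>Polynomial growth stays below every geometric rate, so an arbitrarily small dilation of
  the radius absorbs the passage from the \<open>L^2\<close> norm to the supremum.\<close>

lemma supc_subexponential:
  assumes "lam > 1"
  shows "\<exists>C>0. \<forall>k. supc k \<le> C * lam ^ k"
proof -
  have "(\<lambda>k. supc k / lam ^ k) \<longlonglongrightarrow> 0"
    unfolding supc_def using assms by real_asymp
  then have "Bseq (\<lambda>k. supc k / lam ^ k)" using convergent_imp_Bseq convergent_def by blast
  then obtain C where C: "C > 0" "\<And>k. norm (supc k / lam ^ k) \<le> C" by (auto elim: BseqE)
  have "supc k \<le> C * lam ^ k" for k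
  proof -
    have "supc k / lam ^ k \<le> C" using C(2)[of k] abs_ge_self[of "supc k / lam ^ k"]
      unfolding real_norm_def by linarith
    then show ?thesis using assms by (simp add: field_simps)
  qed
  with C(1) show ?thesis by blast
qed

end

section \<open>The harmonic extension\<close>

lemma lap_uniform_limit:
  assumes "\<And>n. entire (F n)" "\<And>R. uniform_limit (cball 0 R) F G sequentially"
    and "\<And>n z. lap (F n) z = 0"
  shows "lap G z = 0"
proof -
  have G: "entire G" by (rule entire_uniform_limit[OF assms(1,2)])
  have 1: "uniform_limit (cball 0 R) (\<lambda>n. pd i (F n)) (pd i G) sequentially" for i R
    by (rule uniform_limit_pd[OF assms(1) G assms(2)])
  have 2: "uniform_limit (cball 0 R) (\<lambda>n. pd i (pd i (F n))) (pd i (pd i G)) sequentially" for i R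
    by (rule uniform_limit_pd[OF entire_pd[OF assms(1)] entire_pd[OF G] 1])
  have "(\<lambda>n. lap (F n) z) \<longlonglongrightarrow> lap G z"
    unfolding lap_def
    by (intro tendsto_sum tendsto_uniform_limitI[OF 2[where R = "norm z"]]) simp
  then show ?thesis by (simp add: assms(3) LIMSEQ_const_iff)
qed

section \<open>Elementary properties of the maximum modulus\<close>

lemma max_modulus_bdd:
  fixes f :: "complex ^ 'n \<Rightarrow> complex"
  assumes "entire f"
  shows "bdd_above {cmod (f (\<zeta> *s complex_vec \<theta>)) | \<zeta> \<theta>. cmod \<zeta> = r \<and> norm \<theta> = 1}"
proof -
  have "norm (complex_vec \<theta>) = norm \<theta>" for \<theta> :: "real ^ 'n"
    by (simp add: norm_vec_def complex_vec_def)
  then have sub: "{f (\<zeta> *s complex_vec \<theta>) | \<zeta> \<theta>. cmod \<zeta> = r \<and> norm \<theta> = 1} \<subseteq> f ` cball 0 r"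
    by (auto simp: norm_vector_scalar_mult)
  have "bounded (f ` cball 0 r)"
    by (intro compact_imp_bounded compact_continuous_image entire_continuous assms) auto
  then obtain B where "\<And>y. y \<in> f ` cball 0 r \<Longrightarrow> cmod y \<le> B" by (auto simp: bounded_iff)
  with sub show ?thesis by (intro bdd_aboveI[of _ B]) auto
qed

lemma max_modulus_ge:
  "entire f \<Longrightarrow> cmod \<zeta> = r \<Longrightarrow> norm \<theta> = 1 \<Longrightarrow> cmod (f (\<zeta> *s complex_vec \<theta>)) \<le> max_modulus f r"
  unfolding max_modulus_def by (rule cSup_upper[OF _ max_modulus_bdd]) auto

lemma max_modulus_le:
  fixes f :: "complex ^ 'n \<Rightarrow> complex"
  assumes "r \<ge> 0" "\<And>\<zeta> \<theta>. cmod \<zeta> = r \<Longrightarrow> norm \<theta> = 1 \<Longrightarrow> cmod (f (\<zeta> *s complex_vec \<theta>)) \<le> B"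
  shows "max_modulus f r \<le> B"
  unfolding max_modulus_def
proof (rule cSup_least)
  obtain \<theta> :: "real ^ 'n" where "norm \<theta> = 1" using vector_choose_size[of 1] by auto
  moreover have "cmod (of_real r) = r" using assms(1) by simp
  ultimately show "{cmod (f (\<zeta> *s complex_vec \<theta>)) | \<zeta> \<theta>. cmod \<zeta> = r \<and> norm \<theta> = 1} \<noteq> {}" by blast
qed (use assms(2) in auto)

lemma max_modulus_nonneg:
  fixes f :: "complex ^ 'n \<Rightarrow> complex"
  assumes "entire f" "r \<ge> 0"
  shows "max_modulus f r \<ge> 0"
proof -
  obtain \<theta> :: "real ^ 'n" where "norm \<theta> = 1" using vector_choose_size[of 1] by auto
  with max_modulus_ge[OF assms(1), of "of_real r" r \<theta>] assms(2) show ?thesis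
    by (auto intro: order_trans[OF norm_ge_zero])
qed

context ellipsoid_axes
begin

lemma hnorm_hpart_le:
  assumes "entire f" "r > 0"
  shows "hnorm m (hpart f m) \<le> max_modulus f r / r ^ m"
proof (rule hnorm_le_sup[OF hpoly_hpart[OF assms(1)]])
  show "max_modulus f r / r ^ m \<ge> 0"
    using assms by (simp add: max_modulus_nonneg)
  fix \<theta> :: "real ^ 'n" assume "norm \<theta> = 1"
  then show "cmod (hpart f m (complex_vec \<theta>)) \<le> max_modulus f r / r ^ m"
    using assms by (intro hpart_Cauchy max_modulus_ge)
qed

text \<open>The constant \<open>2 * (1 + hi / lo)\<close> enters once per component and does not
  accumulate: only the quotients are passed on, and each of these costs just
  \<open>1 / lo\<close>.\<close>

lemma harmonic_components:
  "hpoly m f \<Longrightarrow> \<exists>hs. (\<forall>j \<le> m div 2. pharm (m - 2 * j) (hs j) \<and>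
      hnorm (m - 2 * j) (hs j) \<le> 2 * (1 + hi / lo) * (1 / lo) ^ j * hnorm m f) \<and>
    (\<forall>z. qform a z = 1 \<longrightarrow> (\<Sum>j\<le>m div 2. hs j z) = f z)"
proof (induction m arbitrary: f rule: less_induct)
  case (less m)
  show ?case
  proof (cases "m < 2")
    case True
    then have m: "m = 0 \<or> m = 1" by auto
    then have "pharm m f"
      using less.prems lap_hpoly_0 lap_hpoly_1 by (auto simp: pharm_def)
    moreover have "1 * hnorm m f \<le> 2 * (1 + hi / lo) * hnorm m f"
      using lo_pos hi_pos hnorm_nonneg by (intro mult_right_mono) auto
    ultimately show ?thesis
      using True by (intro exI[of _ "\<lambda>_. f"]) auto
  next
    case False
    then obtain k where k: "m = k + 2" by (metis add.commute le_Suc_ex not_less)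
    obtain q where q: "hpoly k q" "pharm m (\<lambda>z. f z - qform a z * q z)"
      "hnorm k q \<le> hnorm m f / lo"
      "hnorm m (\<lambda>z. f z - qform a z * q z) \<le> 2 * (1 + hi / lo) * hnorm m f"
      using Fischer_decomposition[of k f] less.prems k by auto
    obtain hs where hs:
      "\<And>j. j \<le> k div 2 \<Longrightarrow> pharm (k - 2 * j) (hs j)"
      "\<And>j. j \<le> k div 2 \<Longrightarrow> hnorm (k - 2 * j) (hs j) \<le> 2 * (1 + hi / lo) * (1 / lo) ^ j * hnorm k q"
      "\<And>z. qform a z = 1 \<Longrightarrow> (\<Sum>j\<le>k div 2. hs j z) = q z"
      using less.IH[OF _ q(1)] k by auto
    define hs' where "hs' = case_nat (\<lambda>z. f z - qform a z * q z) hs"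
    have m2: "m div 2 = Suc (k div 2)" using k by simp
    show ?thesis
    proof (intro exI[of _ hs'] conjI allI impI)
      fix j assume j: "j \<le> m div 2"
      show "pharm (m - 2 * j) (hs' j)"
        using j q(2) hs(1) k by (cases j) (auto simp: hs'_def)
      show "hnorm (m - 2 * j) (hs' j) \<le> 2 * (1 + hi / lo) * (1 / lo) ^ j * hnorm m f"
      proof (cases j)
        case (Suc i)
        then have "hnorm (m - 2 * j) (hs' j) \<le> 2 * (1 + hi / lo) * (1 / lo) ^ i * hnorm k q"
          using hs(2)[of i] j k by (simp add: hs'_def)
        also have "\<dots> \<le> 2 * (1 + hi / lo) * (1 / lo) ^ i * (hnorm m f / lo)"
          using q(3) lo_pos hi_pos by (intro mult_left_mono) auto
        also have "\<dots> = 2 * (1 + hi / lo) * (1 / lo) ^ j * hnorm m f"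
          using Suc by simp
        finally show ?thesis .
      qed (use q(4) in \<open>simp add: hs'_def\<close>)
    next
      fix z assume z: "qform a z = 1"
      have "(\<Sum>j\<le>m div 2. hs' j z) = hs' 0 z + (\<Sum>j\<le>k div 2. hs' (Suc j) z)"
        unfolding m2 by (rule sum.atMost_Suc_shift)
      then show "(\<Sum>j\<le>m div 2. hs' j z) = f z"
        using hs(3)[OF z] z by (simp add: hs'_def)
    qed
  qed
qed

definition fb :: real where "fb = 2 * (1 + hi / lo)"
text \<open>\<open>CARD('n) + 2\<close> is the exponential rate of
  \<open>pharm_bound_complex\<close>; the maximum absorbs \<open>(1 / lo) ^ j\<close> whether
  \<open>lo\<close> is below or above 1.\<close>

definition fc :: real where "fc = (real CARD('n) + 2) * max 1 (1 / lo)"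

lemma fb_pos: "fb > 0"
  unfolding fb_def using lo_pos hi_pos by (simp add: add_pos_pos)

lemma fc_ge: "fc \<ge> 1"
proof -
  have "1 * 1 \<le> (real CARD('n) + 2) * max 1 (1 / lo)" by (intro mult_mono) auto
  then show ?thesis by (simp add: fc_def)
qed

text \<open>Two bounds for two purposes. The first holds at all complex points with an exponential
  rate and gives locally uniform convergence. The second is restricted to complex multiples, of
  large modulus, of real unit vectors; its rate \<open>lam\<close> can be taken arbitrarily close to
  1, and it governs the growth.\<close>

lemma polynomial_Dirichlet:
  assumes f: "hpoly m f"
  shows "\<exists>h. entire h \<and> (\<forall>z. lap h z = 0) \<and> (\<forall>z. qform a z = 1 \<longrightarrow> h z = f z) \<and>
    (\<forall>z R. R \<ge> 1 \<longrightarrow> norm z \<le> R \<longrightarrow> cmod (h z) \<le> real (m + 1) * fb * (fc * R) ^ m * hnorm m f) \<and>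
    (\<forall>lam C \<zeta> \<theta>. lam \<ge> 1 \<longrightarrow> C \<ge> 0 \<longrightarrow> (\<forall>k. supc k \<le> C * lam ^ k) \<longrightarrow> norm \<theta> = 1 \<longrightarrow> (cmod \<zeta>)\<^sup>2 \<ge> 2 / lo \<longrightarrow>
        cmod (h (\<zeta> *s complex_vec \<theta>)) \<le> 2 * fb * C * (lam * cmod \<zeta>) ^ m * hnorm m f)"
proof -
  obtain hs where hs: "\<And>j. j \<le> m div 2 \<Longrightarrow> pharm (m - 2 * j) (hs j)"
    "\<And>j. j \<le> m div 2 \<Longrightarrow> hnorm (m - 2 * j) (hs j) \<le> fb * (1 / lo) ^ j * hnorm m f"
    "\<And>z. qform a z = 1 \<Longrightarrow> (\<Sum>j\<le>m div 2. hs j z) = f z"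
    using harmonic_components[OF f] unfolding fb_def by blast
  define h where "h = (\<lambda>z. \<Sum>j\<le>m div 2. hs j z)"
  define N where "N = hnorm m f"
  have N: "N \<ge> 0" by (simp add: N_def hnorm_nonneg)
  have ent: "entire (hs j)" if "j \<le> m div 2" for j
    using hs(1)[OF that] by (auto simp: pharm_def intro: hpoly_entire)
  have "entire h" unfolding h_def using ent by (intro entire_sum) auto
  moreover have "lap h z = 0" for z
    unfolding h_def using hs(1) ent by (subst lap_sum) (auto simp: pharm_def)
  moreover have "h z = f z" if "qform a z = 1" for z
    using hs(3)[OF that] by (simp add: h_def)
  moreover have "cmod (h z) \<le> real (m + 1) * fb * (fc * R) ^ m * N" if R: "R \<ge> 1" "norm z \<le> R" for z R
  proof -
    have "cmod (hs j z) \<le> fb * (fc * R) ^ m * N" if j: "j \<le> m div 2" for j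
    proof -
      define d where "d = real (CARD('n) + 2)"
      have d: "d \<ge> 1" by (simp add: d_def)
      have jm: "j \<le> m" using j by simp
      have "cmod (hs j z) \<le> d ^ (m - 2 * j) * norm z ^ (m - 2 * j) * hnorm (m - 2 * j) (hs j)"
        unfolding d_def by (rule pharm_bound_complex[OF hs(1)[OF j]])
      also have "\<dots> \<le> d ^ m * R ^ m * (fb * (max 1 (1 / lo)) ^ m * N)"
      proof (intro mult_mono)
        show "d ^ (m - 2 * j) \<le> d ^ m" using d by (intro power_increasing) auto
        have "norm z ^ (m - 2 * j) \<le> R ^ (m - 2 * j)" using R by (intro power_mono) auto
        also have "\<dots> \<le> R ^ m" using R by (intro power_increasing) auto
        finally show "norm z ^ (m - 2 * j) \<le> R ^ m" .
        have "(1 / lo) ^ j \<le> (max 1 (1 / lo)) ^ j" using lo_pos by (intro power_mono) auto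
        also have "\<dots> \<le> (max 1 (1 / lo)) ^ m" using jm by (intro power_increasing) auto
        finally have "fb * (1 / lo) ^ j * N \<le> fb * (max 1 (1 / lo)) ^ m * N"
          using fb_pos N by (intro mult_right_mono mult_left_mono) auto
        then show "hnorm (m - 2 * j) (hs j) \<le> fb * (max 1 (1 / lo)) ^ m * N"
          using hs(2)[OF j] by (simp add: N_def)
      qed (use d R hnorm_nonneg in auto)
      also have "\<dots> = fb * (fc * R) ^ m * N"
        by (simp add: fc_def d_def power_mult_distrib add.commute)
      finally show ?thesis .
    qed
    then have "cmod (h z) \<le> (\<Sum>j\<le>m div 2. fb * (fc * R) ^ m * N)"
      unfolding h_def by (intro sum_norm_le) auto
    also have "\<dots> = real (m div 2 + 1) * (fb * (fc * R) ^ m * N)" by simp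
    also have "\<dots> \<le> real (m + 1) * (fb * (fc * R) ^ m * N)"
      using fb_pos fc_ge R N by (intro mult_right_mono mult_nonneg_nonneg) auto
    finally show ?thesis by (simp add: mult.assoc)
  qed
  moreover have "cmod (h (\<zeta> *s complex_vec \<theta>)) \<le> 2 * fb * C * (lam * cmod \<zeta>) ^ m * N"
    if lam: "lam \<ge> 1" and C: "C \<ge> 0" "\<forall>k. supc k \<le> C * lam ^ k" and \<theta>: "norm \<theta> = 1"
      and \<zeta>: "(cmod \<zeta>)\<^sup>2 \<ge> 2 / lo" for lam C \<zeta> \<theta>
  proof -
    define r where "r = cmod \<zeta>"
    define T where "T = fb * C * (lam * r) ^ m * N"
    have r: "r \<ge> 0" by (simp add: r_def)
    have T: "T \<ge> 0" using fb_pos C lam r N by (simp add: T_def)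
    have "cmod (hs j (\<zeta> *s complex_vec \<theta>)) \<le> T * (1 / 2) ^ j" if j: "j \<le> m div 2" for j
    proof -
      have hp: "hpoly (m - 2 * j) (hs j)" using hs(1)[OF j] by (simp add: pharm_def)
      have "cmod (hs j (complex_vec \<theta>)) \<le> supc (m - 2 * j) * hnorm (m - 2 * j) (hs j)"
        by (rule pharm_bound_real[OF hs(1)[OF j] \<theta>])
      also have "\<dots> \<le> (C * lam ^ (m - 2 * j)) * (fb * (1 / lo) ^ j * N)"
        using C hs(2)[OF j] hnorm_nonneg lam by (intro mult_mono) (auto simp: N_def)
      also have "\<dots> \<le> (C * lam ^ m) * (fb * (1 / lo) ^ j * N)"
        using C lam fb_pos N lo_pos
        by (intro mult_right_mono mult_left_mono power_increasing mult_nonneg_nonneg) auto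
      finally have "r ^ (m - 2 * j) * cmod (hs j (complex_vec \<theta>)) \<le>
          r ^ (m - 2 * j) * ((C * lam ^ m) * (fb * (1 / lo) ^ j * N))"
        using r by (intro mult_left_mono) auto
      also have "\<dots> = C * lam ^ m * fb * N * (r ^ (m - 2 * j) * (1 / lo) ^ j)"
        by (simp add: mult_ac)
      \<comment> \<open>The hypothesis reads \<open>1 / lo \<le> r^2 / 2\<close>: the missing power
        \<open>r ^ (2 * j)\<close> is restored and a factor \<open>(1 / 2) ^ j\<close>
        gained.\<close>
      also have "r ^ (m - 2 * j) * (1 / lo) ^ j \<le> r ^ (m - 2 * j) * (r\<^sup>2 * (1 / 2)) ^ j"
        using \<zeta> r lo_pos by (intro mult_left_mono power_mono) (auto simp: r_def field_simps)
      also have "r ^ (m - 2 * j) * (r\<^sup>2 * (1 / 2)) ^ j = r ^ (m - 2 * j) * r ^ (2 * j) * (1 / 2) ^ j"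
        by (simp only: power_mult_distrib power_mult mult.assoc)
      also have "r ^ (m - 2 * j) * r ^ (2 * j) = r ^ m"
        using j by (simp flip: power_add)
      finally have "r ^ (m - 2 * j) * cmod (hs j (complex_vec \<theta>)) \<le> C * lam ^ m * fb * N * (r ^ m * (1 / 2) ^ j)"
        using C lam fb_pos N by (simp add: mult_left_mono)
      then show ?thesis
        by (simp add: hpoly_scale[OF hp] norm_mult norm_power r_def T_def power_mult_distrib mult_ac)
    qed
    then have "cmod (h (\<zeta> *s complex_vec \<theta>)) \<le> (\<Sum>j\<le>m div 2. T * (1 / 2) ^ j)"
      unfolding h_def by (intro sum_norm_le) auto
    also have "\<dots> = T * (\<Sum>j\<le>m div 2. (1 / 2) ^ j)" by (simp add: sum_distrib_left)
    also have "\<dots> \<le> T * 2"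
    proof (rule mult_left_mono[OF _ T])
      have "(\<Sum>j\<le>n. (1 / 2 :: real) ^ j) = 2 - (1 / 2) ^ n" for n
        by (induction n) auto
      then show "(\<Sum>j\<le>m div 2. (1 / 2 :: real) ^ j) \<le> 2" by simp
    qed
    finally show ?thesis by (simp add: T_def r_def mult_ac)
  qed
  ultimately show ?thesis unfolding N_def by blast
qed

lemma harmonic_extension:
  assumes f: "entire f"
  shows "\<exists>H. entire H \<and> (\<forall>z. lap H z = 0) \<and> (\<forall>z. qform a z = 1 \<longrightarrow> H z = f z) \<and>
    (\<forall>lam>1. \<exists>C>0. \<forall>r. r\<^sup>2 \<ge> 2 / lo \<longrightarrow> r > 0 \<longrightarrow> max_modulus H r \<le> C * max_modulus f (lam * r))"
proof -
  define N where "N = (\<lambda>m. hnorm m (hpart f m))"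
  have N: "N m \<ge> 0" for m by (simp add: N_def hnorm_nonneg)
  have Nle: "N m \<le> max_modulus f r / r ^ m" if "r > 0" for m r
    unfolding N_def by (rule hnorm_hpart_le[OF f that])
  from polynomial_Dirichlet[OF hpoly_hpart[OF f]]
  obtain h where h: "\<And>m. entire (h m)" "\<And>m z. lap (h m) z = 0" "\<And>m z. qform a z = 1 \<Longrightarrow> h m z = hpart f m z"
    and hc: "\<And>m z R. R \<ge> 1 \<Longrightarrow> norm z \<le> R \<Longrightarrow> cmod (h m z) \<le> real (m + 1) * fb * (fc * R) ^ m * N m"
    and hr: "\<And>m lam C \<zeta> \<theta>. lam \<ge> 1 \<Longrightarrow> C \<ge> 0 \<Longrightarrow> (\<forall>k. supc k \<le> C * lam ^ k) \<Longrightarrow> norm \<theta> = 1 \<Longrightarrow>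
        (cmod \<zeta>)\<^sup>2 \<ge> 2 / lo \<Longrightarrow> cmod (h m (\<zeta> *s complex_vec \<theta>)) \<le> 2 * fb * C * (lam * cmod \<zeta>) ^ m * N m"
    unfolding N_def by metis
  define H where "H = (\<lambda>z. \<Sum>m. h m z)"
  define S where "S = (\<lambda>n z. \<Sum>m<n. h m z)"
  have lim: "uniform_limit (cball 0 R) S H sequentially" for R
    unfolding S_def H_def
  proof (rule Weierstrass_m_test)
    define R' where "R' = max 1 R"
    \<comment> \<open>Cauchy's estimate for \<open>f\<close> may be taken at any radius; this one
      beats the rate \<open>fc * R'\<close> by powers of 2.\<close>
    define r where "r = 2 * fc * R'"
    have r: "r > 0" using fc_ge by (simp add: r_def R'_def)
    fix m z assume z: "z \<in> cball (0 :: complex ^ 'n) R"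
    have "cmod (h m z) \<le> real (m + 1) * fb * (fc * R') ^ m * N m"
      using z by (intro hc) (auto simp: R'_def)
    also have "\<dots> \<le> real (m + 1) * fb * (fc * R') ^ m * (max_modulus f r / r ^ m)"
      using fb_pos fc_ge by (intro mult_left_mono Nle r) (auto simp: R'_def)
    also have "\<dots> = fb * max_modulus f r * (real (m + 1) * (1 / 2) ^ m)"
      using fc_ge by (simp add: r_def R'_def power_mult_distrib field_simps)
    finally show "cmod (h m z) \<le> fb * max_modulus f r * (real (m + 1) * (1 / 2) ^ m)" .
  next
    have "summable (\<lambda>m. real (m + 1) * (1 / 2 :: real) ^ m)"
      using geometric_deriv_sums[of "1/2 :: real"] by (simp add: sums_iff)
    then show "summable (\<lambda>m. fb * max_modulus f (2 * fc * max 1 R) * (real (m + 1) * (1 / 2) ^ m))"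
      by (rule summable_mult)
  qed
  have S: "entire (S n)" for n unfolding S_def by (intro entire_sum h)
  have H: "entire H" by (rule entire_uniform_limit[OF S lim])
  have sums: "(\<lambda>m. h m z) sums H z" for z
    using tendsto_uniform_limitI[OF lim[of "norm z"], of z] by (simp add: sums_def S_def)
  have lapS: "lap (S n) z = 0" for n z
    unfolding S_def by (subst lap_sum) (auto simp: h)
  have "lap H z = 0" for z by (rule lap_uniform_limit[OF S lim lapS])
  moreover have "H z = f z" if "qform a z = 1" for z
    using sums[of z] hpart_sums[OF f, of z] h(3)[OF that] by (simp add: sums_unique2)
  moreover have "\<exists>C>0. \<forall>r. r\<^sup>2 \<ge> 2 / lo \<longrightarrow> r > 0 \<longrightarrow> max_modulus H r \<le> C * max_modulus f (lam * r)"
    if lam: "lam > 1" for lam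
  proof -
    \<comment> \<open>One factor \<open>q\<close> pays for the polynomial \<open>supc\<close>, the
      other leaves a geometric series in \<open>1 / q\<close>.\<close>
    define q where "q = sqrt lam"
    have q: "q > 1" "lam = q * q" using lam by (auto simp: q_def)
    obtain C where C: "C > 0" "\<forall>k. supc k \<le> C * q ^ k" using supc_subexponential[OF q(1)] by blast
    define K where "K = 2 * fb * C * (1 / (1 - 1 / q))"
    have "K > 0" using fb_pos C q by (simp add: K_def)
    moreover have "max_modulus H r \<le> K * max_modulus f (lam * r)" if r: "r\<^sup>2 \<ge> 2 / lo" "r > 0" for r
    proof (rule max_modulus_le)
      fix \<zeta> :: complex and \<theta> :: "real ^ 'n"
      assume \<zeta>: "cmod \<zeta> = r" and \<theta>: "norm \<theta> = 1"
      define M where "M = max_modulus f (lam * r)"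
      have M: "M \<ge> 0" using lam r f by (simp add: M_def max_modulus_nonneg)
      have b: "cmod (h m (\<zeta> *s complex_vec \<theta>)) \<le> 2 * fb * C * M * (1 / q) ^ m" for m
      proof -
        have "cmod (h m (\<zeta> *s complex_vec \<theta>)) \<le> 2 * fb * C * (q * cmod \<zeta>) ^ m * N m"
          using q C \<theta> r by (intro hr) (auto simp: \<zeta>)
        also have "\<dots> \<le> 2 * fb * C * (q * cmod \<zeta>) ^ m * (M / (lam * r) ^ m)"
          unfolding M_def using q C r lam fb_pos by (intro mult_left_mono Nle) (auto simp: \<zeta>)
        also have "\<dots> = 2 * fb * C * M * (1 / q) ^ m"
          using q r by (simp add: \<zeta> power_mult_distrib field_simps)
        finally show ?thesis .
      qed
      have geo: "(\<lambda>m. 2 * fb * C * M * (1 / q) ^ m) sums (2 * fb * C * M * (1 / (1 - 1 / q)))"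
        using q by (intro sums_mult geometric_sums) auto
      have "cmod (H (\<zeta> *s complex_vec \<theta>)) \<le> (\<Sum>m. 2 * fb * C * M * (1 / q) ^ m)"
        unfolding H_def by (rule norm_suminf_le[OF b sums_summable[OF geo]])
      also have "\<dots> = K * M" using geo by (simp add: sums_iff K_def mult_ac)
      finally show "cmod (H (\<zeta> *s complex_vec \<theta>)) \<le> K * max_modulus f (lam * r)" by (simp add: M_def)
    qed (use r in simp)
    ultimately show ?thesis by blast
  qed
  ultimately show ?thesis using H by blast
qed

end

section \<open>Order and type\<close>

lemma entire_hpart_eq_0_imp_const:
  assumes "entire f" "\<And>m. m > 0 \<Longrightarrow> hpart f m = (\<lambda>_. 0)"
  shows "f constant_on UNIV"
proof -
  have "f z = hpart f 0 z" for z
  proof -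
    have "(\<lambda>m. hpart f m z) sums (\<Sum>m\<in>{0}. hpart f m z)"
      by (rule sums_finite) (use assms(2) in auto)
    then show ?thesis using hpart_sums[OF assms(1), of z] sums_unique2 by fastforce
  qed
  moreover have "hpart f 0 z = hpart f 0 0" for z
    using hpoly_scale[OF hpoly_hpart[OF assms(1)], of 0 0 z] by simp
  ultimately have "f z = hpart f 0 0" for z by simp
  then show ?thesis by (auto simp: constant_on_def)
qed

text \<open>The axes play no role here: any choice gives the norms \<open>hnorm\<close>.\<close>

lemma max_modulus_at_top:
  fixes f :: "complex ^ 'n \<Rightarrow> complex"
  assumes f: "entire f" and nc: "\<not> f constant_on UNIV"
  shows "filterlim (max_modulus f) at_top at_top"
proof -
  interpret ellipsoid_axes "1 :: real ^ 'n" by standard simp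
  \<comment> \<open>A nonzero homogeneous part of positive degree \<open>m\<close> forces
    \<open>max_modulus f r\<close> to grow at least like \<open>r ^ m\<close>.\<close>
  obtain m z where m: "m > 0" "hpart f m z \<noteq> 0"
    using entire_hpart_eq_0_imp_const[OF f] nc by (metis (no_types, lifting) ext)
  define N where "N = hnorm m (hpart f m)"
  have "nsq (hpart f m) \<noteq> 0"
    using nsq_eq_0D[OF hpoly_hpart[OF f]] m(2) by blast
  then have "N \<noteq> 0"
    using hnorm_square[of "hpart f m" m] by (auto simp: N_def)
  then have N: "N > 0" using hnorm_nonneg[of m "hpart f m"] by (simp add: N_def)
  show ?thesis
  proof (rule filterlim_at_top_mono)
    show "filterlim (\<lambda>r. N * r ^ m) at_top at_top"
      by (rule filterlim_tendsto_pos_mult_at_top[OF tendsto_const N])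
        (rule filterlim_pow_at_top[OF m(1) filterlim_ident])
    show "\<forall>\<^sub>F r in at_top. N * r ^ m \<le> max_modulus f r"
      using eventually_gt_at_top[of 0]
    proof eventually_elim
      case (elim r)
      then show ?case using hnorm_hpart_le[OF f elim, of m] by (simp add: N_def field_simps)
    qed
  qed
qed

lemma max_modulus_const:
  assumes "f constant_on UNIV"
  shows "\<exists>c. \<forall>r\<ge>0. max_modulus f r \<le> c"
proof -
  from assms obtain y where "\<And>z. f z = y" by (auto simp: constant_on_def)
  then have "max_modulus f r \<le> cmod y" if "r \<ge> 0" for r
    using that by (intro max_modulus_le) auto
  then show ?thesis by blast
qed

text \<open>For the order any fixed dilation will do, and 2 is used: it disappears, like the
  constant, under two logarithms. For the type a dilation by \<open>lam\<close> multiplies the bound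
  by \<open>lam powr \<rho>\<close>, hence the demand for \<open>lam\<close> arbitrarily near
  1.\<close>

lemma
  fixes f H :: "complex ^ 'n \<Rightarrow> complex"
  assumes f: "entire f" and H: "entire H"
    and le: "\<And>lam. lam > 1 \<Longrightarrow> \<exists>C>0. \<forall>\<^sub>F r in at_top. max_modulus H r \<le> C * max_modulus f (lam * r)"
  shows growth_order_mono: "growth_order H \<le> growth_order f"
    and growth_type_mono: "\<lbrakk>0 < growth_order H; growth_order H = growth_order f; growth_order f < \<infinity>\<rbrakk>
      \<Longrightarrow> growth_type H \<le> growth_type f"
proof -
  have f_big: "\<forall>\<^sub>F r in at_top. max_modulus f (lam * r) > c" if "\<not> f constant_on UNIV" "lam > 0" for lam c
  proof -
    have "filterlim (\<lambda>r. max_modulus f (lam * r)) at_top at_top"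
      using that by (intro filterlim_compose[OF max_modulus_at_top[OF f]]
        filterlim_tendsto_pos_mult_at_top[OF tendsto_const _ filterlim_ident])
    then show ?thesis by (simp add: filterlim_at_top_dense)
  qed
  have H_big: "\<forall>\<^sub>F r in at_top. max_modulus H r > c" if "\<not> H constant_on UNIV" for c
    using max_modulus_at_top[OF H that] by (simp add: filterlim_at_top_dense)
  have f_order_nonneg: "growth_order f \<ge> 0"
  proof (cases "f constant_on UNIV")
    case False
    have "\<forall>\<^sub>F r in at_top. (0::ereal) \<le> ereal (ln (ln (max_modulus f r)) / ln r)"
      using f_big[OF False zero_less_one, of "exp 1"] eventually_gt_at_top[of 1]
    proof eventually_elim
      case (elim r)
      then have "ln (max_modulus f r) \<ge> ln (exp 1)" by (subst ln_le_cancel_iff) (auto intro: less_trans[OF exp_gt_zero])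
      then have "ln (max_modulus f r) \<ge> 1" by simp
      then show ?case using elim by simp
    qed
    then have "0 \<le> Limsup at_top (\<lambda>r. ereal (ln (ln (max_modulus f r)) / ln r))"
      by (intro le_Limsup) auto
    then show ?thesis using False by (simp add: growth_order_def)
  qed (simp add: growth_order_def)
  \<comment> \<open>Constants have order 0 by convention, so the limsup formula for \<open>f\<close>
    becomes available only through this.\<close>
  have nonconst: "\<not> f constant_on UNIV" if nc: "\<not> H constant_on UNIV"
  proof
    assume "f constant_on UNIV"
    then obtain c where c: "\<And>r. r \<ge> 0 \<Longrightarrow> max_modulus f r \<le> c"
      using max_modulus_const by blast
    obtain C where "C > 0" "\<forall>\<^sub>F r in at_top. max_modulus H r \<le> C * max_modulus f (2 * r)"
      using le[of 2] by auto
    from this(2) H_big[OF nc, of "C * c"] eventually_gt_at_top[of 0]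
    have "\<forall>\<^sub>F r::real in at_top. False"
    proof eventually_elim
      case (elim r)
      have "C * max_modulus f (2 * r) \<le> C * c"
        using c[of "2 * r"] \<open>C > 0\<close> elim by (intro mult_left_mono) auto
      with elim show ?case by linarith
    qed
    then show False by simp
  qed
  show "growth_order H \<le> growth_order f"
  proof (cases "H constant_on UNIV")
    case True
    then show ?thesis using f_order_nonneg by (simp add: growth_order_def)
  next
    case False
    note fnc = nonconst[OF False]
    show ?thesis
    \<comment> \<open>Comparing with real upper bounds \<open>c\<close> disposes of infinite order
      without a case distinction.\<close>
    proof (rule ereal_le_real)
      fix c assume fc: "growth_order f \<le> ereal c"
      then have c: "c \<ge> 0" using f_order_nonneg by (metis ereal_less_eq(5) order_trans)
      show "growth_order H \<le> ereal c"
      proof (rule ereal_le_epsilon2)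
        fix e :: real assume e: "e > 0"
        define b where "b = c + e / 2"
        have "Limsup at_top (\<lambda>r. ereal (ln (ln (max_modulus f r)) / ln r)) < ereal b"
          using fc e fnc by (simp add: growth_order_def b_def le_less_trans)
        then have "\<forall>\<^sub>F r in at_top. ereal (ln (ln (max_modulus f r)) / ln r) < ereal b"
          by (rule Limsup_lessD)
        moreover have "filterlim (\<lambda>r::real. 2 * r) at_top at_top" by real_asymp
        ultimately have ev1: "\<forall>\<^sub>F r in at_top. ereal (ln (ln (max_modulus f (2 * r))) / ln (2 * r)) < ereal b"
          by (rule eventually_compose_filterlim)
        obtain C where C: "C > 0" and ev2: "\<forall>\<^sub>F r in at_top. max_modulus H r \<le> C * max_modulus f (2 * r)"
          using le[of 2] by auto
        have "((\<lambda>r. (ln 2 + b * ln (2 * r)) / ln r) \<longlongrightarrow> b) at_top" by real_asymp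
        then have ev3: "\<forall>\<^sub>F r in at_top. (ln 2 + b * ln (2 * r)) / ln r < c + e"
          using e by (intro order_tendstoD) (auto simp: b_def)
        have two: "(2::real) > 0" by simp
        have "\<forall>\<^sub>F r in at_top. ereal (ln (ln (max_modulus H r)) / ln r) \<le> ereal (c + e)"
          using ev1 ev2 ev3 f_big[OF fnc two, of C] f_big[OF fnc two, of "exp 1"] H_big[OF False, of "exp 1"]
            eventually_gt_at_top[of 1]
        proof eventually_elim
          case (elim r)
          define M where "M = max_modulus f (2 * r)"
          have M: "M > exp 1" "M > C" using elim by (auto simp: M_def)
          have M0: "M > 0" using M(1) by (rule less_trans[OF exp_gt_zero])
          have H0: "max_modulus H r > 0" using elim(6) by (rule less_trans[OF exp_gt_zero])
          have lnM: "ln M > 1" using M(1) M0 by (metis exp_less_cancel_iff exp_ln)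
          have lnH: "ln (max_modulus H r) > 1" using elim(6) H0 by (metis exp_less_cancel_iff exp_ln)
          have "ln (max_modulus H r) \<le> ln (C * M)"
            using elim(2) H0 by (simp add: M_def)
          \<comment> \<open>\<open>C\<close> is absorbed by a second \<open>M\<close>, so the outer
            logarithm sees only an extra summand \<open>ln 2\<close>.\<close>
          also have "\<dots> \<le> ln (M * M)" using M M0 C by (intro ln_mono) auto
          also have "\<dots> = 2 * ln M" using M0 by (simp add: ln_mult)
          finally have "ln (ln (max_modulus H r)) \<le> ln (2 * ln M)"
            using lnH by (intro ln_mono) auto
          also have "\<dots> = ln 2 + ln (ln M)" using lnM by (simp add: ln_mult)
          also have "ln (ln M) \<le> b * ln (2 * r)"
            using elim(1) elim(7) by (simp add: M_def field_simps)
          finally have "ln (ln (max_modulus H r)) / ln r \<le> (ln 2 + b * ln (2 * r)) / ln r"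
            using elim(7) by (intro divide_right_mono) auto
          then show ?case using elim(3) by simp
        qed
        then have "Limsup at_top (\<lambda>r. ereal (ln (ln (max_modulus H r)) / ln r)) \<le> ereal (c + e)"
          by (rule Limsup_bounded)
        then show "growth_order H \<le> ereal c + ereal e" using False by (simp add: growth_order_def)
      qed
    qed
  qed
  assume pos: "0 < growth_order H" and eq: "growth_order H = growth_order f" and fin: "growth_order f < \<infinity>"
  have Hnc: "\<not> H constant_on UNIV" using pos by (auto simp: growth_order_def)
  note fnc = nonconst[OF Hnc]
  define \<rho> where "\<rho> = real_of_ereal (growth_order f)"
  have \<rho>: "\<rho> > 0" using pos eq fin by (cases "growth_order f") (auto simp: \<rho>_def)
  show "growth_type H \<le> growth_type f"
  proof (rule ereal_le_real)
    fix c assume fc: "growth_type f \<le> ereal c"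
    have "0 \<le> growth_type f"
      unfolding growth_type_def
    proof (rule le_Limsup)
      show "\<forall>\<^sub>F r in at_top. 0 \<le> ereal (ln (max_modulus f r) / r powr real_of_ereal (growth_order f))"
        using f_big[OF fnc zero_less_one, of 1] by eventually_elim simp
    qed simp
    then have c: "c \<ge> 0" using fc by (metis ereal_less_eq(5) order_trans)
    show "growth_type H \<le> ereal c"
    proof (rule ereal_le_epsilon2)
      fix e :: real assume e: "e > 0"
      define b where "b = c + e / 2"
      have b: "b > 0" using c e by (simp add: b_def)
      \<comment> \<open>\<open>lam\<close> is chosen after \<open>e\<close>, so near to 1 that the
        dilation uses up less than the remaining \<open>e / 2\<close>.\<close>
      have "((\<lambda>lam. b * lam powr \<rho>) \<longlongrightarrow> b * 1 powr \<rho>) (at_right 1)"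
        by (intro tendsto_intros) auto
      then have "((\<lambda>lam. b * lam powr \<rho>) \<longlongrightarrow> b) (at_right 1)" by simp
      then have "\<forall>\<^sub>F lam in at_right 1. b * lam powr \<rho> < c + e"
        using e by (intro order_tendstoD) (auto simp: b_def)
      then have "\<forall>\<^sub>F lam in at_right (1::real). b * lam powr \<rho> < c + e \<and> lam > 1"
        using eventually_at_right_less[of "1::real"] by eventually_elim auto
      then obtain lam where lam: "b * lam powr \<rho> < c + e" "lam > 1"
        using eventually_happens trivial_limit_at_right_real by blast
      have "growth_type f < ereal b" using fc e by (simp add: b_def le_less_trans)
      then have "\<forall>\<^sub>F r in at_top. ereal (ln (max_modulus f r) / r powr \<rho>) < ereal b"
        unfolding growth_type_def \<rho>_def by (rule Limsup_lessD)
      moreover have "filterlim (\<lambda>r::real. lam * r) at_top at_top"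
        using lam(2) by (intro filterlim_tendsto_pos_mult_at_top[OF tendsto_const _ filterlim_ident]) auto
      ultimately have ev1: "\<forall>\<^sub>F r in at_top. ereal (ln (max_modulus f (lam * r)) / (lam * r) powr \<rho>) < ereal b"
        by (rule eventually_compose_filterlim)
      obtain C where C: "C > 0" and ev2: "\<forall>\<^sub>F r in at_top. max_modulus H r \<le> C * max_modulus f (lam * r)"
        using le[OF lam(2)] by auto
      have "((\<lambda>r. 1 / r powr \<rho>) \<longlongrightarrow> 0) at_top"
        using \<rho> by real_asymp
      from tendsto_add[OF tendsto_mult[OF tendsto_const[of "ln C"] this] tendsto_const[of "b * lam powr \<rho>"]]
      have "((\<lambda>r. ln C / r powr \<rho> + b * lam powr \<rho>) \<longlongrightarrow> b * lam powr \<rho>) at_top"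
        by simp
      then have ev3: "\<forall>\<^sub>F r in at_top. ln C / r powr \<rho> + b * lam powr \<rho> < c + e"
        using lam(1) by (intro order_tendstoD) auto
      have lam0: "lam > 0" using lam(2) by simp
      have "\<forall>\<^sub>F r in at_top. ereal (ln (max_modulus H r) / r powr \<rho>) \<le> ereal (c + e)"
        using ev1 ev2 ev3 f_big[OF fnc lam0, of 1] H_big[OF Hnc, of 1] eventually_gt_at_top[of 0]
      proof eventually_elim
        case (elim r)
        define M where "M = max_modulus f (lam * r)"
        have M: "M > 1" using elim by (auto simp: M_def)
        have "ln (max_modulus H r) \<le> ln (C * M)"
          using elim(2,5) by (simp add: M_def)
        also have "\<dots> = ln C + ln M" using M C by (simp add: ln_mult)
        also have "ln M \<le> b * (lam * r) powr \<rho>"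
          using elim(1,6) lam0 by (simp add: M_def field_simps)
        also have "(lam * r) powr \<rho> = lam powr \<rho> * r powr \<rho>"
          using lam0 elim(6) by (simp add: powr_mult)
        finally have "ln (max_modulus H r) / r powr \<rho> \<le> (ln C + b * (lam powr \<rho> * r powr \<rho>)) / r powr \<rho>"
          by (intro divide_right_mono) auto
        also have "\<dots> = ln C / r powr \<rho> + b * lam powr \<rho>"
          using elim(6) by (simp add: add_divide_distrib)
        finally show ?case using elim(3) by simp
      qed
      then have "Limsup at_top (\<lambda>r. ereal (ln (max_modulus H r) / r powr \<rho>)) \<le> ereal (c + e)"
        by (rule Limsup_bounded)
      then show "growth_type H \<le> ereal c + ereal e" by (simp add: growth_type_def eq \<rho>_def)
    qed
  qed
qed

section \<open>The Dirichlet problem on the ellipsoid\<close>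

lemma complex_vec_add_scaleR: "complex_vec (x + t *\<^sub>R axis i 1) = complex_vec x + of_real t *s axis i 1"
  by (auto simp: complex_vec_def vec_eq_iff axis_def)

lemma continuous_on_complex_vec: "continuous_on S complex_vec"
  unfolding complex_vec_def by (intro continuous_intros)

lemma has_vector_derivative_restriction:
  assumes "entire F"
  shows "((\<lambda>t::real. F (complex_vec (x + t *\<^sub>R axis i 1))) has_vector_derivative pd i F (complex_vec x)) (at 0)"
proof -
  have "((\<lambda>t. F (complex_vec x + t *s axis i 1)) has_field_derivative pd i F (complex_vec x)) (at (of_real 0))"
    using entire_line_deriv[OF assms, of "complex_vec x" "axis i 1" 0]
    by (simp add: axis_def if_distrib[of "\<lambda>x. x * _"] cong: if_cong)
  from has_vector_derivative_real_field[OF this] show ?thesis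
    by (simp add: complex_vec_add_scaleR)
qed

lemma partial_deriv_restriction:
  "entire F \<Longrightarrow> partial_deriv (axis i 1) (\<lambda>x. F (complex_vec x)) = (\<lambda>x. pd i F (complex_vec x))"
  unfolding partial_deriv_def[abs_def]
  by (rule ext, rule vector_derivative_at, rule has_vector_derivative_restriction)

lemma C1_on_restriction:
  assumes "entire F"
  shows "C1_on S (\<lambda>x. F (complex_vec x))"
  unfolding C1_on_def Basis_vec_def
  using has_vector_derivative_restriction[OF assms]
  by (auto simp: partial_deriv_restriction[OF assms] intro!: differentiableI_vector
      continuous_on_compose2[OF entire_continuous[OF entire_pd[OF assms], of UNIV] continuous_on_complex_vec])

lemma harmonic_on_restriction:
  fixes F :: "complex ^ 'n \<Rightarrow> complex"
  assumes "entire F" "\<And>x. lap F (complex_vec x) = 0" "open S"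
  shows "harmonic_on S (\<lambda>x. F (complex_vec x))"
  unfolding harmonic_on_def C2_on_def
proof (intro conjI ballI)
  show "C1_on S (\<lambda>x. F (complex_vec x))" by (rule C1_on_restriction[OF assms(1)])
  fix b :: "real ^ 'n" assume "b \<in> Basis"
  then obtain i where b: "b = axis i 1" by (auto simp: Basis_vec_def)
  show "C1_on S (partial_deriv b (\<lambda>x. F (complex_vec x)))"
    unfolding b partial_deriv_restriction[OF assms(1)]
    by (rule C1_on_restriction[OF entire_pd[OF assms(1)]])
next
  fix x
  have B: "(Basis :: (real ^ 'n) set) = (\<lambda>i. axis i 1) ` UNIV" by (auto simp: Basis_vec_def)
  have inj: "inj (\<lambda>i::'n. axis i (1::real))" by (auto simp: inj_on_def axis_eq_axis)
  have "laplacian (\<lambda>x. F (complex_vec x)) x =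
      (\<Sum>i\<in>UNIV. partial_deriv (axis i 1) (partial_deriv (axis i 1) (\<lambda>x. F (complex_vec x))) x)"
    unfolding laplacian_def B by (simp add: sum.reindex[OF inj])
  also have "\<dots> = lap F (complex_vec x)"
    by (simp add: partial_deriv_restriction assms(1) entire_pd lap_def)
  finally show "laplacian (\<lambda>x. F (complex_vec x)) x = 0" by (simp add: assms(2))
qed (rule assms(3))

section \<open>The maximum principle for harmonic functions on bounded open sets\<close>

lemma second_derivative_nonpos_at_local_max:
  fixes g g' :: "real \<Rightarrow> real"
  assumes "d > 0" and g: "\<And>t. \<bar>t\<bar> < d \<Longrightarrow> (g has_real_derivative g' t) (at t)"
    and g': "(g' has_real_derivative D) (at 0)"
    and max: "\<And>t. \<bar>t\<bar> < d \<Longrightarrow> g t \<le> g 0"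
  shows "D \<le> 0"
proof (rule ccontr)
  assume "\<not> D \<le> 0"
  then have "D > 0" by simp
  have "g' 0 = 0"
    by (rule DERIV_local_max[OF g[of 0] \<open>d > 0\<close>]) (use assms in auto)
  from DERIV_pos_inc_right[OF g' \<open>D > 0\<close>] obtain e where e: "e > 0" "\<And>h. 0 < h \<Longrightarrow> h < e \<Longrightarrow> g' 0 < g' h"
    by auto
  define t where "t = min d e / 2"
  have t: "0 < t" "t < d" "t < e" using \<open>d > 0\<close> e(1) by (auto simp: t_def)
  have "g 0 < g t"
  proof (rule DERIV_pos_imp_increasing_open[OF t(1)])
    fix s assume "0 < s" "s < t"
    then show "\<exists>y. DERIV g s :> y \<and> y > 0"
      using g[of s] e(2)[of s] t \<open>g' 0 = 0\<close> by auto
  next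
    have "isCont g s" if "s \<in> {0..t}" for s
      using g[of s] that t by (intro DERIV_isCont) auto
    then show "continuous_on {0..t} g" by (simp add: continuous_at_imp_continuous_on)
  qed
  with max[of t] t show False by simp
qed

text \<open>Adding \<open>e * |x|\<^sup>2\<close> makes the real part strictly subharmonic, which excludes an interior maximum.\<close>

lemma maximum_principle_Re:
  fixes w :: "'a::euclidean_space \<Rightarrow> complex"
  assumes S: "open S" "bounded S" and w: "harmonic_on S w" and cont: "continuous_on (closure S) w"
    and 0: "\<And>x. x \<in> frontier S \<Longrightarrow> w x = 0" and x: "x \<in> closure S"
  shows "Re (w x) \<le> 0"
proof (rule ccontr)
  assume "\<not> Re (w x) \<le> 0"
  then have pos: "Re (w x) > 0" by simp
  have comp: "compact (closure S)" using S(2) by (simp add: compact_closure)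
  obtain B where B: "B > 0" "\<And>y. y \<in> closure S \<Longrightarrow> norm y \<le> B"
    using bounded_closure[OF S(2)] by (auto simp: bounded_pos)
  \<comment> \<open>Small enough that the added term is at most \<open>Re (w x) / 2\<close> on the
    closure; thus \<open>v\<close> on the frontier stays below \<open>v x\<close>, and its maximum
    lies inside.\<close>
  define e where "e = Re (w x) / (2 * B\<^sup>2)"
  have e: "e > 0" using pos B by (simp add: e_def)
  define v where "v = (\<lambda>y. Re (w y) + e * (y \<bullet> y))"
  have "continuous_on (closure S) v"
    unfolding v_def by (intro continuous_intros cont)
  moreover have "closure S \<noteq> {}" using x by (metis empty_iff)
  ultimately obtain p where p: "p \<in> closure S" "\<And>y. y \<in> closure S \<Longrightarrow> v y \<le> v p"
    using continuous_attains_sup[OF comp, of v] by blast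
  have "p \<in> S"
  proof (rule ccontr)
    assume "p \<notin> S"
    then have "p \<in> frontier S" using p(1) S(1) by (simp add: frontier_def interior_open)
    then have "v p = e * (norm p)\<^sup>2" by (simp add: v_def 0 power2_norm_eq_inner)
    also have "\<dots> \<le> e * B\<^sup>2" using B(2)[OF p(1)] e by (intro mult_left_mono power_mono) auto
    also have "\<dots> = Re (w x) / 2" using B(1) by (simp add: e_def)
    finally have "v p \<le> Re (w x) / 2" .
    moreover have "v x \<ge> Re (w x)" using e by (simp add: v_def)
    ultimately show False using p(2)[OF x] pos by simp
  qed
  then obtain d where d: "d > 0" "ball p d \<subseteq> S" using S(1) by (auto simp: open_contains_ball)
  \<comment> \<open>The second derivative test for \<open>v\<close> along each axis at the interior
    maximum \<open>p\<close>; summed over the basis it contradicts the vanishing Laplacian.\<close>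
  have "Re (partial_deriv b (partial_deriv b w) p) + 2 * e \<le> 0" if b: "b \<in> Basis" for b
  proof (rule second_derivative_nonpos_at_local_max[OF d(1)])
    define g' where "g' = (\<lambda>t. Re (partial_deriv b w (p + t *\<^sub>R b)) + e * (2 * (p \<bullet> b) + 2 * t))"
    have bb: "b \<bullet> b = 1" using b by (simp add: inner_same_Basis)
    have inS: "p + t *\<^sub>R b \<in> S" if "\<bar>t\<bar> < d" for t
      using that d(2) b by (auto simp: subset_iff dist_norm)
    have der: "((\<lambda>t. u (y + t *\<^sub>R b)) has_vector_derivative partial_deriv b u y) (at 0)"
      if "C1_on S u" "y \<in> S" for u y
      using that b unfolding C1_on_def partial_deriv_def by (auto simp: vector_derivative_works)
    have C1: "C1_on S w" "C1_on S (partial_deriv b w)"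
      using w b by (auto simp: harmonic_on_def C2_on_def)
    have quad: "((\<lambda>t. e * ((p + t *\<^sub>R b) \<bullet> (p + t *\<^sub>R b))) has_real_derivative e * (2 * (p \<bullet> b) + 2 * t)) (at t)" for t
    proof -
      have "(\<lambda>t. e * ((p + t *\<^sub>R b) \<bullet> (p + t *\<^sub>R b))) = (\<lambda>t. e * (p \<bullet> p + 2 * t * (p \<bullet> b) + t * t))"
        using bb by (simp add: fun_eq_iff inner_add_left inner_add_right inner_commute algebra_simps)
      then show ?thesis by (auto intro!: derivative_eq_intros simp: algebra_simps)
    qed
    show "((\<lambda>t. v (p + t *\<^sub>R b)) has_real_derivative g' t) (at t)" if t: "\<bar>t\<bar> < d" for t
    proof -
      have "((\<lambda>s. Re (w ((p + t *\<^sub>R b) + s *\<^sub>R b))) has_real_derivative Re (partial_deriv b w (p + t *\<^sub>R b))) (at 0)"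
        using der[OF C1(1) inS[OF t]]
        unfolding has_real_derivative_iff_has_vector_derivative
        by (rule bounded_linear.has_vector_derivative[OF bounded_linear_Re])
      then have "((\<lambda>s. Re (w (p + (s + t) *\<^sub>R b))) has_real_derivative Re (partial_deriv b w (p + t *\<^sub>R b))) (at 0)"
        by (simp add: algebra_simps)
      then have "((\<lambda>s. Re (w (p + s *\<^sub>R b))) has_real_derivative Re (partial_deriv b w (p + t *\<^sub>R b))) (at (0 + t))"
        by (subst DERIV_shift)
      from DERIV_add[OF this, OF quad[of "0 + t"]] show ?thesis
        unfolding v_def g'_def by simp
    qed
    have "((\<lambda>s. Re (partial_deriv b w (p + s *\<^sub>R b))) has_real_derivative Re (partial_deriv b (partial_deriv b w) p)) (at 0)"
      using der[OF C1(2) \<open>p \<in> S\<close>]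
      unfolding has_real_derivative_iff_has_vector_derivative
      by (rule bounded_linear.has_vector_derivative[OF bounded_linear_Re])
    moreover have "((\<lambda>t. e * (2 * (p \<bullet> b) + 2 * t)) has_real_derivative 2 * e) (at 0)"
      by (auto intro!: derivative_eq_intros)
    ultimately show "(g' has_real_derivative Re (partial_deriv b (partial_deriv b w) p) + 2 * e) (at 0)"
      unfolding g'_def by (rule DERIV_add)
    show "v (p + t *\<^sub>R b) \<le> v (p + 0 *\<^sub>R b)" if "\<bar>t\<bar> < d" for t
      using p(2)[of "p + t *\<^sub>R b"] inS[OF that] closure_subset by auto
  qed
  then have "(\<Sum>b\<in>(Basis :: 'a set). Re (partial_deriv b (partial_deriv b w) p) + 2 * e) \<le> 0"
    by (rule sum_nonpos)
  moreover have "(\<Sum>b\<in>(Basis :: 'a set). Re (partial_deriv b (partial_deriv b w) p)) = 0"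
    using w \<open>p \<in> S\<close> by (simp add: harmonic_on_def laplacian_def flip: Re_sum)
  ultimately have "real DIM('a) * (2 * e) \<le> 0" by (simp add: sum.distrib)
  then show False using e by (simp add: mult_le_0_iff)
qed

section \<open>Linear combinations of harmonic functions and uniqueness\<close>

lemma partial_deriv_cong_open:
  fixes x :: "'a::euclidean_space"
  assumes "open S" "x \<in> S" "\<And>y. y \<in> S \<Longrightarrow> u y = v y"
    and "((\<lambda>t::real. u (x + t *\<^sub>R b)) has_vector_derivative D) (at 0)"
  shows "((\<lambda>t::real. v (x + t *\<^sub>R b)) has_vector_derivative D) (at 0)"
proof (rule has_vector_derivative_transform_within_open[OF assms(4)])
  show "open ((\<lambda>t. x + t *\<^sub>R b) -` S)"
    by (intro open_vimage assms(1) continuous_intros)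
  show "0 \<in> (\<lambda>t. x + t *\<^sub>R b) -` S" using assms(2) by simp
qed (use assms(3) in auto)

text \<open>Only the behaviour of \<open>partial_deriv\<close> on \<open>S\<close> counts, so any
  \<open>D\<close> that gives the derivatives there may stand for it.\<close>

lemma C1_on_iff:
  "C1_on S u \<longleftrightarrow> (\<exists>D. \<forall>b\<in>Basis. (\<forall>x\<in>S. ((\<lambda>t::real. u (x + t *\<^sub>R b)) has_vector_derivative D b x) (at 0))
     \<and> continuous_on S (D b))"
  (is "_ \<longleftrightarrow> ?R")
proof
  assume "C1_on S u"
  then show ?R
    by (intro exI[of _ "\<lambda>b. partial_deriv b u"]) (auto simp: C1_on_def partial_deriv_def vector_derivative_works)
next
  assume ?R
  then obtain D where D: "\<And>b x. b \<in> Basis \<Longrightarrow> x \<in> S \<Longrightarrow> ((\<lambda>t::real. u (x + t *\<^sub>R b)) has_vector_derivative D b x) (at 0)"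
    "\<And>b. b \<in> Basis \<Longrightarrow> continuous_on S (D b)" by blast
  have "partial_deriv b u x = D b x" if "b \<in> Basis" "x \<in> S" for b x
    unfolding partial_deriv_def by (rule vector_derivative_at[OF D(1)[OF that]])
  then have "continuous_on S (partial_deriv b u)" if "b \<in> Basis" for b
    using D(2)[OF that] that by (simp cong: continuous_on_cong)
  then show "C1_on S u"
    using D(1) unfolding C1_on_def by (blast intro: differentiableI_vector)
qed

lemma C1_on_has_partial_deriv:
  "C1_on S u \<Longrightarrow> b \<in> Basis \<Longrightarrow> x \<in> S \<Longrightarrow>
    ((\<lambda>t. u (x + t *\<^sub>R b)) has_vector_derivative partial_deriv b u x) (at 0)"
  by (auto simp: C1_on_def partial_deriv_def vector_derivative_works)

text \<open>\<open>w\<close> is required to be the combination on \<open>S\<close> only, since the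
  partial derivatives of a combination are known only there. This permits a second application, to
  the first derivatives.\<close>

lemma C1_on_lincomb:
  assumes "open S" "C1_on S u" "C1_on S v" and w: "\<And>x. x \<in> S \<Longrightarrow> w x = c * u x + d * v x"
  shows "C1_on S w"
    and "b \<in> Basis \<Longrightarrow> x \<in> S \<Longrightarrow> partial_deriv b w x = c * partial_deriv b u x + d * partial_deriv b v x"
proof -
  have der: "((\<lambda>t. w (x + t *\<^sub>R b)) has_vector_derivative c * partial_deriv b u x + d * partial_deriv b v x) (at 0)"
    if "b \<in> Basis" "x \<in> S" for b x
  proof (rule partial_deriv_cong_open[OF assms(1) that(2)])
    show "((\<lambda>t. c * u (x + t *\<^sub>R b) + d * v (x + t *\<^sub>R b)) has_vector_derivative
        c * partial_deriv b u x + d * partial_deriv b v x) (at 0)"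
      by (intro has_vector_derivative_add bounded_linear.has_vector_derivative[OF bounded_linear_mult_right]
          C1_on_has_partial_deriv[OF assms(2) that] C1_on_has_partial_deriv[OF assms(3) that])
  qed (simp add: w)
  show "partial_deriv b w x = c * partial_deriv b u x + d * partial_deriv b v x" if "b \<in> Basis" "x \<in> S" for b x
    unfolding partial_deriv_def[of b w] by (rule vector_derivative_at[OF der[OF that]])
  show "C1_on S w"
    unfolding C1_on_iff
  proof (intro exI[of _ "\<lambda>b x. c * partial_deriv b u x + d * partial_deriv b v x"] ballI conjI der)
    fix b assume "b \<in> (Basis :: 'a set)"
    then show "continuous_on S (\<lambda>x. c * partial_deriv b u x + d * partial_deriv b v x)"
      using assms(2,3) by (intro continuous_intros) (auto simp: C1_on_def)
  qed
qed

lemma harmonic_on_lincomb: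
  assumes u: "harmonic_on S u" and v: "harmonic_on S v"
  shows "harmonic_on S (\<lambda>x. c * u x + d * v x)"
proof -
  have S: "open S" using u by (simp add: harmonic_on_def)
  have C: "C1_on S u" "C1_on S v" "\<And>b. b \<in> Basis \<Longrightarrow> C1_on S (partial_deriv b u)"
    "\<And>b. b \<in> Basis \<Longrightarrow> C1_on S (partial_deriv b v)"
    using u v by (auto simp: harmonic_on_def C2_on_def)
  note 1 = C1_on_lincomb[OF S C(1,2), of "\<lambda>x. c * u x + d * v x" c d]
  have 2: "C1_on S (partial_deriv b (\<lambda>x. c * u x + d * v x))"
    "x \<in> S \<Longrightarrow> partial_deriv b (partial_deriv b (\<lambda>x. c * u x + d * v x)) x =
      c * partial_deriv b (partial_deriv b u) x + d * partial_deriv b (partial_deriv b v) x"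
    if b: "b \<in> Basis" for b x
    using C1_on_lincomb[OF S C(3)[OF b] C(4)[OF b], of "partial_deriv b (\<lambda>x. c * u x + d * v x)" c d] 1(2)[of b] b
    by auto
  have "laplacian (\<lambda>x. c * u x + d * v x) x = c * laplacian u x + d * laplacian v x" if "x \<in> S" for x
    using that by (simp add: laplacian_def 2(2) sum.distrib sum_distrib_left)
  then show ?thesis
    using S 1(1) 2(1) u v by (simp add: harmonic_on_def C2_on_def)
qed

lemma dirichlet_solution_unique:
  assumes S: "bounded S" and u: "dirichlet_solution S f u" and v: "dirichlet_solution S f v" and x: "x \<in> closure S"
  shows "u x = v x"
proof -
  have op: "open S" using u by (simp add: dirichlet_solution_def harmonic_on_def)
  \<comment> \<open>The maximum principle bounds real parts from above; the values \<open>1\<close>,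
    \<open>-1\<close>, \<open>\<i>\<close>, \<open>-\<i>\<close> of \<open>c\<close> recover the
    whole complex difference.\<close>
  have "Re (c * u x + (- c) * v x) \<le> 0" for c
  proof (rule maximum_principle_Re[OF op S _ _ _ x])
    show "harmonic_on S (\<lambda>x. c * u x + (- c) * v x)"
      using u v by (intro harmonic_on_lincomb) (auto simp: dirichlet_solution_def)
    show "continuous_on (closure S) (\<lambda>x. c * u x + (- c) * v x)"
      using u v by (intro continuous_intros) (auto simp: dirichlet_solution_def)
    show "c * u y + (- c) * v y = 0" if "y \<in> frontier S" for y
      using u v that by (simp add: dirichlet_solution_def)
  qed
  from this[of 1] this[of "-1"] this[of \<i>] this[of "-\<i>"] show ?thesis
    by (simp add: complex_eq_iff)
qed

lemma qform_complex_vec: "qform a (complex_vec x) = of_real (\<Sum>i\<in>UNIV. (x $ i)\<^sup>2 / (a $ i)\<^sup>2)"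
  by (simp add: qform_def complex_vec_def)

context ellipsoid_axes
begin

lemma continuous_on_qform_real: "continuous_on S (\<lambda>x :: real ^ 'n. \<Sum>i\<in>UNIV. (x $ i)\<^sup>2 / (a $ i)\<^sup>2)"
  using a_pos by (intro continuous_intros) (auto simp: less_imp_neq[symmetric])

lemma open_ellipsoid: "open (ellipsoid a)"
  unfolding ellipsoid_def by (intro open_Collect_less continuous_on_qform_real continuous_intros)

lemma bounded_ellipsoid: "bounded (ellipsoid a)"
proof -
  have "norm x \<le> sqrt (1 / lo)" if "x \<in> ellipsoid a" for x
  proof -
    have "lo * (norm x)\<^sup>2 = lo * (\<Sum>i\<in>UNIV. (x $ i)\<^sup>2)"
      by (simp add: norm_vec_def L2_set_def real_sqrt_pow2 sum_nonneg)
    also have "\<dots> \<le> (\<Sum>i\<in>UNIV. (x $ i)\<^sup>2 / (a $ i)\<^sup>2)" by (rule qform_bounds(1))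
    also have "\<dots> \<le> 1" using that by (simp add: ellipsoid_def)
    finally have "(norm x)\<^sup>2 \<le> 1 / lo" using lo_pos by (simp add: field_simps)
    then show ?thesis by (rule real_le_rsqrt)
  qed
  then show ?thesis by (auto simp: bounded_iff)
qed

lemma frontier_ellipsoid: "x \<in> frontier (ellipsoid a) \<Longrightarrow> qform a (complex_vec x) = 1"
proof -
  assume x: "x \<in> frontier (ellipsoid a)"
  have "closed {x. (\<Sum>i\<in>UNIV. (x $ i)\<^sup>2 / (a $ i)\<^sup>2) \<le> 1}"
    by (intro closed_Collect_le continuous_on_qform_real continuous_intros)
  then have "closure (ellipsoid a) \<subseteq> {x. (\<Sum>i\<in>UNIV. (x $ i)\<^sup>2 / (a $ i)\<^sup>2) \<le> 1}"
    by (intro closure_minimal) (auto simp: ellipsoid_def)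
  with x have "(\<Sum>i\<in>UNIV. (x $ i)\<^sup>2 / (a $ i)\<^sup>2) \<le> 1" by (auto simp: frontier_def)
  moreover have "x \<notin> ellipsoid a"
    using x open_ellipsoid by (simp add: frontier_def interior_open)
  ultimately have "(\<Sum>i\<in>UNIV. (x $ i)\<^sup>2 / (a $ i)\<^sup>2) = 1" by (simp add: ellipsoid_def)
  then show ?thesis by (simp add: qform_complex_vec)
qed

end

theorem theorem2:
  fixes a :: "real ^ 'n"
    and f :: "complex ^ 'n \<Rightarrow> complex"
  assumes "\<And>i. a $ i > 0"
    and "entire f"
  shows "(\<exists>h. dirichlet_solution (ellipsoid a) (\<lambda>x. f (complex_vec x)) h) \<and>
    (\<forall>h. dirichlet_solution (ellipsoid a) (\<lambda>x. f (complex_vec x)) h \<longrightarrow>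
      (\<exists>u. harmonic_on UNIV u \<and> (\<forall>x\<in>closure (ellipsoid a). u x = h x) \<and>
        (\<exists>H. entire H \<and> (\<forall>x. H (complex_vec x) = u x) \<and>
          growth_order H \<le> growth_order f \<and>
          (0 < growth_order H \<and> growth_order H = growth_order f \<and> growth_order f < \<infinity> \<longrightarrow>
            growth_type H \<le> growth_type f))))"
proof -
  interpret ellipsoid_axes a by standard (rule assms(1))
  obtain H where H: "entire H" "\<And>z. lap H z = 0" "\<And>z. qform a z = 1 \<Longrightarrow> H z = f z"
    and bound: "\<And>lam. lam > 1 \<Longrightarrow>
      \<exists>C>0. \<forall>r. r\<^sup>2 \<ge> 2 / lo \<longrightarrow> r > 0 \<longrightarrow> max_modulus H r \<le> C * max_modulus f (lam * r)"
    using harmonic_extension[OF assms(2)] by blast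
  define u where "u = (\<lambda>x. H (complex_vec x))"
  have harm: "harmonic_on S u" if "open S" for S
    unfolding u_def using H(1,2) that by (intro harmonic_on_restriction)
  have sol: "dirichlet_solution (ellipsoid a) (\<lambda>x. f (complex_vec x)) u"
    unfolding dirichlet_solution_def
  proof (intro conjI ballI)
    show "continuous_on (closure (ellipsoid a)) u"
      unfolding u_def
      by (rule continuous_on_compose2[OF entire_continuous[OF H(1), of UNIV] continuous_on_complex_vec]) simp
    show "harmonic_on (ellipsoid a) u" by (rule harm[OF open_ellipsoid])
    show "u x = f (complex_vec x)" if "x \<in> frontier (ellipsoid a)" for x
      using H(3)[OF frontier_ellipsoid[OF that]] by (simp add: u_def)
  qed
  have ev: "\<exists>C>0. \<forall>\<^sub>F r in at_top. max_modulus H r \<le> C * max_modulus f (lam * r)" if "lam > 1" for lam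
  proof -
    obtain C where C: "C > 0" "\<And>r. r\<^sup>2 \<ge> 2 / lo \<Longrightarrow> r > 0 \<Longrightarrow> max_modulus H r \<le> C * max_modulus f (lam * r)"
      using bound[OF \<open>lam > 1\<close>] by blast
    have "\<forall>\<^sub>F r in at_top. max_modulus H r \<le> C * max_modulus f (lam * r)"
      using eventually_ge_at_top[of "sqrt (2 / lo)"] eventually_gt_at_top[of 0]
    proof eventually_elim
      case (elim r)
      then show ?case using lo_pos by (intro C(2)) (auto intro: sqrt_le_D)
    qed
    with C(1) show ?thesis by blast
  qed
  show ?thesis
  proof (intro conjI exI[of _ u] sol allI impI exI[of _ H])
    fix h assume h: "dirichlet_solution (ellipsoid a) (\<lambda>x. f (complex_vec x)) h"
    show "harmonic_on UNIV u" by (rule harm) simp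
    \<comment> \<open>An arbitrary solution \<open>h\<close> may differ from \<open>u\<close> off
      the closure; uniqueness identifies the two exactly where the Dirichlet problem constrains
      \<open>h\<close>.\<close>
    show "\<forall>x\<in>closure (ellipsoid a). u x = h x"
      using dirichlet_solution_unique[OF bounded_ellipsoid sol h] by blast
    show "entire H" by (rule H(1))
    show "H (complex_vec x) = u x" for x by (simp add: u_def)
    show "growth_order H \<le> growth_order f"
      by (rule growth_order_mono[OF assms(2) H(1) ev])
    show "growth_type H \<le> growth_type f"
      if "0 < growth_order H \<and> growth_order H = growth_order f \<and> growth_order f < \<infinity>"
      using that by (intro growth_type_mono[OF assms(2) H(1) ev]) auto
  qed
qed

end
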